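(* Let $I\subseteq\mathbb{R}$ be a nonempty open interval and let $f,g,h,k:I\to\mathbb{R}$ be continuously differentiable functions such that $g$ and $k$ are positive on $I$ and the derivatives $(f/g)'$ and $(h/k)'$ do not vanish anywhere in $I$. Consider the following assertions. (i) $\mathscr{B}_{f,g}(x,y)=\mathscr{B}_{h,k}(x,y)$ for all $x,y\in I$. (ii) Either $(f,g)\sim(h,k)$ or there exist real constants $\alpha,\beta,\gamma$ such that $$W_{f',g'}=\alpha\,(W_{f,g})^3,\qquad W_{h',k'}=\beta\,(W_{h,k})^3,\qquad W_{h,k}=\gamma W_{f,g}$$ hold on $I$. (iii) Either $(f,g)\sim(h,k)$ or there exist real constants $a,b,c,A,B,C,\gamma$ such that $$af^2+bfg+cg^2=1,\qquad Ah^2+Bhk+Ck^2=1,\qquad W_{h,k}=\gamma W_{f,g}$$ hold on $I$. (iv) Either $(f,g)\sim(h,k)$ or there exist two real polynomials $P$ and $Q$ of at most second degree which are positive on the ranges of $f/g$ and $h/k$, respectively, and there exist real constants $\gamma$ and $\delta$ such that $$g=\frac{1}{\sqrt P}\circ\frac fg,\qquad k=\frac1{\sqrt Q}\circ\frac hk,\qquad \Big(\int\frac1Q\Big)\circ\frac hk=\gamma\Big(\int\frac1P\Big)\circ\frac fg+\delta .$$ (v) Either $(f,g)\sim(h,k)$ or there exist a continuous strictly monotone function $w:I\to\mathbb{R}$ and real constants $\alpha$ and $\beta$ such that $$(f,g)\sim(S_\alpha\circ w,\,C_\alpha\circ w)\qquad\text{and}\qquad (h,k)\sim(S_\beta\circ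 w,\,C_\beta\circ w).$$ (vi) Either $(f,g)\sim(h,k)$ or $\mathscr{B}_{f,g}=\mathscr{B}_{w,1}=\mathscr{B}_{h,k}$ holds on $I^2$ with $w:=\int W_{f,g}$. (vii) Either $(f,g)\sim(h,k)$ or there exists a continuous strictly monotone function $w:I\to\mathbb{R}$ such that $\mathscr{B}_{f,g}=\mathscr{B}_{w,1}=\mathscr{B}_{h,k}$ holds on $I^2$. Then the assertions (i), (iii), (iv), (v), (vi), (vii) are equivalent to each other. If, in addition, $f,g,h,k$ are twice continuously differentiable, then assertion (ii) is also equivalent to the other ones.
   Context: For a nonempty open interval $I$ and functions $f,g:I\to\mathbb{R}$ with $g$ continuous and positive and $f/g$ continuous and strictly monotone, the two-variable Bajraktarević mean $\mathscr{B}_{f,g}:I^2\to I$ is $$\mathscr{B}_{f,g}(x,y):=\Big(\frac fg\Big)^{-1}\Big(\frac{f(x)+f(y)}{g(x)+g(y)}\Big)\qquad(x,y\in I).$$ In $\mathscr{B}_{w,1}$ the symbol $1$ denotes the constant function $1$. For pairs of functions, $(f,g)\sim(h,k)$ means that there exist real constants $a,b,c,d$ with $ad-bc\neq0$ such that $h=af+bg$ and $k=cf+dg$ hold on $I$. For differentiable $f,g:I\to\mathbb{R}$, the Wronskian is $W_{f,g}:=f'g-fg'$; accordingly $W_{f',g'}=f''g'-f'g''$. For $\alpha\in\mathbb{R}$, the functions $S_\alpha,C_\alpha:\mathbb{R}\to\mathbb{R}$ are $$S_\alpha(t):=\sum_{k=0}^\infty\frac{\alpha^kt^{2k+1}}{(2k+1)!},\qquad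 C_\alpha(t):=\sum_{k=0}^\infty\frac{\alpha^kt^{2k}}{(2k)!},$$ i.e. $S_\alpha(t)=\sin(\sqrt{-\alpha}\,t)/\sqrt{-\alpha}$, $C_\alpha(t)=\cos(\sqrt{-\alpha}\,t)$ if $\alpha<0$; $S_0(t)=t$, $C_0(t)=1$; $S_\alpha(t)=\sinh(\sqrt{\alpha}\,t)/\sqrt{\alpha}$, $C_\alpha(t)=\cosh(\sqrt\alpha\,t)$ if $\alpha>0$. The symbol $\int F$ denotes an antiderivative (primitive function) of a continuous function $F$ on the interval in question (the range of $f/g$ for $1/P$, the range of $h/k$ for $1/Q$, and $I$ for $W_{f,g}$); the choice of the additive constant is immaterial. *)

theory Defs
  imports "HOL-Analysis.Analysis" "HOL-Computational_Algebra.Polynomial"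
begin

text \<open>
  Functions on an open interval \<open>I\<close> are represented by total functions on the reals, of which only
  the values on \<open>I\<close> matter; in particular \<^const>\<open>deriv\<close> at a point of the open set \<open>I\<close> depends only
  on those values.
\<close>

definition bajraktarevic :: "real set \<Rightarrow> (real \<Rightarrow> real) \<Rightarrow> (real \<Rightarrow> real) \<Rightarrow> real \<Rightarrow> real \<Rightarrow> real" where
  "bajraktarevic I f g x y =
     the_inv_into I (\<lambda>t. f t / g t) ((f x + f y) / (g x + g y))"

definition pair_equiv ::
    "real set \<Rightarrow> (real \<Rightarrow> real) \<times> (real \<Rightarrow> real) \<Rightarrow> (real \<Rightarrow> real) \<times> (real \<Rightarrow> real) \<Rightarrow> bool" where
  "pair_equiv I = (\<lambda>(f, g) (h, k).
     \<exists>a b c d. a * d - b * c \<noteq> 0 \<and>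
       (\<forall>x\<in>I. h x = a * f x + b * g x \<and> k x = c * f x + d * g x))"

definition wronskian :: "(real \<Rightarrow> real) \<Rightarrow> (real \<Rightarrow> real) \<Rightarrow> real \<Rightarrow> real" where
  "wronskian f g x = deriv f x * g x - f x * deriv g x"

definition S_fun :: "real \<Rightarrow> real \<Rightarrow> real" where
  "S_fun \<alpha> t = (\<Sum>n. \<alpha> ^ n * t ^ (2 * n + 1) / fact (2 * n + 1))"

definition C_fun :: "real \<Rightarrow> real \<Rightarrow> real" where
  "C_fun \<alpha> t = (\<Sum>n. \<alpha> ^ n * t ^ (2 * n) / fact (2 * n))"

definition antiderivative_on :: "real set \<Rightarrow> (real \<Rightarrow> real) \<Rightarrow> (real \<Rightarrow> real) \<Rightarrow> bool" where
  "antiderivative_on J F \<Phi> \<longleftrightarrow> (\<forall>x\<in>J. (\<Phi> has_real_derivative F x) (at x within J))"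

definition strictly_monotone_on :: "real set \<Rightarrow> (real \<Rightarrow> real) \<Rightarrow> bool" where
  "strictly_monotone_on I w \<longleftrightarrow> strict_mono_on I w \<or> strict_antimono_on I w"

definition C2_differentiable_on :: "(real \<Rightarrow> real) \<Rightarrow> real set \<Rightarrow> bool" where
  "C2_differentiable_on f I \<longleftrightarrow>
     f C1_differentiable_on I \<and> deriv f C1_differentiable_on I"

end

theory Submission
  imports Defs
begin

text \<open>
  Put \<open>W = f' g - f g'\<close>. The mean \<open>m\<close> of \<open>x\<close> and \<open>y\<close> generated by \<open>(f, g)\<close> is the unique solution of
  \<open>f m * (g x + g y) = g m * (f x + f y)\<close>, an equation that says that the vector \<open>(f m, g m)\<close> is
  parallel to \<open>(f x, g x) + (f y, g y)\<close>. It is invariant under invertible linear maps of the plane,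
  so equivalent pairs have equal means.

  If \<open>f\<close> and \<open>g\<close> are combinations of \<open>S_fun \<alpha> \<circ> w\<close> and \<open>C_fun \<alpha> \<circ> w\<close>, then the sum-to-product formulas
  give \<open>f x + f y = 2 * C_fun \<alpha> r * f m\<close> and the same for \<open>g\<close>, where \<open>w m = (w x + w y) / 2\<close> and
  \<open>r = (w x - w y) / 2\<close>. Hence the mean is the quasi-arithmetic mean with generator \<open>w\<close>, whatever \<open>\<alpha>\<close>
  is (\<open>mean_of_trigonometric_pair\<close>). The quadratic identities, the polynomials and the condition on
  the Wronskians of the derivatives are all ways to say that, as functions of the variable
  \<open>w = \<integral>W\<close>, both members of a pair solve \<open>y'' = \<alpha> y\<close>; the solutions of this equation are spanned by
  \<open>S_fun \<alpha>\<close> and \<open>C_fun \<alpha>\<close> (\<open>linear_system_solution\<close>). This gives all the implications that end in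
  the equality of the means.

  The difficult direction starts from equal means of continuously differentiable pairs. The quotient
  of the two partial derivatives of the mean can be computed from \<open>(f, g)\<close> and from \<open>(h, k)\<close>, and \<open>m\<close>
  cancels from both expressions
  (\<open>means_equal_imp_partial_derivatives_proportional\<close>). Letting \<open>y\<close> tend to \<open>x\<close> to first order shows
  that \<open>W\<^sub>h\<^sub>k / W\<^sub>f\<^sub>g\<close> has derivative zero, hence is a constant \<open>\<gamma>\<close>. In the variable \<open>w = \<integral>W\<close>, and with
  \<open>h\<close> divided by \<open>\<gamma>\<close>, both Wronskians become \<open>1\<close>. With \<open>e x y = f x * g y - g x * f y\<close> and the
  corresponding \<open>E\<close> for \<open>(h, k)\<close>, the equation of the partial derivatives reads
  \<open>(1 + e\<^sub>x) (1 - E\<^sub>y) = (1 + E\<^sub>x) (1 - e\<^sub>y)\<close>.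

  For fixed \<open>x\<close>, each \<open>y\<close> gives one linear equation for \<open>g' x\<close> and \<open>k' x\<close>, whose coefficients involve
  \<open>f, g, h, k\<close> at \<open>x\<close> but no derivatives there. There are two cases.

  \<^item> If two values of \<open>y\<close> give independent equations, then near \<open>x\<close> the derivatives of \<open>f, g, h, k\<close> are
    rational expressions in these functions, which makes all of them smooth. They then satisfy
    equations \<open>y'' = p y\<close> and \<open>y'' = q y\<close>, and the Taylor expansion at the diagonal yields \<open>p' = q'\<close> in
    order three and \<open>(p - q) p' = 0\<close> in order five. The case \<open>p = q\<close> would make the two pairs locally
    equivalent and the equations dependent. So \<open>p\<close> and \<open>q\<close> are distinct constants near \<open>x\<close>
    (\<open>nondegenerate_local_structure\<close>).

  \<^item> If all the equations for \<open>y\<close> near \<open>x\<close> are dependent, then \<open>e x y = E x y\<close> for all \<open>y\<close> near \<open>x\<close>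
    (\<open>degenerate_iff\<close>).

  Each of the cases holds on an open set, so by connectedness one of them holds throughout the
  interval. In the first case \<open>p\<close> and \<open>q\<close> are globally constant, which is the trigonometric
  alternative. In the second case the matrix that carries \<open>(f, g)\<close> and \<open>(f', g')\<close> to \<open>(h, k)\<close> and
  \<open>(h', k')\<close> is constant, so the pairs are equivalent.
\<close>

section \<open>Calculus on open intervals\<close>

lemma interval_has_antiderivative:
  fixes I :: "real set" and W :: "real \<Rightarrow> real"
  assumes I: "open I" "is_interval I" "I \<noteq> {}" and W: "continuous_on I W"
  shows "\<exists>w. \<forall>x\<in>I. (w has_real_derivative W x) (at x)"
proof -
  obtain c where c: "c \<in> I" using I by blast
  have "((\<lambda>u. LBINT y=c..u. W y) has_real_derivative W x) (at x)" if x: "x \<in> I" for x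
  proof -
    obtain r where r: "r > 0" "cball x r \<subseteq> I"
      using I(1) x open_contains_cball by blast
    define d e where "d = min c (x - r)" and "e = max c (x + r)"
    have "x - r \<in> cball x r" "x + r \<in> cball x r"
      using r(1) by (simp_all add: dist_real_def)
    then have "x - r \<in> I" "x + r \<in> I"
      using r(2) by blast+
    then have "d \<in> I" "e \<in> I"
      using c by (simp_all add: d_def e_def min_def max_def)
    then have sub: "{d..e} \<subseteq> I"
      using I(2) by (meson atLeastAtMost_iff mem_is_interval_1_I subsetI)
    have "((\<lambda>u. LBINT y=c..u. W y) has_vector_derivative W x) (at x within {d..e})"
      using r by (intro interval_integral_FTC2 continuous_on_subset[OF W sub])
        (auto simp: d_def e_def min_def max_def)
    then have "((\<lambda>u. LBINT y=c..u. W y) has_real_derivative W x) (at x within {d..e})"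
      by (simp add: has_real_derivative_iff_has_vector_derivative)
    moreover have "x \<in> interior {d..e}"
      using r by (auto simp: d_def e_def min_def max_def)
    ultimately show ?thesis
      by (metis at_within_interior)
  qed
  then show ?thesis by blast
qed

lemma zero_derivative_imp_constant:
  fixes \<phi> :: "real \<Rightarrow> real"
  assumes "is_interval I" "\<And>x. x \<in> I \<Longrightarrow> (\<phi> has_real_derivative 0) (at x)"
  shows "\<exists>c. \<forall>x\<in>I. \<phi> x = c"
  using assms has_field_derivative_zero_constant[of I \<phi>]
  by (meson is_interval_convex has_field_derivative_at_within)

lemma derivative_of_zero_function:
  fixes \<phi> :: "real \<Rightarrow> real"
  assumes "open U" "a \<in> U" "\<And>x. x \<in> U \<Longrightarrow> \<phi> x = 0" "(\<phi> has_real_derivative D) (at a)"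
  shows "D = 0"
proof -
  have "(\<phi> has_real_derivative 0) (at a)"
    by (rule has_field_derivative_transform_within_open[of "\<lambda>_. 0" _ _ U]) (use assms in auto)
  then show ?thesis using assms(4) DERIV_unique by blast
qed

lemma strictly_monotone_imp_inj_on:
  fixes w :: "real \<Rightarrow> real"
  assumes "strictly_monotone_on I w"
  shows "inj_on w I"
proof (rule inj_onI, rule ccontr)
  fix x y assume "x \<in> I" "y \<in> I" "w x = w y" "x \<noteq> y"
  then show False
    using assms unfolding strictly_monotone_on_def
    by (metis less_irrefl linorder_neqE strict_mono_onD monotone_onD)
qed

lemma nonzero_derivative_imp_strictly_monotone:
  fixes \<phi> \<phi>1 :: "real \<Rightarrow> real"
  assumes I: "is_interval I" and d: "\<And>x. x \<in> I \<Longrightarrow> (\<phi> has_real_derivative \<phi>1 x) (at x)"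
    and c: "continuous_on I \<phi>1" and nz: "\<And>x. x \<in> I \<Longrightarrow> \<phi>1 x \<noteq> 0"
  shows "strictly_monotone_on I \<phi>"
proof -
  have sub: "{x..y} \<subseteq> I" if "x \<in> I" "y \<in> I" for x y
    using I that by (meson atLeastAtMost_iff mem_is_interval_1_I subsetI)
  have "is_interval (\<phi>1 ` I)"
    using I c connected_continuous_image is_interval_connected_1 by blast
  then have "(\<forall>x\<in>I. \<phi>1 x > 0) \<or> (\<forall>x\<in>I. \<phi>1 x < 0)"
  proof (rule contrapos_pp)
    assume "\<not> ((\<forall>x\<in>I. \<phi>1 x > 0) \<or> (\<forall>x\<in>I. \<phi>1 x < 0))"
    then obtain x y where "x \<in> I" "y \<in> I" "\<phi>1 x \<le> 0" "0 \<le> \<phi>1 y"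
      by (auto simp: not_less)
    moreover have "0 \<notin> \<phi>1 ` I"
      using nz by auto
    ultimately show "\<not> is_interval (\<phi>1 ` I)"
      using mem_is_interval_1_I by blast
  qed
  then show ?thesis
  proof
    assume p: "\<forall>x\<in>I. \<phi>1 x > 0"
    have "strict_mono_on I \<phi>"
    proof (rule strict_mono_onI)
      fix r s assume rs: "r \<in> I" "s \<in> I" "r < s"
      show "\<phi> r < \<phi> s"
        by (rule DERIV_pos_imp_increasing[OF rs(3)]) (use sub[OF rs(1,2)] p d in force)
    qed
    then show ?thesis unfolding strictly_monotone_on_def ..
  next
    assume p: "\<forall>x\<in>I. \<phi>1 x < 0"
    have "strict_antimono_on I \<phi>"
    proof (rule monotone_onI)
      fix r s assume rs: "r \<in> I" "s \<in> I" "r < s"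
      show "\<phi> r > \<phi> s"
        by (rule DERIV_neg_imp_decreasing[OF rs(3)]) (use sub[OF rs(1,2)] p d in force)
    qed
    then show ?thesis unfolding strictly_monotone_on_def ..
  qed
qed

lemma derivative_continuous_on:
  fixes \<phi> \<phi>1 :: "real \<Rightarrow> real"
  assumes "\<And>x. x \<in> I \<Longrightarrow> (\<phi> has_real_derivative \<phi>1 x) (at x)"
  shows "continuous_on I \<phi>"
  by (rule DERIV_continuous_on) (use assms has_field_derivative_at_within in blast)

text \<open>
  Used twice: for \<open>f / g\<close>, whose inverse defines the mean, and for the antiderivative \<open>w\<close> of the
  Wronskian, which serves as the new independent variable.
\<close>
lemma inverse_of_nonzero_derivative:
  fixes \<phi> \<phi>1 :: "real \<Rightarrow> real"
  assumes o: "open I" and I: "is_interval I"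
    and d: "\<And>x. x \<in> I \<Longrightarrow> (\<phi> has_real_derivative \<phi>1 x) (at x)"
    and c: "continuous_on I \<phi>1" and nz: "\<And>x. x \<in> I \<Longrightarrow> \<phi>1 x \<noteq> 0"
  shows "open (\<phi> ` I)" "is_interval (\<phi> ` I)" "inj_on \<phi> I"
    and "\<And>x. x \<in> I \<Longrightarrow> (the_inv_into I \<phi> has_real_derivative inverse (\<phi>1 x)) (at (\<phi> x))"
proof -
  show inj: "inj_on \<phi> I"
    using nonzero_derivative_imp_strictly_monotone[OF I d c nz] strictly_monotone_imp_inj_on
    by blast
  have ct: "continuous_on I \<phi>"
    using d by (rule derivative_continuous_on)
  show "is_interval (\<phi> ` I)"
    using I ct connected_continuous_image is_interval_connected_1 by blast
  show "open (\<phi> ` I)"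
    using ct inj o invariance_of_domain by blast
  fix x assume x: "x \<in> I"
  have "(the_inv_into I \<phi> has_derivative (*) (inverse (\<phi>1 x))) (at (\<phi> x))"
  proof (rule has_derivative_inverse_strong[OF o x ct])
    show "(\<phi> has_derivative (*) (\<phi>1 x)) (at x)"
      using d[OF x] by (simp add: has_field_derivative_def)
    show "(*) (\<phi>1 x) \<circ> (*) (inverse (\<phi>1 x)) = id"
      using nz[OF x] by (auto simp: fun_eq_iff)
  qed (simp add: inj the_inv_into_f_f)
  then show "(the_inv_into I \<phi> has_real_derivative inverse (\<phi>1 x)) (at (\<phi> x))"
    by (simp add: has_field_derivative_def)
qed

section \<open>The generalized trigonometric functions\<close>

text \<open>
  Both series are rewritten as ordinary power series, with every other coefficient zero, so that
  they can be differentiated term by term.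
\<close>
lemma summable_interleaved:
  fixes \<alpha> t :: real
  shows "summable (\<lambda>n. (if even n then \<alpha> ^ (n div 2) / fact n else 0) * t ^ n)"
    and "summable (\<lambda>n. (if odd n then \<alpha> ^ (n div 2) / fact n else 0) * t ^ n)"
proof -
  define M where "M = (1 + \<bar>\<alpha>\<bar>) * \<bar>t\<bar>"
  have s: "summable (\<lambda>n. M ^ n / fact n)"
    using summable_exp[of M] by (simp add: field_simps)
  have b: "\<bar>\<alpha>\<bar> ^ (n div 2) * \<bar>t\<bar> ^ n / fact n \<le> M ^ n / fact n" for n
  proof -
    have "\<bar>\<alpha>\<bar> ^ (n div 2) \<le> (1 + \<bar>\<alpha>\<bar>) ^ (n div 2)"
      by (rule power_mono) auto
    also have "\<dots> \<le> (1 + \<bar>\<alpha>\<bar>) ^ n"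
      by (rule power_increasing) auto
    finally have "\<bar>\<alpha>\<bar> ^ (n div 2) * \<bar>t\<bar> ^ n \<le> (1 + \<bar>\<alpha>\<bar>) ^ n * \<bar>t\<bar> ^ n"
      by (rule mult_right_mono) auto
    then show ?thesis
      by (simp add: M_def power_mult_distrib divide_right_mono)
  qed
  show "summable (\<lambda>n. (if even n then \<alpha> ^ (n div 2) / fact n else 0) * t ^ n)"
    by (rule summable_comparison_test'[OF s, of 0])
      (use b in \<open>auto simp: abs_mult power_abs M_def\<close>)
  show "summable (\<lambda>n. (if odd n then \<alpha> ^ (n div 2) / fact n else 0) * t ^ n)"
    by (rule summable_comparison_test'[OF s, of 0])
      (use b in \<open>auto simp: abs_mult power_abs M_def\<close>)
qed

lemma C_fun_power_series:
  "C_fun \<alpha> t = (\<Sum>n. (if even n then \<alpha> ^ (n div 2) / fact n else 0) * t ^ n)"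
proof -
  let ?c = "\<lambda>n. (if even n then \<alpha> ^ (n div 2) / fact n else 0) * t ^ n"
  have "strict_mono (\<lambda>n::nat. 2 * n)" by (auto simp: strict_mono_def)
  moreover have "?c n = 0" if "n \<notin> range (\<lambda>n. 2 * n)" for n
    using that by (auto elim!: evenE)
  ultimately have "(\<lambda>n. ?c (2 * n)) sums suminf ?c"
    using sums_mono_reindex[of "\<lambda>n. 2 * n" ?c] summable_sums[OF summable_interleaved(1)] by blast
  then show ?thesis
    by (simp add: C_fun_def sums_iff)
qed

lemma S_fun_power_series:
  "S_fun \<alpha> t = (\<Sum>n. (if odd n then \<alpha> ^ (n div 2) / fact n else 0) * t ^ n)"
proof -
  let ?c = "\<lambda>n. (if odd n then \<alpha> ^ (n div 2) / fact n else 0) * t ^ n"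
  have "strict_mono (\<lambda>n::nat. 2 * n + 1)" by (auto simp: strict_mono_def)
  moreover have "?c n = 0" if "n \<notin> range (\<lambda>n. 2 * n + 1)" for n
    using that by (auto elim!: oddE)
  ultimately have "(\<lambda>n. ?c (2 * n + 1)) sums suminf ?c"
    using sums_mono_reindex[of "\<lambda>n. 2 * n + 1" ?c] summable_sums[OF summable_interleaved(2)]
    by blast
  then show ?thesis
    by (simp add: S_fun_def sums_iff)
qed

lemma Suc_times_divide_fact_Suc: "real (Suc n) * (a / fact (Suc n)) = a / fact n"
  by (simp del: of_nat_Suc)

lemma S_fun_has_derivative: "(S_fun \<alpha> has_real_derivative C_fun \<alpha> t) (at t)"
proof -
  let ?c = "\<lambda>n. if odd n then \<alpha> ^ (n div 2) / fact n else 0"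
  have "diffs ?c = (\<lambda>n. if even n then \<alpha> ^ (n div 2) / fact n else 0)"
    using Suc_times_divide_fact_Suc by (auto simp: diffs_def fun_eq_iff simp del: fact_Suc of_nat_Suc)
  then show ?thesis
    using termdiffs_strong_converges_everywhere[of ?c t] summable_interleaved(2)
    by (simp add: C_fun_power_series S_fun_power_series[abs_def])
qed

lemma C_fun_has_derivative: "(C_fun \<alpha> has_real_derivative \<alpha> * S_fun \<alpha> t) (at t)"
proof -
  let ?c = "\<lambda>n. if even n then \<alpha> ^ (n div 2) / fact n else 0"
  have *: "diffs ?c = (\<lambda>n. \<alpha> * (if odd n then \<alpha> ^ (n div 2) / fact n else 0))"
    using Suc_times_divide_fact_Suc
    by (auto simp: diffs_def fun_eq_iff simp del: fact_Suc of_nat_Suc elim!: oddE)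
  have "(\<Sum>n. diffs ?c n * t ^ n) = \<alpha> * S_fun \<alpha> t"
    unfolding * S_fun_power_series
    by (subst suminf_mult[OF summable_interleaved(2), symmetric]) (simp add: mult.assoc)
  then show ?thesis
    using termdiffs_strong_converges_everywhere[of ?c t] summable_interleaved(1)
    by (simp add: C_fun_power_series[abs_def])
qed

lemma S_fun_0 [simp]: "S_fun \<alpha> 0 = 0"
  unfolding S_fun_def by simp

lemma C_fun_0 [simp]: "C_fun \<alpha> 0 = 1"
  unfolding C_fun_power_series using powser_zero[of "\<lambda>n. if even n then \<alpha> ^ (n div 2) / fact n else 0"]
  by simp

lemma DERIV_S_fun_chain [derivative_intros]:
  "(w has_real_derivative w1) (at x) \<Longrightarrow>
    ((\<lambda>x. S_fun \<alpha> (w x)) has_real_derivative C_fun \<alpha> (w x) * w1) (at x)"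
  by (rule DERIV_chain2[OF S_fun_has_derivative])

lemma DERIV_C_fun_chain [derivative_intros]:
  "(w has_real_derivative w1) (at x) \<Longrightarrow>
    ((\<lambda>x. C_fun \<alpha> (w x)) has_real_derivative \<alpha> * S_fun \<alpha> (w x) * w1) (at x)"
  by (rule DERIV_chain2[OF C_fun_has_derivative])

text \<open>
  The conserved energy of \<open>y'' = \<alpha> y\<close>; it is the source of the quadratic identities.
\<close>
lemma C_fun_sq_minus_S_fun_sq: "(C_fun \<alpha> t)\<^sup>2 - \<alpha> * (S_fun \<alpha> t)\<^sup>2 = 1"
proof -
  have "((\<lambda>t. (C_fun \<alpha> t)\<^sup>2 - \<alpha> * (S_fun \<alpha> t)\<^sup>2) has_real_derivative 0) (at t)" for t
    by (auto intro!: derivative_eq_intros)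
  then obtain c where c: "\<And>t. (C_fun \<alpha> t)\<^sup>2 - \<alpha> * (S_fun \<alpha> t)\<^sup>2 = c"
    using zero_derivative_imp_constant[of UNIV "\<lambda>t. (C_fun \<alpha> t)\<^sup>2 - \<alpha> * (S_fun \<alpha> t)\<^sup>2"]
    by auto
  from c[of 0] have "c = 1" by simp
  with c show ?thesis by blast
qed

text \<open>
  The system \<open>p' = W q\<close>, \<open>q' = \<alpha> W p\<close> is \<open>y'' = \<alpha> y\<close> written in the variable \<open>w\<close>, without composing
  with the inverse of \<open>w\<close>. Multiplying \<open>(p, q)\<close> by the inverse of the fundamental matrix gives two
  functions with derivative zero, and these are the two constants.
\<close>
lemma linear_system_solution:
  fixes p q w W :: "real \<Rightarrow> real"
  assumes I: "is_interval I"
    and w: "\<And>x. x \<in> I \<Longrightarrow> (w has_real_derivative W x) (at x)"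
    and p: "\<And>x. x \<in> I \<Longrightarrow> (p has_real_derivative W x * q x) (at x)"
    and q: "\<And>x. x \<in> I \<Longrightarrow> (q has_real_derivative \<alpha> * W x * p x) (at x)"
  shows "\<exists>a b. \<forall>x\<in>I. p x = a * S_fun \<alpha> (w x) + b * C_fun \<alpha> (w x) \<and>
                       q x = a * C_fun \<alpha> (w x) + b * \<alpha> * S_fun \<alpha> (w x)"
proof -
  have "((\<lambda>x. p x * C_fun \<alpha> (w x) - q x * S_fun \<alpha> (w x)) has_real_derivative 0) (at x)"
    if "x \<in> I" for x
    by (rule derivative_eq_intros w[OF that] p[OF that] q[OF that] refl)+ (simp add: algebra_simps)
  from zero_derivative_imp_constant[OF I this]
  obtain b where b: "\<forall>x\<in>I. p x * C_fun \<alpha> (w x) - q x * S_fun \<alpha> (w x) = b" by blast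
  have "((\<lambda>x. q x * C_fun \<alpha> (w x) - \<alpha> * p x * S_fun \<alpha> (w x)) has_real_derivative 0) (at x)"
    if "x \<in> I" for x
    by (rule derivative_eq_intros w[OF that] p[OF that] q[OF that] refl)+ (simp add: algebra_simps)
  from zero_derivative_imp_constant[OF I this]
  obtain a where a: "\<forall>x\<in>I. q x * C_fun \<alpha> (w x) - \<alpha> * p x * S_fun \<alpha> (w x) = a" by blast
  have "p x = a * S_fun \<alpha> (w x) + b * C_fun \<alpha> (w x) \<and>
        q x = a * C_fun \<alpha> (w x) + b * \<alpha> * S_fun \<alpha> (w x)" if x: "x \<in> I" for x
  proof -
    let ?S = "S_fun \<alpha> (w x)" and ?C = "C_fun \<alpha> (w x)"
    have 1: "?C * ?C - \<alpha> * (?S * ?S) = 1"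
      using C_fun_sq_minus_S_fun_sq[of \<alpha> "w x"] by (simp add: power2_eq_square)
    have a': "a = q x * ?C - \<alpha> * p x * ?S" and b': "b = p x * ?C - q x * ?S"
      using a b x by simp_all
    have "a * ?S + b * ?C = p x * (?C * ?C - \<alpha> * (?S * ?S))"
      unfolding a' b' by (simp add: algebra_simps)
    moreover have "a * ?C + b * \<alpha> * ?S = q x * (?C * ?C - \<alpha> * (?S * ?S))"
      unfolding a' b' by (simp add: algebra_simps)
    ultimately show ?thesis by (simp add: 1)
  qed
  then show ?thesis by blast
qed

lemma linear_system_solution_UNIV:
  fixes p q :: "real \<Rightarrow> real"
  assumes p: "\<And>t. (p has_real_derivative q t) (at t)"
    and q: "\<And>t. (q has_real_derivative \<alpha> * p t) (at t)"
  shows "p t = q 0 * S_fun \<alpha> t + p 0 * C_fun \<alpha> t"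
proof -
  have "\<exists>a b. \<forall>x\<in>UNIV. p x = a * S_fun \<alpha> x + b * C_fun \<alpha> x \<and>
                       q x = a * C_fun \<alpha> x + b * \<alpha> * S_fun \<alpha> x"
    by (rule linear_system_solution[where W = "\<lambda>_. 1"])
      (use p q in \<open>auto intro!: derivative_eq_intros\<close>)
  then obtain a b where ab: "\<And>x. p x = a * S_fun \<alpha> x + b * C_fun \<alpha> x"
      "\<And>x. q x = a * C_fun \<alpha> x + b * \<alpha> * S_fun \<alpha> x"
    by blast
  from ab(1)[of 0] ab(2)[of 0] ab(1)[of t] show ?thesis by simp
qed

text \<open>
  As a function of \<open>d\<close>, the left-hand side solves \<open>y'' = \<alpha> y\<close> with vanishing derivative at \<open>d = 0\<close>,
  hence is a multiple of \<open>C_fun \<alpha> d\<close>. The same argument applies to \<open>C_fun\<close>.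
\<close>
lemma S_fun_sum_to_product: "S_fun \<alpha> (m + d) + S_fun \<alpha> (m - d) = 2 * S_fun \<alpha> m * C_fun \<alpha> d"
proof -
  have "S_fun \<alpha> (m + d) + S_fun \<alpha> (m - d) =
      (C_fun \<alpha> (m + 0) - C_fun \<alpha> (m - 0)) * S_fun \<alpha> d +
      (S_fun \<alpha> (m + 0) + S_fun \<alpha> (m - 0)) * C_fun \<alpha> d"
    by (rule linear_system_solution_UNIV; (rule derivative_eq_intros refl)+; simp add: algebra_simps)
  then show ?thesis by simp
qed

lemma C_fun_sum_to_product: "C_fun \<alpha> (m + d) + C_fun \<alpha> (m - d) = 2 * C_fun \<alpha> m * C_fun \<alpha> d"
proof -
  have "C_fun \<alpha> (m + d) + C_fun \<alpha> (m - d) =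
      \<alpha> * (S_fun \<alpha> (m + 0) - S_fun \<alpha> (m - 0)) * S_fun \<alpha> d +
      (C_fun \<alpha> (m + 0) + C_fun \<alpha> (m - 0)) * C_fun \<alpha> d"
    by (rule linear_system_solution_UNIV; (rule derivative_eq_intros refl)+; simp add: algebra_simps)
  then show ?thesis by simp
qed

section \<open>Functions that are differentiable several times\<close>

text \<open>
  Differentiability of order \<open>n\<close> is defined by recursion on \<open>n\<close>, so that an equation that expresses
  derivatives by the functions themselves raises the order by one in an induction on \<open>n\<close>. Order
  \<open>0\<close> carries no information, so that such an induction starts trivially.
\<close>
primrec times_differentiable :: "nat \<Rightarrow> real set \<Rightarrow> (real \<Rightarrow> real) \<Rightarrow> bool" where
  "times_differentiable 0 U \<phi> = True"
| "times_differentiable (Suc n) U \<phi> =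
     (\<exists>\<phi>1. (\<forall>x\<in>U. (\<phi> has_real_derivative \<phi>1 x) (at x)) \<and> times_differentiable n U \<phi>1)"

lemma times_differentiable_SucI:
  "\<forall>x\<in>U. (\<phi> has_real_derivative \<phi>1 x) (at x) \<Longrightarrow> times_differentiable n U \<phi>1 \<Longrightarrow>
    times_differentiable (Suc n) U \<phi>"
  by auto

lemma times_differentiable_SucD:
  "times_differentiable (Suc n) U \<phi> \<Longrightarrow> times_differentiable n U \<phi>"
  by (induction n arbitrary: \<phi>) auto

lemma times_differentiable_cong:
  assumes "open U" "\<And>x. x \<in> U \<Longrightarrow> \<phi> x = \<psi> x" "times_differentiable n U \<phi>"
  shows "times_differentiable n U \<psi>"
proof (cases n)
  case (Suc m)
  with assms(3) obtain \<phi>1 where \<phi>1: "\<forall>x\<in>U. (\<phi> has_real_derivative \<phi>1 x) (at x)"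
      "times_differentiable m U \<phi>1"
    by auto
  have "(\<psi> has_real_derivative \<phi>1 x) (at x)" if "x \<in> U" for x
    using \<phi>1(1) that assms(1,2) has_field_derivative_transform_within_open by blast
  with \<phi>1(2) Suc show ?thesis by auto
qed auto

lemma times_differentiable_const: "times_differentiable n U (\<lambda>_. c)"
proof (induction n arbitrary: c)
  case (Suc n)
  have "\<forall>x\<in>U. ((\<lambda>_. c) has_real_derivative 0) (at x)" by auto
  from this Suc[of 0] show ?case
    by (rule times_differentiable_SucI)
qed auto

lemma times_differentiable_add:
  "times_differentiable n U \<phi> \<Longrightarrow> times_differentiable n U \<psi> \<Longrightarrow>
    times_differentiable n U (\<lambda>x. \<phi> x + \<psi> x)"
proof (induction n arbitrary: \<phi> \<psi>)
  case (Suc n)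
  from Suc.prems obtain \<phi>1 \<psi>1 where
      d: "\<forall>x\<in>U. (\<phi> has_real_derivative \<phi>1 x) (at x)" "\<forall>x\<in>U. (\<psi> has_real_derivative \<psi>1 x) (at x)"
      and s: "times_differentiable n U \<phi>1" "times_differentiable n U \<psi>1"
    by auto
  have "\<forall>x\<in>U. ((\<lambda>x. \<phi> x + \<psi> x) has_real_derivative \<phi>1 x + \<psi>1 x) (at x)"
    using d by (auto intro!: derivative_intros)
  from this Suc.IH[OF s] show ?case
    by (rule times_differentiable_SucI)
qed auto

lemma times_differentiable_mult:
  "times_differentiable n U \<phi> \<Longrightarrow> times_differentiable n U \<psi> \<Longrightarrow>
    times_differentiable n U (\<lambda>x. \<phi> x * \<psi> x)"
proof (induction n arbitrary: \<phi> \<psi>)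
  case (Suc n)
  from Suc.prems obtain \<phi>1 \<psi>1 where
      d: "\<forall>x\<in>U. (\<phi> has_real_derivative \<phi>1 x) (at x)" "\<forall>x\<in>U. (\<psi> has_real_derivative \<psi>1 x) (at x)"
      and s: "times_differentiable n U \<phi>1" "times_differentiable n U \<psi>1"
    by auto
  have "\<forall>x\<in>U. ((\<lambda>x. \<phi> x * \<psi> x) has_real_derivative \<phi>1 x * \<psi> x + \<phi> x * \<psi>1 x) (at x)"
    using d by (auto intro!: derivative_eq_intros)
  moreover have "times_differentiable n U (\<lambda>x. \<phi>1 x * \<psi> x + \<phi> x * \<psi>1 x)"
    using s Suc.prems[THEN times_differentiable_SucD]
    by (intro times_differentiable_add Suc.IH)
  ultimately show ?case
    by (rule times_differentiable_SucI)
qed auto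

lemma times_differentiable_diff:
  assumes "times_differentiable n U \<phi>" "times_differentiable n U \<psi>"
  shows "times_differentiable n U (\<lambda>x. \<phi> x - \<psi> x)"
  using times_differentiable_add[OF assms(1)
      times_differentiable_mult[OF times_differentiable_const[of n U "-1"] assms(2)]]
  by simp

lemma times_differentiable_inverse:
  assumes nz: "\<And>x. x \<in> U \<Longrightarrow> \<phi> x \<noteq> 0"
  shows "times_differentiable n U \<phi> \<Longrightarrow> times_differentiable n U (\<lambda>x. inverse (\<phi> x))"
proof (induction n)
  case (Suc n)
  from Suc.prems obtain \<phi>1 where d: "\<forall>x\<in>U. (\<phi> has_real_derivative \<phi>1 x) (at x)"
      and s: "times_differentiable n U \<phi>1"
    by auto
  have "\<forall>x\<in>U. ((\<lambda>x. inverse (\<phi> x)) has_real_derivative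
      (-1) * (inverse (\<phi> x) * \<phi>1 x * inverse (\<phi> x))) (at x)"
    using d nz by (auto intro!: derivative_eq_intros)
  moreover have "times_differentiable n U (\<lambda>x. (-1) * (inverse (\<phi> x) * \<phi>1 x * inverse (\<phi> x)))"
    using s Suc.IH[OF times_differentiable_SucD[OF Suc.prems]]
    by (intro times_differentiable_mult times_differentiable_const)
  ultimately show ?case
    by (rule times_differentiable_SucI)
qed auto

lemma times_differentiable_divide:
  assumes "\<And>x. x \<in> U \<Longrightarrow> \<psi> x \<noteq> 0" "times_differentiable n U \<phi>" "times_differentiable n U \<psi>"
  shows "times_differentiable n U (\<lambda>x. \<phi> x / \<psi> x)"
  unfolding divide_inverse
  using assms by (intro times_differentiable_mult times_differentiable_inverse)

lemmas times_differentiable_intros =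
  times_differentiable_const times_differentiable_add times_differentiable_diff
  times_differentiable_mult times_differentiable_divide

lemma times_differentiable_derivative:
  assumes U: "open U" and s: "times_differentiable (Suc n) U \<phi>"
    and d: "\<And>x. x \<in> U \<Longrightarrow> (\<phi> has_real_derivative \<phi>1 x) (at x)"
  shows "times_differentiable n U \<phi>1"
proof -
  from s obtain \<psi> where \<psi>: "\<forall>x\<in>U. (\<phi> has_real_derivative \<psi> x) (at x)"
      "times_differentiable n U \<psi>"
    by auto
  show ?thesis
    by (rule times_differentiable_cong[OF U _ \<psi>(2)]) (use \<psi>(1) d DERIV_unique in blast)
qed

section \<open>Taylor expansion at the diagonal\<close>

lemma leibniz_sum_has_derivative:
  fixes a b :: "nat \<Rightarrow> real \<Rightarrow> real"
  assumes a: "\<And>j. j \<le> n \<Longrightarrow> (a j has_real_derivative a (Suc j) x) (at x)"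
    and b: "\<And>j. j \<le> n \<Longrightarrow> (b j has_real_derivative b (Suc j) x) (at x)"
  shows "((\<lambda>x. \<Sum>j\<le>n. (n choose j) * (a j x * b (n - j) x)) has_real_derivative
          (\<Sum>j\<le>Suc n. (Suc n choose j) * (a j x * b (Suc n - j) x))) (at x)"
proof -
  have "((\<lambda>x. \<Sum>j\<le>n. (n choose j) * (a j x * b (n - j) x)) has_real_derivative
      (\<Sum>j\<le>n. (n choose j) * (a (Suc j) x * b (n - j) x + a j x * b (Suc (n - j)) x))) (at x)"
    by (intro DERIV_sum) (auto intro!: derivative_eq_intros a b)
  also have "(\<Sum>j\<le>n. (n choose j) * (a (Suc j) x * b (n - j) x + a j x * b (Suc (n - j)) x)) =
      (\<Sum>j\<le>n. (n choose j) * (a (Suc j) x * b (n - j) x)) +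
      (\<Sum>j\<le>n. (n choose j) * (a j x * b (Suc n - j) x))"
    by (simp add: distrib_left sum.distrib Suc_diff_le)
  also have "(\<Sum>j\<le>n. (n choose j) * (a j x * b (Suc n - j) x)) =
      (\<Sum>j\<le>Suc n. (n choose j) * (a j x * b (Suc n - j) x))"
    by simp
  also have "\<dots> = a 0 x * b (Suc n) x + (\<Sum>j\<le>n. (n choose Suc j) * (a (Suc j) x * b (n - j) x))"
    by (subst sum.atMost_Suc_shift) simp
  also have "(\<Sum>j\<le>n. (n choose j) * (a (Suc j) x * b (n - j) x)) +
      (a 0 x * b (Suc n) x + (\<Sum>j\<le>n. (n choose Suc j) * (a (Suc j) x * b (n - j) x))) =
      (\<Sum>j\<le>Suc n. (Suc n choose j) * (a j x * b (Suc n - j) x))"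
    by (subst sum.atMost_Suc_shift) (simp add: sum.distrib[symmetric] algebra_simps)
  finally show ?thesis .
qed

lemma leibniz_of_equal_products:
  fixes a b c d :: "nat \<Rightarrow> real \<Rightarrow> real"
  assumes U: "open U"
    and eq: "\<And>x. x \<in> U \<Longrightarrow> a 0 x * b 0 x = c 0 x * d 0 x"
    and "\<And>j x. j < n \<Longrightarrow> x \<in> U \<Longrightarrow> (a j has_real_derivative a (Suc j) x) (at x)"
    and "\<And>j x. j < n \<Longrightarrow> x \<in> U \<Longrightarrow> (b j has_real_derivative b (Suc j) x) (at x)"
    and "\<And>j x. j < n \<Longrightarrow> x \<in> U \<Longrightarrow> (c j has_real_derivative c (Suc j) x) (at x)"
    and "\<And>j x. j < n \<Longrightarrow> x \<in> U \<Longrightarrow> (d j has_real_derivative d (Suc j) x) (at x)"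
    and "x \<in> U"
  shows "(\<Sum>j\<le>n. (n choose j) * (a j x * b (n - j) x)) =
         (\<Sum>j\<le>n. (n choose j) * (c j x * d (n - j) x))"
  using assms(3-7)
proof (induction n arbitrary: x)
  case 0
  then show ?case using eq by simp
next
  case (Suc n)
  have z: "(\<Sum>j\<le>n. (n choose j) * (a j y * b (n - j) y)) -
        (\<Sum>j\<le>n. (n choose j) * (c j y * d (n - j) y)) = 0" if "y \<in> U" for y
    using Suc.IH[of y] Suc.prems(1-4) that by simp
  have dz: "((\<lambda>y. (\<Sum>j\<le>n. (n choose j) * (a j y * b (n - j) y)) -
        (\<Sum>j\<le>n. (n choose j) * (c j y * d (n - j) y))) has_real_derivative
      (\<Sum>j\<le>Suc n. (Suc n choose j) * (a j x * b (Suc n - j) x)) -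
        (\<Sum>j\<le>Suc n. (Suc n choose j) * (c j x * d (Suc n - j) x))) (at x)"
    by (intro DERIV_diff leibniz_sum_has_derivative Suc.prems(1-5) le_imp_less_Suc)
  have "(\<Sum>j\<le>Suc n. (Suc n choose j) * (a j x * b (Suc n - j) x)) -
        (\<Sum>j\<le>Suc n. (Suc n choose j) * (c j x * d (Suc n - j) x)) = 0"
    by (rule derivative_of_zero_function[OF U Suc.prems(5) z dz])
  then show ?case by simp
qed

text \<open>
  The derivatives up to order five of \<open>1 + G\<close>, where \<open>G'' = p G\<close>, and of \<open>1 + F'\<close>, where \<open>F'' = p F\<close>.
  At a point where \<open>G\<close> has value \<open>1\<close> and slope \<open>0\<close>, while \<open>F\<close> has value \<open>0\<close> and slope \<open>1\<close>, they become
  \<open>2, 0, p, p', p'' + p\<^sup>2, p''' + 4 p p'\<close> and \<open>2, 0, p, 2 p', 3 p'' + p\<^sup>2, 4 p''' + 6 p p'\<close>.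
  The names refer to the parity of the solutions \<open>G\<close> and \<open>F\<close> for constant \<open>p\<close>.
\<close>
definition even_jet :: "(real \<Rightarrow> real) \<Rightarrow> (real \<Rightarrow> real) \<Rightarrow> (real \<Rightarrow> real) \<Rightarrow> (real \<Rightarrow> real) \<Rightarrow>
    (real \<Rightarrow> real) \<Rightarrow> (real \<Rightarrow> real) \<Rightarrow> nat \<Rightarrow> real \<Rightarrow> real" where
  "even_jet G G1 p p1 p2 p3 j =
    [\<lambda>x. 1 + G x, G1, \<lambda>x. p x * G x, \<lambda>x. p1 x * G x + p x * G1 x,
     \<lambda>x. p2 x * G x + 2 * p1 x * G1 x + p x * p x * G x,
     \<lambda>x. p3 x * G x + 3 * p2 x * G1 x + 4 * p x * p1 x * G x + p x * p x * G1 x] ! j"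

definition odd_jet :: "(real \<Rightarrow> real) \<Rightarrow> (real \<Rightarrow> real) \<Rightarrow> (real \<Rightarrow> real) \<Rightarrow> (real \<Rightarrow> real) \<Rightarrow>
    (real \<Rightarrow> real) \<Rightarrow> (real \<Rightarrow> real) \<Rightarrow> (real \<Rightarrow> real) \<Rightarrow> nat \<Rightarrow> real \<Rightarrow> real" where
  "odd_jet F F1 p p1 p2 p3 p4 j =
    [\<lambda>x. 1 + F1 x, \<lambda>x. p x * F x, \<lambda>x. p1 x * F x + p x * F1 x,
     \<lambda>x. p2 x * F x + 2 * p1 x * F1 x + p x * p x * F x,
     \<lambda>x. p3 x * F x + 3 * p2 x * F1 x + 4 * p x * p1 x * F x + p x * p x * F1 x,
     \<lambda>x. p4 x * F x + 4 * p3 x * F1 x + 7 * p x * p2 x * F x + 4 * p1 x * p1 x * F x +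
       6 * p x * p1 x * F1 x + p x * p x * p x * F x] ! j"

lemma even_jet_has_derivative:
  assumes D: "(G has_real_derivative G1 x) (at x)" "(G1 has_real_derivative p x * G x) (at x)"
    "(p has_real_derivative p1 x) (at x)" "(p1 has_real_derivative p2 x) (at x)"
    "(p2 has_real_derivative p3 x) (at x)"
    and "j < 5"
  shows "(even_jet G G1 p p1 p2 p3 j has_real_derivative even_jet G G1 p p1 p2 p3 (Suc j) x) (at x)"
proof -
  consider "j = 0" | "j = 1" | "j = 2" | "j = 3" | "j = 4" using \<open>j < 5\<close> by linarith
  then show ?thesis
    by cases (simp add: even_jet_def;
      ((rule derivative_eq_intros D refl)+)?; (simp add: algebra_simps)?)+
qed

lemma odd_jet_has_derivative:
  assumes D: "(F has_real_derivative F1 x) (at x)" "(F1 has_real_derivative p x * F x) (at x)"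
    "(p has_real_derivative p1 x) (at x)" "(p1 has_real_derivative p2 x) (at x)"
    "(p2 has_real_derivative p3 x) (at x)" "(p3 has_real_derivative p4 x) (at x)"
    and "j < 5"
  shows "(odd_jet F F1 p p1 p2 p3 p4 j has_real_derivative odd_jet F F1 p p1 p2 p3 p4 (Suc j) x) (at x)"
proof -
  consider "j = 0" | "j = 1" | "j = 2" | "j = 3" | "j = 4" using \<open>j < 5\<close> by linarith
  then show ?thesis
    by cases (simp add: odd_jet_def;
      ((rule derivative_eq_intros D refl)+)?; (simp add: algebra_simps)?)+
qed

text \<open>
  This is where the two alternatives of the classification come from. With the jets above, the third
  derivative of the product identity reduces to \<open>2 p' + 4 q' = 2 q' + 4 p'\<close>. In the fifth derivative
  all terms cancel by \<open>p' = q'\<close> and \<open>p''' = q'''\<close>, except \<open>28 p p' + 22 q p'\<close> on the left and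
  \<open>28 q p' + 22 p p'\<close> on the right.
\<close>
lemma jets_of_normalized_solutions:
  fixes F F1 G G1 H H1 K K1 :: "real \<Rightarrow> real"
  assumes U: "open U" and aU: "a \<in> U"
    and "\<And>x. x \<in> U \<Longrightarrow> (F has_real_derivative F1 x) (at x)"
    and "\<And>x. x \<in> U \<Longrightarrow> (F1 has_real_derivative p x * F x) (at x)"
    and "\<And>x. x \<in> U \<Longrightarrow> (G has_real_derivative G1 x) (at x)"
    and "\<And>x. x \<in> U \<Longrightarrow> (G1 has_real_derivative p x * G x) (at x)"
    and "\<And>x. x \<in> U \<Longrightarrow> (H has_real_derivative H1 x) (at x)"
    and "\<And>x. x \<in> U \<Longrightarrow> (H1 has_real_derivative q x * H x) (at x)"
    and "\<And>x. x \<in> U \<Longrightarrow> (K has_real_derivative K1 x) (at x)"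
    and "\<And>x. x \<in> U \<Longrightarrow> (K1 has_real_derivative q x * K x) (at x)"
    and "\<And>x. x \<in> U \<Longrightarrow> (p has_real_derivative p1 x) (at x)"
    and "\<And>x. x \<in> U \<Longrightarrow> (p1 has_real_derivative p2 x) (at x)"
    and "\<And>x. x \<in> U \<Longrightarrow> (p2 has_real_derivative p3 x) (at x)"
    and "\<And>x. x \<in> U \<Longrightarrow> (p3 has_real_derivative p4 x) (at x)"
    and "\<And>x. x \<in> U \<Longrightarrow> (q has_real_derivative q1 x) (at x)"
    and "\<And>x. x \<in> U \<Longrightarrow> (q1 has_real_derivative q2 x) (at x)"
    and "\<And>x. x \<in> U \<Longrightarrow> (q2 has_real_derivative q3 x) (at x)"
    and "\<And>x. x \<in> U \<Longrightarrow> (q3 has_real_derivative q4 x) (at x)"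
    and ini: "F a = 0" "F1 a = 1" "G a = 1" "G1 a = 0" "H a = 0" "H1 a = 1" "K a = 1" "K1 a = 0"
    and eq: "\<And>x. x \<in> U \<Longrightarrow> (1 + G x) * (1 + H1 x) = (1 + K x) * (1 + F1 x)"
  shows "p1 a = q1 a" and "p3 a = q3 a \<Longrightarrow> (p a - q a) * p1 a = 0"
proof -
  note D = assms(3-18)
  have L: "(\<Sum>j\<le>n. (n choose j) * (even_jet G G1 p p1 p2 p3 j a * odd_jet H H1 q q1 q2 q3 q4 (n - j) a)) =
         (\<Sum>j\<le>n. (n choose j) * (even_jet K K1 q q1 q2 q3 j a * odd_jet F F1 p p1 p2 p3 p4 (n - j) a))"
    if "n \<le> 5" for n
  proof (rule leibniz_of_equal_products[OF U _ _ _ _ _ aU])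
    fix x assume "x \<in> U"
    from eq[OF this] show "even_jet G G1 p p1 p2 p3 0 x * odd_jet H H1 q q1 q2 q3 q4 0 x =
        even_jet K K1 q q1 q2 q3 0 x * odd_jet F F1 p p1 p2 p3 p4 0 x"
      by (simp add: even_jet_def odd_jet_def)
  qed (use that in \<open>auto intro!: even_jet_has_derivative odd_jet_has_derivative D\<close>)
  show p1: "p1 a = q1 a"
    using L[of 3] by (simp add: even_jet_def odd_jet_def ini eval_nat_numeral)
  show "(p a - q a) * p1 a = 0" if "p3 a = q3 a"
    using L[of 5] that p1 by (simp add: even_jet_def odd_jet_def ini eval_nat_numeral algebra_simps)
qed

section \<open>Pairs with Wronskian one\<close>

text \<open>
  The plane curve \<open>(f, g)\<close> moves such that its position vector sweeps area at a constant rate. This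
  is the normal form that a pair takes in the variable \<open>w = \<integral>W\<close>.
\<close>
locale unimodular_pair =
  fixes J :: "real set" and f f1 g g1 :: "real \<Rightarrow> real"
  assumes open_J: "open J" and interval_J: "is_interval J"
    and deriv_f: "\<And>x. x \<in> J \<Longrightarrow> (f has_real_derivative f1 x) (at x)"
    and deriv_g: "\<And>x. x \<in> J \<Longrightarrow> (g has_real_derivative g1 x) (at x)"
    and cont_f1: "continuous_on J f1" and cont_g1: "continuous_on J g1"
    and g_pos: "\<And>x. x \<in> J \<Longrightarrow> g x > 0"
    and unimodular: "\<And>x. x \<in> J \<Longrightarrow> f1 x * g x - f x * g1 x = 1"
begin

text \<open>
  The oriented area of the parallelogram spanned by two positions, invariant under linear maps of
  determinant one.
\<close>
definition area :: "real \<Rightarrow> real \<Rightarrow> real" where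
  "area x y = f x * g y - g x * f y"

text \<open>
  Up to a positive factor depending on \<open>x\<close> and \<open>y\<close> this is the partial derivative with respect to \<open>x\<close>
  of the quotient \<open>(f x + f y) / (g x + g y)\<close>. It equals \<open>1\<close> plus the partial derivative of
  \<open>area x y\<close> with respect to \<open>x\<close>.
\<close>
definition speed :: "real \<Rightarrow> real \<Rightarrow> real" where
  "speed x y = 1 + f1 x * g y - g1 x * f y"

lemma cont_f: "continuous_on J f" and cont_g: "continuous_on J g"
  using deriv_f deriv_g by (auto intro: derivative_continuous_on)

lemma area_deriv_right:
  "y \<in> J \<Longrightarrow> (area x has_real_derivative 1 - speed y x) (at y)"
  unfolding area_def[abs_def] speed_def
  by (rule derivative_eq_intros deriv_f deriv_g refl | assumption)+ (simp add: algebra_simps)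

lemma speed_deriv_right:
  "y \<in> J \<Longrightarrow> (speed x has_real_derivative f1 x * g1 y - g1 x * f1 y) (at y)"
  unfolding speed_def[abs_def]
  by (rule derivative_eq_intros deriv_f deriv_g refl | assumption)+ (simp add: algebra_simps)

lemma area_diag [simp]: "area x x = 0"
  by (simp add: area_def)

lemma speed_diag [simp]: "x \<in> J \<Longrightarrow> speed x x = 2"
  using unimodular[of x] by (simp add: speed_def algebra_simps)

text \<open>
  Two positions are parallel only if \<open>f / g\<close> takes the same value there, and \<open>f / g\<close> has the
  derivative \<open>1 / g\<^sup>2\<close>.
\<close>
lemma area_eq_0_iff:
  assumes "x \<in> J" "y \<in> J" shows "area x y = 0 \<longleftrightarrow> x = y"
proof
  assume "area x y = 0"
  then have eq: "f x / g x = f y / g y"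
    using g_pos assms by (simp add: area_def field_simps less_imp_neq[symmetric])
  have "strictly_monotone_on J (\<lambda>t. f t / g t)"
  proof (rule nonzero_derivative_imp_strictly_monotone[OF interval_J])
    show "((\<lambda>t. f t / g t) has_real_derivative 1 / (g t * g t)) (at t)" if "t \<in> J" for t
      by (rule derivative_eq_intros deriv_f deriv_g that refl)+
        (use g_pos[OF that] unimodular[OF that] in auto)
    show "continuous_on J (\<lambda>t. 1 / (g t * g t))"
      using g_pos by (auto intro!: continuous_intros cont_g simp: less_imp_neq[symmetric])
    show "1 / (g t * g t) \<noteq> 0" if "t \<in> J" for t
      using g_pos[OF that] by simp
  qed
  then show "x = y"
    using eq assms strictly_monotone_imp_inj_on by (blast dest: inj_onD)
qed simp

text \<open>
  Pluecker's relation between the four vectors \<open>(f, g)\<close> and \<open>(f', g')\<close> at \<open>x\<close> and \<open>y\<close>. It says that the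
  derivative of \<open>speed x y / area x y\<close> with respect to \<open>y\<close> is \<open>speed y x / (area x y)\<^sup>2\<close>.
\<close>
lemma area_speed_identity:
  assumes "x \<in> J" "y \<in> J"
  shows "area x y * (f1 x * g1 y - g1 x * f1 y) - speed x y * (1 - speed y x) = speed y x"
proof -
  have "area x y * (f1 x * g1 y - g1 x * f1 y) - speed x y * (1 - speed y x) - speed y x =
      (f1 x * g y - g1 x * f y) * (f1 y * g x - g1 y * f x) + area x y * (f1 x * g1 y - g1 x * f1 y) - 1"
    by (simp add: speed_def algebra_simps)
  also have "\<dots> = (f1 x * g x - f x * g1 x) * (f1 y * g y - f y * g1 y) - 1"
    by (simp add: area_def algebra_simps)
  finally show ?thesis
    using unimodular assms by simp
qed

text \<open>
  The constraint on the Wronskian removes \<open>f1 x\<close>, so that \<open>speed x y\<close> becomes an affine function of the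
  single unknown \<open>g1 x\<close>.
\<close>
lemma speed_via_g1:
  assumes "x \<in> J"
  shows "g x * speed x y = g x + g y + g1 x * area x y"
proof -
  have "g x * speed x y = g x + (f1 x * g x - f x * g1 x) * g y + g1 x * area x y"
    by (simp add: speed_def area_def algebra_simps)
  then show ?thesis using unimodular[OF assms] by simp
qed

lemma f1_via_g1: "x \<in> J \<Longrightarrow> f1 x = (1 + f x * g1 x) / g x"
  using unimodular[of x] g_pos[of x] by (simp add: field_simps)

lemma continuous_speed_left: "continuous_on J (\<lambda>y. speed y x)"
  unfolding speed_def by (intro continuous_intros cont_f1 cont_g1)

lemma eventually_in_J: "x \<in> J \<Longrightarrow> \<forall>\<^sub>F y in nhds x. y \<in> J"
  using open_J by (simp add: eventually_nhds_in_open)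

lemma isCont_speed_left: "x \<in> J \<Longrightarrow> isCont (\<lambda>y. speed y x) x"
  using continuous_speed_left continuous_on_eq_continuous_at open_J by blast

lemma eventually_speed_pos: "x \<in> J \<Longrightarrow> \<forall>\<^sub>F y in nhds x. speed y x > 0"
proof -
  assume x: "x \<in> J"
  have "((\<lambda>y. speed y x) \<longlongrightarrow> speed x x) (nhds x)"
    using isCont_speed_left[OF x] tendsto_at_iff_tendsto_nhds[of "\<lambda>y. speed y x" x]
    by (simp add: isCont_def)
  from order_tendstoD(1)[OF this, of 0] x show "\<forall>\<^sub>F y in nhds x. speed y x > 0"
    by simp
qed

lemma area_quotient_tendsto:
  assumes "x \<in> J"
  shows "((\<lambda>y. area x y / (x - y)) \<longlongrightarrow> 1) (at x)"
proof -
  have "(area x has_real_derivative -1) (at x)"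
    using area_deriv_right[OF assms, of x] assms by simp
  then have "((\<lambda>y. area x y / (y - x)) \<longlongrightarrow> -1) (at x)"
    by (simp add: has_field_derivative_iff)
  then have "((\<lambda>y. - (area x y / (y - x))) \<longlongrightarrow> 1) (at x)"
    using tendsto_minus by fastforce
  moreover have "- (area x y / (y - x)) = area x y / (x - y)" for y
    by (metis minus_diff_eq minus_divide_right)
  ultimately show ?thesis by simp
qed

text \<open>
  Differentiating \<open>f' g - f g' = 1\<close> gives \<open>f'' g = f g''\<close>, so both functions solve the equation
  \<open>y'' = p y\<close> with \<open>p = g'' / g\<close>.
\<close>
lemma smooth_imp_hill_equation:
  assumes U: "open U" "U \<subseteq> J" and g: "times_differentiable (Suc (Suc n)) U g"
  shows "\<exists>p. times_differentiable n U p \<and>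
    (\<forall>x\<in>U. (f1 has_real_derivative p x * f x) (at x) \<and> (g1 has_real_derivative p x * g x) (at x))"
proof -
  have "times_differentiable (Suc n) U g1"
    by (rule times_differentiable_derivative[OF U(1)]) (use g U deriv_g in auto)
  then obtain g2 where g2: "\<forall>x\<in>U. (g1 has_real_derivative g2 x) (at x)" "times_differentiable n U g2"
    by auto
  let ?p = "\<lambda>x. g2 x / g x"
  have nz: "g x \<noteq> 0" if "x \<in> U" for x
    using that U(2) g_pos by force
  have "times_differentiable n U ?p"
    by (intro times_differentiable_divide nz g2(2) g[THEN times_differentiable_SucD, THEN times_differentiable_SucD])
  moreover have "(f1 has_real_derivative ?p x * f x) (at x)" if x: "x \<in> U" for x
  proof -
    have xJ: "x \<in> J" using x U(2) by blast
    have "((\<lambda>x. (1 + f x * g1 x) / g x) has_real_derivative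
        ((f1 x * g1 x + g2 x * f x) * g x - (1 + f x * g1 x) * g1 x) / (g x * g x)) (at x)"
      by (rule derivative_eq_intros deriv_f deriv_g g2(1)[rule_format] x xJ nz[OF x] refl)+
        simp
    also have "((f1 x * g1 x + g2 x * f x) * g x - (1 + f x * g1 x) * g1 x) / (g x * g x) = ?p x * f x"
    proof -
      have "(f1 x * g1 x + g2 x * f x) * g x - (1 + f x * g1 x) * g1 x =
          (f1 x * g x - f x * g1 x - 1) * g1 x + g2 x * f x * g x"
        by (simp add: algebra_simps)
      then show ?thesis using unimodular[OF xJ] nz[OF x] by simp
    qed
    finally show ?thesis
      by (rule has_field_derivative_transform_within_open[OF _ U(1) x])
        (use U(2) f1_via_g1 in auto)
  qed
  moreover have "(g1 has_real_derivative ?p x * g x) (at x)" if "x \<in> U" for x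
    using g2(1) nz that by simp
  ultimately show ?thesis by blast
qed

end

section \<open>Two pairs with Wronskian one and equal means\<close>

text \<open>
  The assumption \<open>speed_ratio\<close> says that the quotients of the two partial derivatives of the mean,
  computed from either pair, agree; in this form the equality of the means enters here.
\<close>
locale two_unimodular_pairs =
  fg: unimodular_pair J f f1 g g1 + hk: unimodular_pair J h h1 k k1 for J f f1 g g1 h h1 k k1 +
  assumes speed_ratio: "\<And>x y. x \<in> J \<Longrightarrow> y \<in> J \<Longrightarrow>
    fg.speed x y * hk.speed y x = hk.speed x y * fg.speed y x"
begin

lemma area_eq_imp_speed_eq:
  assumes "open U" "U \<subseteq> J" "\<And>y. y \<in> U \<Longrightarrow> fg.area x y = hk.area x y" "y \<in> U"
  shows "fg.speed y x = hk.speed y x"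
proof -
  have "((\<lambda>y. fg.area x y - hk.area x y) has_real_derivative
      (1 - fg.speed y x) - (1 - hk.speed y x)) (at y)"
    using assms by (intro DERIV_diff fg.area_deriv_right hk.area_deriv_right) auto
  from derivative_of_zero_function[OF assms(1,4) _ this] show ?thesis
    using assms(3) by simp
qed

text \<open>
  For fixed \<open>x\<close>, \<open>speed_ratio\<close> is a family of linear equations for \<open>g1 x\<close> and \<open>k1 x\<close> with parameter \<open>y\<close>.
  Up to factors that depend on \<open>x\<close> only, the coefficients of the unknowns are the two sides below,
  the second with a minus sign, and their quotient tends to \<open>-1\<close> as \<open>y\<close> tends to \<open>x\<close>. Degeneracy
  says that it equals \<open>-1\<close> near \<open>x\<close>, so that no two of these equations are independent.
\<close>
definition degenerate :: "real \<Rightarrow> bool" where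
  "degenerate x \<longleftrightarrow>
    (\<forall>\<^sub>F y in nhds x. fg.area x y * hk.speed y x = hk.area x y * fg.speed y x)"

text \<open>
  Degeneracy and \<open>speed_ratio\<close> together give equality of \<open>speed x y / area x y\<close> for the two pairs, for
  all \<open>y \<noteq> x\<close> near \<open>x\<close>. Differentiating in \<open>y\<close> by \<open>area_speed_identity\<close> gives equality of
  \<open>speed y x / (area x y)\<^sup>2\<close>; degeneracy itself is equality of \<open>speed y x / area x y\<close>. Dividing the two
  leaves equality of the areas. Conversely, equal areas have equal derivatives.
\<close>
lemma degenerate_iff:
  assumes x: "x \<in> J"
  shows "degenerate x \<longleftrightarrow> (\<exists>U. open U \<and> x \<in> U \<and> U \<subseteq> J \<and> (\<forall>y\<in>U. fg.area x y = hk.area x y))"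
proof
  assume "\<exists>U. open U \<and> x \<in> U \<and> U \<subseteq> J \<and> (\<forall>y\<in>U. fg.area x y = hk.area x y)"
  then obtain U where "open U" "x \<in> U" "U \<subseteq> J" "\<And>y. y \<in> U \<Longrightarrow> fg.area x y = hk.area x y"
    by blast
  with area_eq_imp_speed_eq show "degenerate x"
    unfolding degenerate_def eventually_nhds by metis
next
  assume "degenerate x"
  then have "\<forall>\<^sub>F y in nhds x. y \<in> J \<and> fg.speed y x > 0 \<and> hk.speed y x > 0 \<and>
      fg.area x y * hk.speed y x = hk.area x y * fg.speed y x"
    unfolding degenerate_def
    by (intro eventually_conj fg.eventually_in_J fg.eventually_speed_pos hk.eventually_speed_pos x)
  then obtain U where U: "open U" "x \<in> U" and
      UJ: "\<And>y. y \<in> U \<Longrightarrow> y \<in> J" and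
      pos: "\<And>y. y \<in> U \<Longrightarrow> fg.speed y x > 0" "\<And>y. y \<in> U \<Longrightarrow> hk.speed y x > 0" and
      deg: "\<And>y. y \<in> U \<Longrightarrow> fg.area x y * hk.speed y x = hk.area x y * fg.speed y x"
    unfolding eventually_nhds by blast
  have "fg.area x y = hk.area x y" if y: "y \<in> U" for y
  proof (cases "y = x")
    case False
    define V where "V = U - {x}"
    have V: "open V" "y \<in> V"
      using U y False by (auto simp: V_def)
    have nz: "fg.area x z \<noteq> 0" "hk.area x z \<noteq> 0" if "z \<in> V" for z
      using that UJ x by (auto simp: V_def fg.area_eq_0_iff hk.area_eq_0_iff)
    \<comment> \<open>The product of \<open>speed_ratio\<close> with the degeneracy equation, divided by the positive speeds.\<close>
    have quot: "fg.speed x z / fg.area x z - hk.speed x z / hk.area x z = 0" if "z \<in> V" for z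
    proof -
      have z: "z \<in> U" using that by (simp add: V_def)
      have "fg.speed x z * hk.area x z * (fg.speed z x * hk.speed z x) =
            (fg.speed x z * hk.speed z x) * (hk.area x z * fg.speed z x)"
        by simp
      also have "\<dots> = hk.speed x z * fg.area x z * (fg.speed z x * hk.speed z x)"
        using speed_ratio[OF x UJ[OF z]] deg[OF z] by (metis mult.assoc mult.commute)
      finally have "fg.speed x z * hk.area x z = hk.speed x z * fg.area x z"
        using pos[OF z] by simp
      then show ?thesis using nz[OF that] by (simp add: field_simps)
    qed
    have yJ: "y \<in> J" using y UJ by blast
    have "((\<lambda>z. fg.speed x z / fg.area x z) has_real_derivative
        fg.speed y x / (fg.area x y * fg.area x y)) (at y)"
      by (rule derivative_eq_intros fg.speed_deriv_right fg.area_deriv_right yJ nz(1)[OF V(2)] refl)+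
        (use fg.area_speed_identity[OF x yJ] in \<open>simp add: mult.commute\<close>)
    moreover have "((\<lambda>z. hk.speed x z / hk.area x z) has_real_derivative
        hk.speed y x / (hk.area x y * hk.area x y)) (at y)"
      by (rule derivative_eq_intros hk.speed_deriv_right hk.area_deriv_right yJ nz(2)[OF V(2)] refl)+
        (use hk.area_speed_identity[OF x yJ] in \<open>simp add: mult.commute\<close>)
    ultimately have "((\<lambda>z. fg.speed x z / fg.area x z - hk.speed x z / hk.area x z) has_real_derivative
        fg.speed y x / (fg.area x y * fg.area x y) - hk.speed y x / (hk.area x y * hk.area x y)) (at y)"
      by (rule DERIV_diff)
    from derivative_of_zero_function[OF V quot this]
    have "fg.speed y x / (fg.area x y * fg.area x y) = hk.speed y x / (hk.area x y * hk.area x y)"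
      by simp
    then have "(fg.speed y x * hk.area x y) * hk.area x y = (hk.speed y x * fg.area x y) * fg.area x y"
      using nz[OF V(2)] by (simp add: field_simps)
    moreover have "hk.speed y x * fg.area x y = fg.speed y x * hk.area x y"
      using deg[OF y] by (simp add: mult.commute)
    ultimately show ?thesis
      using nz[OF V(2)] pos[OF y] by simp
  qed simp
  then show "\<exists>U. open U \<and> x \<in> U \<and> U \<subseteq> J \<and> (\<forall>y\<in>U. fg.area x y = hk.area x y)"
    using U UJ by blast
qed

section \<open>Smoothness at nondegenerate points\<close>

text \<open>
  Up to a nonzero factor, the determinant of the linear system for \<open>g1 x\<close> and \<open>k1 x\<close> that consists of
  the equations with parameters \<open>y\<close> and \<open>z\<close>.
\<close>
definition cramer_det :: "real \<Rightarrow> real \<Rightarrow> real \<Rightarrow> real" where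
  "cramer_det y z x = fg.area x y * hk.speed y x * (hk.area x z * fg.speed z x) -
                      fg.area x z * hk.speed z x * (hk.area x y * fg.speed y x)"

text \<open>
  Take \<open>y\<close> such that its equation violates degeneracy, and let \<open>z\<close> tend to \<open>x\<close>. Since
  \<open>area x z / (x - z)\<close> tends to \<open>1\<close> and \<open>speed z x\<close> tends to \<open>2\<close> for both pairs, \<open>cramer_det y z x / (x - z)\<close>
  tends to twice the defect of \<open>y\<close>.
\<close>
lemma nondegenerate_imp_cramer_det_nonzero:
  assumes x: "x \<in> J" and nd: "\<not> degenerate x"
  shows "\<exists>y\<in>J. \<exists>z\<in>J. cramer_det y z x \<noteq> 0"
proof -
  have "\<exists>\<^sub>F y in nhds x. fg.area x y * hk.speed y x \<noteq> hk.area x y * fg.speed y x"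
    using nd by (simp add: degenerate_def frequently_def)
  from frequently_eventually_frequently[OF this fg.eventually_in_J[OF x]] obtain y
    where y: "y \<in> J" and ne: "fg.area x y * hk.speed y x \<noteq> hk.area x y * fg.speed y x"
    by (auto dest: frequently_ex)
  let ?c = "fg.area x y * hk.speed y x" and ?d = "hk.area x y * fg.speed y x"
  have sp: "((\<lambda>z. fg.speed z x) \<longlongrightarrow> 2) (at x)" "((\<lambda>z. hk.speed z x) \<longlongrightarrow> 2) (at x)"
    using fg.isCont_speed_left[OF x] hk.isCont_speed_left[OF x] x by (simp_all add: isCont_def)
  have "((\<lambda>z. ?c * (hk.area x z / (x - z) * fg.speed z x) -
              fg.area x z / (x - z) * hk.speed z x * ?d) \<longlongrightarrow> ?c * (1 * 2) - 1 * 2 * ?d) (at x)"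
    by (intro tendsto_intros fg.area_quotient_tendsto hk.area_quotient_tendsto sp x)
  moreover have "?c * (1 * 2) - 1 * 2 * ?d \<noteq> 0"
    using ne by simp
  ultimately have "\<forall>\<^sub>F z in at x. ?c * (hk.area x z / (x - z) * fg.speed z x) -
              fg.area x z / (x - z) * hk.speed z x * ?d \<noteq> 0"
    by (rule tendsto_imp_eventually_ne)
  moreover have "\<forall>\<^sub>F z in at x. z \<in> J"
    using fg.eventually_in_J[OF x] by (simp add: eventually_at_filter eventually_mono)
  ultimately have "\<forall>\<^sub>F z in at x. z \<in> J \<and> ?c * (hk.area x z / (x - z) * fg.speed z x) -
              fg.area x z / (x - z) * hk.speed z x * ?d \<noteq> 0"
    by eventually_elim simp
  from eventually_happens'[OF at_neq_bot this] obtain z where z: "z \<in> J" "?c * (hk.area x z / (x - z) * fg.speed z x) -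
              fg.area x z / (x - z) * hk.speed z x * ?d \<noteq> 0"
    by blast
  have "?c * (hk.area x z / (x - z) * fg.speed z x) -
        fg.area x z / (x - z) * hk.speed z x * ?d = cramer_det y z x / (x - z)"
    by (simp add: cramer_det_def diff_divide_distrib)
  with z(2) have "cramer_det y z x \<noteq> 0"
    by (metis divide_eq_0_iff)
  with z(1) y show ?thesis by blast
qed

lemma continuous_cramer_det: "continuous_on J (cramer_det y z)"
  unfolding cramer_det_def[abs_def] fg.area_def hk.area_def fg.speed_def hk.speed_def
  by (intro continuous_intros fg.cont_f fg.cont_g hk.cont_f hk.cont_g)

definition cramer_rhs :: "real \<Rightarrow> real \<Rightarrow> real" where
  "cramer_rhs y x = (k x + k y) * fg.speed y x * g x - (g x + g y) * hk.speed y x * k x"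

lemma cramer_equation:
  assumes "x \<in> J" "y \<in> J"
  shows "g1 x * fg.area x y * hk.speed y x * k x - k1 x * hk.area x y * fg.speed y x * g x = cramer_rhs y x"
proof -
  have "(g x * fg.speed x y) * hk.speed y x * k x = g x * k x * (fg.speed x y * hk.speed y x)"
    by simp
  also have "\<dots> = (k x * hk.speed x y) * fg.speed y x * g x"
    unfolding speed_ratio[OF assms] by simp
  finally show ?thesis
    unfolding fg.speed_via_g1[OF assms(1)] hk.speed_via_g1[OF assms(1)] cramer_rhs_def
    by (simp add: algebra_simps)
qed

lemma cramer_solution:
  assumes x: "x \<in> J" and "y \<in> J" "z \<in> J" and nz: "cramer_det y z x \<noteq> 0"
  shows "g1 x = (cramer_rhs y x * (hk.area x z * fg.speed z x) -
                 cramer_rhs z x * (hk.area x y * fg.speed y x)) / (k x * cramer_det y z x)"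
    and "k1 x = (cramer_rhs y x * (fg.area x z * hk.speed z x) -
                 cramer_rhs z x * (fg.area x y * hk.speed y x)) / (g x * cramer_det y z x)"
proof -
  note eqs = cramer_equation[OF x, symmetric]
  have "g1 x * (k x * cramer_det y z x) = cramer_rhs y x * (hk.area x z * fg.speed z x) -
                 cramer_rhs z x * (hk.area x y * fg.speed y x)"
    unfolding eqs[OF \<open>y \<in> J\<close>] eqs[OF \<open>z \<in> J\<close>] cramer_det_def by (simp add: algebra_simps)
  then show "g1 x = (cramer_rhs y x * (hk.area x z * fg.speed z x) -
                 cramer_rhs z x * (hk.area x y * fg.speed y x)) / (k x * cramer_det y z x)"
    using nz hk.g_pos[OF x] by (simp add: eq_divide_eq)
  have "k1 x * (g x * cramer_det y z x) = cramer_rhs y x * (fg.area x z * hk.speed z x) -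
                 cramer_rhs z x * (fg.area x y * hk.speed y x)"
    unfolding eqs[OF \<open>y \<in> J\<close>] eqs[OF \<open>z \<in> J\<close>] cramer_det_def by (simp add: algebra_simps)
  then show "k1 x = (cramer_rhs y x * (fg.area x z * hk.speed z x) -
                 cramer_rhs z x * (fg.area x y * hk.speed y x)) / (g x * cramer_det y z x)"
    using nz fg.g_pos[OF x] by (simp add: eq_divide_eq)
qed

text \<open>
  The parameters \<open>y\<close> and \<open>z\<close> stay fixed while \<open>x\<close> varies, hence the solution of the linear system
  involves \<open>x\<close> only through \<open>f, g, h, k\<close>. If these are differentiable of order \<open>n\<close>, then so are their
  derivatives.
\<close>
lemma nondegenerate_imp_smooth:
  assumes x0: "x0 \<in> J" and nd: "\<not> degenerate x0"
  shows "\<exists>U. open U \<and> x0 \<in> U \<and> U \<subseteq> J \<and>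
    (\<forall>n. times_differentiable n U g \<and> times_differentiable n U k)"
proof -
  obtain y z where yz: "y \<in> J" "z \<in> J" and det: "cramer_det y z x0 \<noteq> 0"
    using nondegenerate_imp_cramer_det_nonzero[OF x0 nd] by blast
  define U where "U = J \<inter> cramer_det y z -` (- {0})"
  have U: "open U" "x0 \<in> U" "U \<subseteq> J"
    using continuous_open_preimage[OF continuous_cramer_det fg.open_J, of "- {0}"] x0 det
    by (auto simp: U_def)
  have nz: "cramer_det y z x \<noteq> 0" "g x \<noteq> 0" "k x \<noteq> 0" if "x \<in> U" for x
    using that fg.g_pos hk.g_pos by (force simp: U_def)+
  have "times_differentiable n U f \<and> times_differentiable n U g \<and>
        times_differentiable n U h \<and> times_differentiable n U k" for n
  proof (induction n)
    case (Suc n)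
    then have s: "times_differentiable n U f" "times_differentiable n U g"
        "times_differentiable n U h" "times_differentiable n U k"
      by auto
    have pieces: "times_differentiable n U (\<lambda>x. fg.area x v)" "times_differentiable n U (\<lambda>x. hk.area x v)"
        "times_differentiable n U (fg.speed v)" "times_differentiable n U (hk.speed v)" for v
      unfolding fg.area_def hk.area_def fg.speed_def[abs_def] hk.speed_def[abs_def]
      by (intro times_differentiable_intros s)+
    have pieces2: "times_differentiable n U (cramer_rhs v)" "times_differentiable n U (cramer_det y z)" for v
      unfolding cramer_rhs_def[abs_def] cramer_det_def[abs_def]
      by (intro times_differentiable_intros s pieces)+
    have g1: "times_differentiable n U g1"
      by (rule times_differentiable_cong[OF U(1)], rule cramer_solution(1)[OF _ yz, symmetric])
        (use U nz in \<open>auto intro!: times_differentiable_intros s pieces pieces2\<close>)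
    have k1: "times_differentiable n U k1"
      by (rule times_differentiable_cong[OF U(1)], rule cramer_solution(2)[OF _ yz, symmetric])
        (use U nz in \<open>auto intro!: times_differentiable_intros s pieces pieces2\<close>)
    have f1: "times_differentiable n U f1"
      by (rule times_differentiable_cong[OF U(1)], rule fg.f1_via_g1[symmetric])
        (use U nz in \<open>auto intro!: times_differentiable_intros s g1\<close>)
    have h1: "times_differentiable n U h1"
      by (rule times_differentiable_cong[OF U(1)], rule hk.f1_via_g1[symmetric])
        (use U nz in \<open>auto intro!: times_differentiable_intros s k1\<close>)
    show ?case
      using times_differentiable_SucI[OF _ f1, of f] times_differentiable_SucI[OF _ g1, of g]
        times_differentiable_SucI[OF _ h1, of h] times_differentiable_SucI[OF _ k1, of k]
        fg.deriv_f fg.deriv_g hk.deriv_f hk.deriv_g U(3)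
      by blast
  qed auto
  with U show ?thesis by blast
qed

section \<open>The transition matrix\<close>

text \<open>
  The entries of the matrix of determinant one that maps \<open>(f y, g y)\<close> to \<open>(h y, k y)\<close> and
  \<open>(f1 y, g1 y)\<close> to \<open>(h1 y, k1 y)\<close>.
\<close>
definition m11 where "m11 y = h1 y * g y - h y * g1 y"
definition m12 where "m12 y = h y * f1 y - h1 y * f y"
definition m21 where "m21 y = k1 y * g y - k y * g1 y"
definition m22 where "m22 y = k y * f1 y - k1 y * f y"

lemmas transition_defs = m11_def[abs_def] m12_def[abs_def] m21_def[abs_def] m22_def[abs_def]

lemma transition_maps:
  assumes "y \<in> J"
  shows "h y = m11 y * f y + m12 y * g y" "k y = m21 y * f y + m22 y * g y"
proof -
  have "m11 y * f y + m12 y * g y = h y * (f1 y * g y - f y * g1 y)"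
       "m21 y * f y + m22 y * g y = k y * (f1 y * g y - f y * g1 y)"
    by (simp_all add: transition_defs algebra_simps)
  then show "h y = m11 y * f y + m12 y * g y" "k y = m21 y * f y + m22 y * g y"
    using fg.unimodular[OF assms] by simp_all
qed

lemma transition_det:
  assumes "y \<in> J"
  shows "m11 y * m22 y - m12 y * m21 y = 1"
proof -
  have "m11 y * m22 y - m12 y * m21 y = (h1 y * k y - h y * k1 y) * (f1 y * g y - f y * g1 y)"
    by (simp add: transition_defs algebra_simps)
  then show ?thesis
    using fg.unimodular[OF assms] hk.unimodular[OF assms] by simp
qed

lemma transition_eq_imp_area_eq:
  assumes x: "x \<in> J" and y: "y \<in> J"
    and "m11 y = m11 x" "m12 y = m12 x" "m21 y = m21 x" "m22 y = m22 x"
  shows "fg.area x y = hk.area x y"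
proof -
  have "hk.area x y = (m11 x * m22 x - m12 x * m21 x) * fg.area x y"
    unfolding hk.area_def fg.area_def transition_maps[OF x] transition_maps[OF y] assms(3-6)
    by (simp add: algebra_simps)
  then show ?thesis using transition_det[OF x] by simp
qed

text \<open>
  Equality of the two areas and of their derivatives in \<open>y\<close> says that pairing with \<open>(f x, g x)\<close> and
  with \<open>(h x, k x)\<close> agree, via the transition matrix at \<open>y\<close>, on the basis formed by position and velocity
  at \<open>y\<close>. Hence that matrix maps the position of the first curve at \<open>x\<close> to that of the second.
\<close>
lemma area_eq_imp_transition_fixes:
  assumes "open U" "U \<subseteq> J" "\<And>y. y \<in> U \<Longrightarrow> fg.area x y = hk.area x y" "y \<in> U"
  shows "m11 y * f x + m12 y * g x = h x" "m21 y * f x + m22 y * g x = k x"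
proof -
  have e: "f x * g y - g x * f y = h x * k y - k x * h y"
    using assms(3)[OF assms(4)] by (simp add: fg.area_def hk.area_def)
  have e1: "f1 y * g x - g1 y * f x = h1 y * k x - k1 y * h x"
    using area_eq_imp_speed_eq[OF assms] by (simp add: fg.speed_def hk.speed_def)
  have u: "h1 y * k y - h y * k1 y = 1"
    using hk.unimodular assms(2,4) by blast
  have "m11 y * f x + m12 y * g x = h1 y * (f x * g y - g x * f y) + h y * (f1 y * g x - g1 y * f x)"
    by (simp add: transition_defs algebra_simps)
  also have "\<dots> = h x * (h1 y * k y - h y * k1 y)"
    unfolding e e1 by (simp add: algebra_simps)
  finally show "m11 y * f x + m12 y * g x = h x" using u by simp
  have "m21 y * f x + m22 y * g x = k1 y * (f x * g y - g x * f y) + k y * (f1 y * g x - g1 y * f x)"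
    by (simp add: transition_defs algebra_simps)
  also have "\<dots> = k x * (h1 y * k y - h y * k1 y)"
    unfolding e e1 by (simp add: algebra_simps)
  finally show "m21 y * f x + m22 y * g x = k x" using u by simp
qed

end

lemma times_differentiable_subset:
  "times_differentiable n U \<phi> \<Longrightarrow> V \<subseteq> U \<Longrightarrow> times_differentiable n V \<phi>"
  by (induction n arbitrary: \<phi>) (simp_all, blast)

lemma derivatives_of_equal_functions:
  fixes \<phi> \<psi> :: "real \<Rightarrow> real"
  assumes U: "open U" and eq: "\<And>x. x \<in> U \<Longrightarrow> \<phi> x = \<psi> x"
    and "\<And>x. x \<in> U \<Longrightarrow> (\<phi> has_real_derivative \<phi>1 x) (at x)"
    and "\<And>x. x \<in> U \<Longrightarrow> (\<psi> has_real_derivative \<psi>1 x) (at x)"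
    and x: "x \<in> U"
  shows "\<phi>1 x = \<psi>1 x"
proof -
  have "((\<lambda>x. \<phi> x - \<psi> x) has_real_derivative \<phi>1 x - \<psi>1 x) (at x)"
    using assms by (intro DERIV_diff) auto
  from derivative_of_zero_function[OF U x _ this] eq show ?thesis by simp
qed

text \<open>
  The function is constant on either side of each center, and continuity glues the two sides; so the
  derivative exists and vanishes at the center too.
\<close>
lemma locally_constant_off_centers_imp_constant:
  fixes \<phi> :: "real \<Rightarrow> real"
  assumes J: "is_interval J" and c: "continuous_on J \<phi>"
    and loc: "\<And>x. x \<in> J \<Longrightarrow>
      \<exists>r>0. ball x r \<subseteq> J \<and> (\<forall>y\<in>ball x r. y \<noteq> x \<longrightarrow> (\<phi> has_real_derivative 0) (at y))"
  shows "\<exists>c. \<forall>x\<in>J. \<phi> x = c"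
proof (rule zero_derivative_imp_constant[OF J])
  fix x assume "x \<in> J"
  from loc[OF this] obtain r where r: "r > 0" "ball x r \<subseteq> J"
      and d: "\<And>y. y \<in> ball x r \<Longrightarrow> y \<noteq> x \<Longrightarrow> (\<phi> has_real_derivative 0) (at y)"
    by blast
  have eq: "\<phi> x = \<phi> y" if y: "y \<in> ball x r" for y
  proof -
    have sub: "{min x y..max x y} \<subseteq> ball x r"
      using y by (auto simp: dist_real_def min_def max_def split: if_splits)
    have "\<phi> (max x y) = \<phi> (min x y)" if "x \<noteq> y"
    proof (rule DERIV_isconst_end[where f = \<phi>])
      show "min x y < max x y" using that by auto
      show "continuous_on {min x y..max x y} \<phi>"
        using c sub r(2) continuous_on_subset by blast
      fix z assume z: "min x y < z" "z < max x y"
      then have "z \<in> ball x r" "z \<noteq> x"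
        using sub by (auto simp: subset_iff min_def max_def split: if_splits)
      then show "(\<phi> has_real_derivative 0) (at z)" by (rule d)
    qed
    then show ?thesis
      by (cases "x = y"; cases "x \<le> y") (auto simp: min_def max_def)
  qed
  show "(\<phi> has_real_derivative 0) (at x)"
    by (rule has_field_derivative_transform_within_open[OF DERIV_const open_ball _ eq])
      (use r(1) in simp_all)
qed

context two_unimodular_pairs
begin

section \<open>The dichotomy\<close>

text \<open>
  The normalization at a point \<open>a\<close> uses the functions \<open>y \<mapsto> - area a y\<close> and \<open>y \<mapsto> speed a y - 1\<close>, which are
  the solutions \<open>F\<close> and \<open>G\<close> of \<open>y'' = p y\<close> with \<open>F a = 0\<close>, \<open>F' a = 1\<close> and \<open>G a = 1\<close>, \<open>G' a = 0\<close>. In terms of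
  these, \<open>speed_ratio\<close> at \<open>(a, y)\<close> is the product identity of \<open>jets_of_normalized_solutions\<close>.
\<close>
lemma nondegenerate_local_structure:
  assumes x0: "x0 \<in> J" and nd: "\<not> degenerate x0"
  shows "\<exists>r \<alpha> \<beta>. r > 0 \<and> ball x0 r \<subseteq> J \<and> \<alpha> \<noteq> \<beta> \<and>
    (\<forall>x\<in>ball x0 r.
      (f1 has_real_derivative \<alpha> * f x) (at x) \<and> (g1 has_real_derivative \<alpha> * g x) (at x) \<and>
      (h1 has_real_derivative \<beta> * h x) (at x) \<and> (k1 has_real_derivative \<beta> * k x) (at x))"
proof -
  obtain U where U: "open U" "x0 \<in> U" "U \<subseteq> J"
      and sm: "\<And>n. times_differentiable n U g" "\<And>n. times_differentiable n U k"
    using nondegenerate_imp_smooth[OF x0 nd] by blast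
  from U(1,2) obtain r where r: "r > 0" "ball x0 r \<subseteq> U"
    using open_contains_ball by blast
  define V where "V = ball x0 r"
  have V: "open V" "x0 \<in> V" "V \<subseteq> J"
    using r U(3) by (auto simp: V_def)
  have sV: "times_differentiable n V g" "times_differentiable n V k" for n
    using sm r(2) times_differentiable_subset V_def by blast+
  obtain p where sp: "times_differentiable (Suc (Suc (Suc (Suc 0)))) V p"
      and p: "\<And>x. x \<in> V \<Longrightarrow> (f1 has_real_derivative p x * f x) (at x)"
        "\<And>x. x \<in> V \<Longrightarrow> (g1 has_real_derivative p x * g x) (at x)"
    using fg.smooth_imp_hill_equation[OF V(1,3) sV(1)] by blast
  obtain q where sq: "times_differentiable (Suc (Suc (Suc (Suc 0)))) V q"
      and q: "\<And>x. x \<in> V \<Longrightarrow> (h1 has_real_derivative q x * h x) (at x)"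
        "\<And>x. x \<in> V \<Longrightarrow> (k1 has_real_derivative q x * k x) (at x)"
    using hk.smooth_imp_hill_equation[OF V(1,3) sV(2)] by blast
  from sp obtain p1 p2 p3 p4 where dp: "\<And>x. x \<in> V \<Longrightarrow> (p has_real_derivative p1 x) (at x)"
      "\<And>x. x \<in> V \<Longrightarrow> (p1 has_real_derivative p2 x) (at x)"
      "\<And>x. x \<in> V \<Longrightarrow> (p2 has_real_derivative p3 x) (at x)"
      "\<And>x. x \<in> V \<Longrightarrow> (p3 has_real_derivative p4 x) (at x)"
    unfolding times_differentiable.simps by blast
  from sq obtain q1 q2 q3 q4 where dq: "\<And>x. x \<in> V \<Longrightarrow> (q has_real_derivative q1 x) (at x)"
      "\<And>x. x \<in> V \<Longrightarrow> (q1 has_real_derivative q2 x) (at x)"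
      "\<And>x. x \<in> V \<Longrightarrow> (q2 has_real_derivative q3 x) (at x)"
      "\<And>x. x \<in> V \<Longrightarrow> (q3 has_real_derivative q4 x) (at x)"
    unfolding times_differentiable.simps by blast
  have dfghk: "(f has_real_derivative f1 x) (at x)" "(g has_real_derivative g1 x) (at x)"
      "(h has_real_derivative h1 x) (at x)" "(k has_real_derivative k1 x) (at x)" if "x \<in> V" for x
    using that V(3) fg.deriv_f fg.deriv_g hk.deriv_f hk.deriv_g by blast+
  have jets: "p1 a = q1 a" "p3 a = q3 a \<Longrightarrow> (p a - q a) * p1 a = 0" if a: "a \<in> V" for a
  proof -
    have aJ: "a \<in> J" using a V(3) by blast
    note u = fg.unimodular[OF aJ] hk.unimodular[OF aJ]
    define F F1 where "F = (\<lambda>y. g a * f y - f a * g y)" and "F1 = (\<lambda>y. g a * f1 y - f a * g1 y)"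
    define G G1 where "G = (\<lambda>y. f1 a * g y - g1 a * f y)" and "G1 = (\<lambda>y. f1 a * g1 y - g1 a * f1 y)"
    define H H1 where "H = (\<lambda>y. k a * h y - h a * k y)" and "H1 = (\<lambda>y. k a * h1 y - h a * k1 y)"
    define K K1 where "K = (\<lambda>y. h1 a * k y - k1 a * h y)" and "K1 = (\<lambda>y. h1 a * k1 y - k1 a * h1 y)"
    note defs = F_def F1_def G_def G1_def H_def H1_def K_def K1_def
    have d: "(F has_real_derivative F1 x) (at x)" "(F1 has_real_derivative p x * F x) (at x)"
        "(G has_real_derivative G1 x) (at x)" "(G1 has_real_derivative p x * G x) (at x)"
        "(H has_real_derivative H1 x) (at x)" "(H1 has_real_derivative q x * H x) (at x)"
        "(K has_real_derivative K1 x) (at x)" "(K1 has_real_derivative q x * K x) (at x)"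
      if "x \<in> V" for x
      unfolding defs
      by ((rule derivative_eq_intros dfghk[OF that] p[OF that] q[OF that] refl)+,
          simp add: algebra_simps)+
    have ini: "F a = 0" "F1 a = 1" "G a = 1" "G1 a = 0" "H a = 0" "H1 a = 1" "K a = 1" "K1 a = 0"
      using u by (simp_all add: defs mult.commute)
    have eq: "(1 + G x) * (1 + H1 x) = (1 + K x) * (1 + F1 x)" if "x \<in> V" for x
      using speed_ratio[OF aJ, of x] that V(3)
      by (auto simp: fg.speed_def hk.speed_def defs mult.commute add_diff_eq)
    show "p1 a = q1 a" "p3 a = q3 a \<Longrightarrow> (p a - q a) * p1 a = 0"
      using jets_of_normalized_solutions[OF V(1) a d dp dq ini eq] by simp_all
  qed
  have p1q1: "p1 x = q1 x" if "x \<in> V" for x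
    using jets(1) that .
  have p2q2: "p2 x = q2 x" if "x \<in> V" for x
    by (rule derivatives_of_equal_functions[OF V(1) p1q1 dp(2) dq(2) that])
  have p3q3: "p3 x = q3 x" if "x \<in> V" for x
    by (rule derivatives_of_equal_functions[OF V(1) p2q2 dp(3) dq(3) that])
  have "((\<lambda>x. p x - q x) has_real_derivative 0) (at x)" if "x \<in> V" for x
    using DERIV_diff[OF dp(1) dq(1), OF that that] p1q1[OF that] by simp
  then obtain c where c: "\<And>x. x \<in> V \<Longrightarrow> p x - q x = c"
    using zero_derivative_imp_constant[of V "\<lambda>x. p x - q x"]
    by (auto simp: V_def is_interval_ball_real)
  \<comment> \<open>If \<open>p = q\<close>, the transition matrix is constant, the areas agree, and the center is degenerate.\<close>
  have "c \<noteq> 0"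
  proof
    assume "c = 0"
    then have pq: "q x = p x" if "x \<in> V" for x using c that by force
    have const: "\<phi> x = \<phi> x0" if "\<And>x. x \<in> V \<Longrightarrow> (\<phi> has_real_derivative 0) (at x)" "x \<in> V" for \<phi> x
      using zero_derivative_imp_constant[of V \<phi>] that V(2)
      by (auto simp: V_def is_interval_ball_real)
    have m: "(m11 has_real_derivative 0) (at x)" "(m12 has_real_derivative 0) (at x)"
         "(m21 has_real_derivative 0) (at x)" "(m22 has_real_derivative 0) (at x)" if x: "x \<in> V" for x
      unfolding transition_defs
      by ((rule derivative_eq_intros dfghk[OF x] p[OF x] q[OF x, unfolded pq[OF x]] refl)+,
          simp add: algebra_simps)+
    note const[OF m(1)] const[OF m(2)] const[OF m(3)] const[OF m(4)]
    then have "fg.area x0 x = hk.area x0 x" if "x \<in> V" for x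
      using transition_eq_imp_area_eq[OF x0] V(3) that by blast
    with nd degenerate_iff[OF x0] V show False by blast
  qed
  have "(p has_real_derivative 0) (at x)" if "x \<in> V" for x
    using jets(2)[OF that p3q3[OF that]] c[OF that] \<open>c \<noteq> 0\<close> dp(1)[OF that] by simp
  then obtain \<alpha> where \<alpha>: "\<And>x. x \<in> V \<Longrightarrow> p x = \<alpha>"
    using zero_derivative_imp_constant[of V p] by (auto simp: V_def is_interval_ball_real)
  then have \<beta>: "q x = \<alpha> - c" if "x \<in> V" for x
    using c[OF that] that by force
  show ?thesis
    using r(1) V(3) \<open>c \<noteq> 0\<close> p q \<alpha> \<beta>
    by (intro exI[of _ r] exI[of _ \<alpha>] exI[of _ "\<alpha> - c"]) (simp add: V_def)
qed

text \<open>
  A function that solves both \<open>y'' = \<alpha> y\<close> and \<open>y'' = \<beta> y\<close> with \<open>\<alpha> \<noteq> \<beta>\<close> vanishes. Applied to the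
  common function \<open>y \<mapsto> area x y\<close> of both pairs, this prevents degenerate and nondegenerate points from lying close together.
\<close>
lemma distinct_curvatures_imp_area_zero:
  assumes V: "open V" "V \<subseteq> J" and eq: "\<And>z. z \<in> V \<Longrightarrow> fg.area x z = hk.area x z"
    and ne: "\<alpha> \<noteq> \<beta>"
    and d: "\<forall>v\<in>V. (f1 has_real_derivative \<alpha> * f v) (at v) \<and> (g1 has_real_derivative \<alpha> * g v) (at v) \<and>
        (h1 has_real_derivative \<beta> * h v) (at v) \<and> (k1 has_real_derivative \<beta> * k v) (at v)"
    and z: "z \<in> V"
  shows "fg.area x z = 0"
proof -
  have "1 - fg.speed v x = 1 - hk.speed v x" if "v \<in> V" for v
    using area_eq_imp_speed_eq[OF V eq that] by simp
  moreover have "((\<lambda>v. 1 - fg.speed v x) has_real_derivative \<alpha> * fg.area x v) (at v)"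
      "((\<lambda>v. 1 - hk.speed v x) has_real_derivative \<beta> * hk.area x v) (at v)" if "v \<in> V" for v
    unfolding fg.speed_def hk.speed_def fg.area_def hk.area_def
    using d that by (auto simp: algebra_simps intro!: derivative_eq_intros)
  ultimately have "\<alpha> * fg.area x z = \<beta> * hk.area x z"
    by (rule derivatives_of_equal_functions[OF V(1) _ _ _ z])
  then show ?thesis
    using eq[OF z] ne by simp
qed

lemma open_nondegenerate: "open {x \<in> J. \<not> degenerate x}"
  unfolding open_subopen[of "{x \<in> J. \<not> degenerate x}"]
proof clarify
  fix x assume "x \<in> J" "\<not> degenerate x"
  from nondegenerate_local_structure[OF this] obtain r \<alpha> \<beta> where
    r: "r > 0" "ball x r \<subseteq> J" and ne: "\<alpha> \<noteq> \<beta>" and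
    d: "\<forall>v\<in>ball x r. (f1 has_real_derivative \<alpha> * f v) (at v) \<and> (g1 has_real_derivative \<alpha> * g v) (at v) \<and>
        (h1 has_real_derivative \<beta> * h v) (at v) \<and> (k1 has_real_derivative \<beta> * k v) (at v)"
    by blast
  have "\<not> degenerate y" if y: "y \<in> ball x r" for y
  proof
    assume deg: "degenerate y"
    have yJ: "y \<in> J" using y r(2) by blast
    from degenerate_iff[OF yJ] deg obtain U where
      U: "open U" "y \<in> U" "U \<subseteq> J" "\<forall>z\<in>U. fg.area y z = hk.area y z"
      by blast
    define V where "V = U \<inter> ball x r"
    have V: "open V" "V \<subseteq> J" "y \<in> V"
      using U y by (auto simp: V_def)
    have "V \<noteq> {y}"
      using V(1) not_open_singleton by blast
    with V(3) obtain z where z: "z \<in> V" "z \<noteq> y" by blast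
    have "fg.area y z = 0"
      by (rule distinct_curvatures_imp_area_zero[OF V(1,2) _ ne _ z(1)])
        (use U(4) d in \<open>auto simp: V_def\<close>)
    moreover have "z \<in> J" using z(1) V(2) by blast
    ultimately show False
      using fg.area_eq_0_iff[OF yJ] z(2) by blast
  qed
  with r show "\<exists>T. open T \<and> x \<in> T \<and> T \<subseteq> {x \<in> J. \<not> degenerate x}"
    by (intro exI[of _ "ball x r"]) auto
qed

lemma open_degenerate: "open {x \<in> J. degenerate x}"
  unfolding open_subopen[of "{x \<in> J. degenerate x}"]
proof clarify
  fix x assume x: "x \<in> J" "degenerate x"
  from degenerate_iff[OF x(1)] x(2) obtain U where
    U: "open U" "x \<in> U" "U \<subseteq> J" "\<forall>z\<in>U. fg.area x z = hk.area x z"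
    by blast
  have "degenerate y" if y: "y \<in> U" for y
  proof (rule ccontr)
    assume nd: "\<not> degenerate y"
    have yJ: "y \<in> J" using y U(3) by blast
    from nondegenerate_local_structure[OF yJ nd] obtain r \<alpha> \<beta> where
      r: "r > 0" "ball y r \<subseteq> J" and ne: "\<alpha> \<noteq> \<beta>" and
      d: "\<forall>v\<in>ball y r. (f1 has_real_derivative \<alpha> * f v) (at v) \<and> (g1 has_real_derivative \<alpha> * g v) (at v) \<and>
        (h1 has_real_derivative \<beta> * h v) (at v) \<and> (k1 has_real_derivative \<beta> * k v) (at v)"
      by blast
    have "fg.area x y = 0"
      by (rule distinct_curvatures_imp_area_zero[of "U \<inter> ball y r", OF _ _ _ ne])
        (use U d r y in auto)
    with fg.area_eq_0_iff[OF x(1) yJ] x(2) nd show False by blast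
  qed
  with U show "\<exists>T. open T \<and> x \<in> T \<and> T \<subseteq> {x \<in> J. degenerate x}"
    by blast
qed

text \<open>
  Near \<open>x\<close> the transition matrix maps the first position at \<open>x\<close> to the second one. Near a point \<open>y \<noteq> x\<close>
  that is close to \<open>x\<close> it does the same for \<open>x\<close> and for \<open>y\<close>, and these positions are linearly
  independent, hence the matrix is constant there. The neighborhoods on which the areas agree may
  shrink as \<open>y\<close> varies, so the argument says nothing at \<open>x\<close> itself, and continuity is used there.
\<close>
lemma all_degenerate_imp_pair_equiv:
  assumes "J \<noteq> {}" and deg: "\<And>x. x \<in> J \<Longrightarrow> degenerate x"
  shows "pair_equiv J (f, g) (h, k)"
proof -
  have near: "\<exists>r>0. ball x r \<subseteq> J \<and> (\<forall>y\<in>ball x r. fg.area x y = hk.area x y)" if x: "x \<in> J" for x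
  proof -
    from degenerate_iff[OF x] deg[OF x] obtain U where
      U: "open U" "x \<in> U" "U \<subseteq> J" "\<forall>z\<in>U. fg.area x z = hk.area x z"
      by blast
    from U(1,2) obtain r where "r > 0" "ball x r \<subseteq> U"
      using open_contains_ball by blast
    with U(3,4) show ?thesis by blast
  qed
  have loc: "\<exists>r>0. ball x r \<subseteq> J \<and> (\<forall>y\<in>ball x r. y \<noteq> x \<longrightarrow>
      (m11 has_real_derivative 0) (at y) \<and> (m12 has_real_derivative 0) (at y) \<and>
      (m21 has_real_derivative 0) (at y) \<and> (m22 has_real_derivative 0) (at y))" if x: "x \<in> J" for x
  proof -
    from near[OF x] obtain r where r: "r > 0" "ball x r \<subseteq> J" "\<And>y. y \<in> ball x r \<Longrightarrow> fg.area x y = hk.area x y"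
      by blast
    have "(m11 has_real_derivative 0) (at y) \<and> (m12 has_real_derivative 0) (at y) \<and>
      (m21 has_real_derivative 0) (at y) \<and> (m22 has_real_derivative 0) (at y)"
      if y: "y \<in> ball x r" "y \<noteq> x" for y
    proof -
      have yJ: "y \<in> J" using y(1) r(2) by blast
      from near[OF yJ] obtain s where s: "s > 0" "ball y s \<subseteq> J" "\<And>z. z \<in> ball y s \<Longrightarrow> fg.area y z = hk.area y z"
        by blast
      define V where "V = ball x r \<inter> ball y s"
      have V: "open V" "y \<in> V"
        using y s by (auto simp: V_def)
      have e: "fg.area x y \<noteq> 0"
        using fg.area_eq_0_iff[OF x yJ] y(2) by blast
      have fix_x: "m11 z * f x + m12 z * g x = h x" "m21 z * f x + m22 z * g x = k x" if "z \<in> V" for z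
        using area_eq_imp_transition_fixes[OF open_ball r(2,3)] that by (auto simp: V_def)
      have fix_y: "m11 z * f y + m12 z * g y = h y" "m21 z * f y + m22 z * g y = k y" if "z \<in> V" for z
        using area_eq_imp_transition_fixes[OF open_ball s(2,3)] that by (auto simp: V_def)
      have solve: "m = (c * g y - d * g x) / fg.area x y" "m' = (d * f x - c * f y) / fg.area x y"
        if "m * f x + m' * g x = c" "m * f y + m' * g y = d" for m m' c d
        using e unfolding that[symmetric] by (simp_all add: fg.area_def field_simps)
      show ?thesis
      proof (intro conjI)
        show "(m11 has_real_derivative 0) (at y)"
          by (rule has_field_derivative_transform_within_open[OF DERIV_const V])
            (rule solve(1)[OF fix_x(1) fix_y(1), symmetric])
        show "(m12 has_real_derivative 0) (at y)"
          by (rule has_field_derivative_transform_within_open[OF DERIV_const V])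
            (rule solve(2)[OF fix_x(1) fix_y(1), symmetric])
        show "(m21 has_real_derivative 0) (at y)"
          by (rule has_field_derivative_transform_within_open[OF DERIV_const V])
            (rule solve(1)[OF fix_x(2) fix_y(2), symmetric])
        show "(m22 has_real_derivative 0) (at y)"
          by (rule has_field_derivative_transform_within_open[OF DERIV_const V])
            (rule solve(2)[OF fix_x(2) fix_y(2), symmetric])
      qed
    qed
    with r(1,2) show ?thesis by blast
  qed
  have cont: "continuous_on J m11" "continuous_on J m12" "continuous_on J m21" "continuous_on J m22"
    unfolding transition_defs
    by (intro continuous_intros fg.cont_f fg.cont_g hk.cont_f hk.cont_g fg.cont_f1 fg.cont_g1
        hk.cont_f1 hk.cont_g1)+
  have "\<exists>c. \<forall>x\<in>J. m11 x = c"
    by (rule locally_constant_off_centers_imp_constant[OF fg.interval_J cont(1)]) (use loc in blast)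
  then obtain a where a: "\<forall>x\<in>J. m11 x = a" by blast
  have "\<exists>c. \<forall>x\<in>J. m12 x = c"
    by (rule locally_constant_off_centers_imp_constant[OF fg.interval_J cont(2)]) (use loc in blast)
  then obtain b where b: "\<forall>x\<in>J. m12 x = b" by blast
  have "\<exists>c. \<forall>x\<in>J. m21 x = c"
    by (rule locally_constant_off_centers_imp_constant[OF fg.interval_J cont(3)]) (use loc in blast)
  then obtain c where c: "\<forall>x\<in>J. m21 x = c" by blast
  have "\<exists>c. \<forall>x\<in>J. m22 x = c"
    by (rule locally_constant_off_centers_imp_constant[OF fg.interval_J cont(4)]) (use loc in blast)
  then obtain d where d: "\<forall>x\<in>J. m22 x = d" by blast
  obtain x0 where "x0 \<in> J" using assms(1) by blast
  then have "a * d - b * c \<noteq> 0"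
    using transition_det[of x0] a b c d by simp
  moreover have "\<forall>x\<in>J. h x = a * f x + b * g x \<and> k x = c * f x + d * g x"
    using transition_maps a b c d by metis
  ultimately show ?thesis
    unfolding pair_equiv_def by blast
qed

theorem equivalent_or_constant_curvature:
  assumes ne: "J \<noteq> {}"
  shows "pair_equiv J (f, g) (h, k) \<or>
    (\<exists>\<alpha> \<beta>. \<forall>x\<in>J.
      (f1 has_real_derivative \<alpha> * f x) (at x) \<and> (g1 has_real_derivative \<alpha> * g x) (at x) \<and>
      (h1 has_real_derivative \<beta> * h x) (at x) \<and> (k1 has_real_derivative \<beta> * k x) (at x))"
proof (cases "\<forall>x\<in>J. degenerate x")
  case True
  with all_degenerate_imp_pair_equiv[OF ne] show ?thesis by blast
next
  case False
  have "connected J"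
    using fg.interval_J is_interval_connected_1 by blast
  then have "{x \<in> J. degenerate x} \<inter> J = {} \<or> {x \<in> J. \<not> degenerate x} \<inter> J = {}"
    by (rule connectedD[OF _ open_degenerate open_nondegenerate]) auto
  with False have nd: "\<not> degenerate x" if "x \<in> J" for x
    using that by blast
  \<comment> \<open>The local constants depend on the neighborhood; these functions recover them pointwise.\<close>
  define \<alpha> \<beta> where "\<alpha> = (\<lambda>x. deriv g1 x / g x)" and "\<beta> = (\<lambda>x. deriv k1 x / k x)"
  have loc: "\<exists>r a b. r > 0 \<and> (\<forall>v\<in>ball x r. \<alpha> v = a \<and> \<beta> v = b \<and>
      (f1 has_real_derivative a * f v) (at v) \<and> (g1 has_real_derivative a * g v) (at v) \<and>
      (h1 has_real_derivative b * h v) (at v) \<and> (k1 has_real_derivative b * k v) (at v))"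
    if x: "x \<in> J" for x
  proof -
    from nondegenerate_local_structure[OF x nd[OF x]] obtain r a b where
      r: "r > 0" "ball x r \<subseteq> J" and
      d: "\<forall>v\<in>ball x r. (f1 has_real_derivative a * f v) (at v) \<and> (g1 has_real_derivative a * g v) (at v) \<and>
        (h1 has_real_derivative b * h v) (at v) \<and> (k1 has_real_derivative b * k v) (at v)"
      by blast
    have "\<alpha> v = a \<and> \<beta> v = b" if v: "v \<in> ball x r" for v
    proof -
      have "v \<in> J" using v r(2) by blast
      then have "g v > 0" "k v > 0"
        using fg.g_pos hk.g_pos by auto
      moreover have "deriv g1 v = a * g v" "deriv k1 v = b * k v"
        using d v DERIV_imp_deriv by blast+
      ultimately show ?thesis by (simp add: \<alpha>_def \<beta>_def)
    qed
    with r(1) d show ?thesis by blast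
  qed
  have "(\<alpha> has_real_derivative 0) (at x) \<and> (\<beta> has_real_derivative 0) (at x)" if x: "x \<in> J" for x
  proof -
    from loc[OF x] obtain r a b where r: "r > 0" and d: "\<forall>v\<in>ball x r. \<alpha> v = a \<and> \<beta> v = b \<and>
      (f1 has_real_derivative a * f v) (at v) \<and> (g1 has_real_derivative a * g v) (at v) \<and>
      (h1 has_real_derivative b * h v) (at v) \<and> (k1 has_real_derivative b * k v) (at v)"
      by blast
    have ab: "a = \<alpha> v" "b = \<beta> v" if "v \<in> ball x r" for v
      using bspec[OF d that] by simp_all
    have xb: "x \<in> ball x r" using r by simp
    show ?thesis
      by (intro conjI; rule has_field_derivative_transform_within_open[OF DERIV_const open_ball xb])
        (rule ab, assumption)+
  qed
  then obtain a b where ab: "\<forall>x\<in>J. \<alpha> x = a" "\<forall>x\<in>J. \<beta> x = b"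
    using zero_derivative_imp_constant[OF fg.interval_J, of \<alpha>]
      zero_derivative_imp_constant[OF fg.interval_J, of \<beta>] by blast
  have "(f1 has_real_derivative a * f x) (at x) \<and> (g1 has_real_derivative a * g x) (at x) \<and>
      (h1 has_real_derivative b * h x) (at x) \<and> (k1 has_real_derivative b * k x) (at x)"
    if x: "x \<in> J" for x
  proof -
    from loc[OF x] obtain r a' b' where r: "r > 0" and d: "\<forall>v\<in>ball x r. \<alpha> v = a' \<and> \<beta> v = b' \<and>
      (f1 has_real_derivative a' * f v) (at v) \<and> (g1 has_real_derivative a' * g v) (at v) \<and>
      (h1 has_real_derivative b' * h v) (at v) \<and> (k1 has_real_derivative b' * k v) (at v)"
      by blast
    have "x \<in> ball x r" using r by simp
    from bspec[OF d this] ab x show ?thesis by simp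
  qed
  then show ?thesis by blast
qed

end

section \<open>The mean of a single pair\<close>

lemma pair_equiv_sym:
  assumes "pair_equiv I (f, g) (h, k)"
  shows "pair_equiv I (h, k) (f, g)"
proof -
  from assms obtain a b c d where det: "a * d - b * c \<noteq> 0"
    and eq: "\<And>x. x \<in> I \<Longrightarrow> h x = a * f x + b * g x \<and> k x = c * f x + d * g x"
    unfolding pair_equiv_def by auto
  define D where "D = a * d - b * c"
  have D: "D \<noteq> 0" using det by (simp add: D_def)
  have "f x = d / D * h x + (- b / D) * k x \<and> g x = (- c / D) * h x + a / D * k x" if "x \<in> I" for x
  proof -
    have "f x * D = d * h x - b * k x" "g x * D = a * k x - c * h x"
      using eq[OF that] by (simp_all add: D_def algebra_simps)
    then show ?thesis
      using D by (simp add: field_simps)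
  qed
  moreover have "d / D * (a / D) - (- b / D) * (- c / D) = D / (D * D)"
    unfolding D_def by (simp add: diff_divide_distrib mult.commute)
  then have "d / D * (a / D) - (- b / D) * (- c / D) \<noteq> 0"
    using D by simp
  ultimately show ?thesis
    unfolding pair_equiv_def split by blast
qed

locale bajraktarevic_pair =
  fixes I :: "real set" and f f1 g g1 :: "real \<Rightarrow> real"
  assumes I_ne: "I \<noteq> {}" and open_I: "open I" and interval_I: "is_interval I"
    and deriv_f: "\<And>x. x \<in> I \<Longrightarrow> (f has_real_derivative f1 x) (at x)"
    and deriv_g: "\<And>x. x \<in> I \<Longrightarrow> (g has_real_derivative g1 x) (at x)"
    and cont_f1: "continuous_on I f1" and cont_g1: "continuous_on I g1"
    and g_pos: "\<And>x. x \<in> I \<Longrightarrow> g x > 0"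
    and wronskian_nz: "\<And>x. x \<in> I \<Longrightarrow> f1 x * g x - f x * g1 x \<noteq> 0"
begin

definition W :: "real \<Rightarrow> real" where "W x = f1 x * g x - f x * g1 x"

definition u :: "real \<Rightarrow> real" where "u x = f x / g x"

lemma W_nz: "x \<in> I \<Longrightarrow> W x \<noteq> 0"
  using wronskian_nz by (simp add: W_def)

lemma cont_f: "continuous_on I f" and cont_g: "continuous_on I g"
  using deriv_f deriv_g by (auto intro: derivative_continuous_on)

lemma cont_W: "continuous_on I W"
  unfolding W_def[abs_def] by (intro continuous_intros cont_f cont_g cont_f1 cont_g1)

lemma wronskian_eq_W: "x \<in> I \<Longrightarrow> wronskian f g x = W x"
  using DERIV_imp_deriv[OF deriv_f] DERIV_imp_deriv[OF deriv_g] by (simp add: wronskian_def W_def)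

lemma deriv_u: "x \<in> I \<Longrightarrow> (u has_real_derivative W x / (g x * g x)) (at x)"
  unfolding u_def[abs_def] W_def
  by (rule derivative_eq_intros deriv_f deriv_g refl | assumption)+ (use g_pos in force)+

lemma u_derivative_nz: "x \<in> I \<Longrightarrow> W x / (g x * g x) \<noteq> 0"
  using W_nz g_pos by force

lemma cont_u_derivative: "continuous_on I (\<lambda>x. W x / (g x * g x))"
  using g_pos by (intro continuous_intros cont_W cont_g) force

lemma u_diffeo:
  shows "open (u ` I)" "is_interval (u ` I)" "inj_on u I"
    and "\<And>x. x \<in> I \<Longrightarrow>
      (the_inv_into I u has_real_derivative inverse (W x / (g x * g x))) (at (u x))"
  using inverse_of_nonzero_derivative[OF open_I interval_I deriv_u cont_u_derivative u_derivative_nz]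
  by blast+

lemma antiderivative_strictly_monotone:
  assumes "\<And>x. x \<in> I \<Longrightarrow> (w has_real_derivative W x) (at x)"
  shows "strictly_monotone_on I w"
  by (rule nonzero_derivative_imp_strictly_monotone[OF interval_I assms cont_W W_nz])

text \<open>
  The quotient is a weighted arithmetic mean of \<open>f x / g x\<close> and \<open>f y / g y\<close>, and the range is an interval.
\<close>
lemma mediant_in_range:
  assumes "x \<in> I" "y \<in> I"
  shows "(f x + f y) / (g x + g y) \<in> u ` I"
proof -
  have *: "(f x + f y) / (g x + g y) \<in> u ` I" if "x \<in> I" "y \<in> I" "u x \<le> u y" for x y
  proof -
    have p: "g x > 0" "g y > 0" using g_pos that by auto
    have fx: "f x = u x * g x" "f y = u y * g y"
      using p by (simp_all add: u_def)
    have "u x * (g x + g y) \<le> f x + f y" "f x + f y \<le> u y * (g x + g y)"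
      unfolding fx using p that(3) by (simp_all add: distrib_left)
    then have "u x \<le> (f x + f y) / (g x + g y)" "(f x + f y) / (g x + g y) \<le> u y"
      using p by (simp_all add: pos_le_divide_eq pos_divide_le_eq)
    with mem_is_interval_1_I[OF u_diffeo(2), of "u x" "u y"] that(1,2) show ?thesis
      by blast
  qed
  show ?thesis
    using *[of x y] *[of y x] assms by (cases "u x \<le> u y") (simp_all add: add.commute)
qed

lemma bajraktarevic_eq: "bajraktarevic I f g x y = the_inv_into I u ((f x + f y) / (g x + g y))"
  by (simp add: bajraktarevic_def u_def[abs_def])

lemma mean_in: "x \<in> I \<Longrightarrow> y \<in> I \<Longrightarrow> bajraktarevic I f g x y \<in> I"
  unfolding bajraktarevic_eq
  using the_inv_into_into[OF u_diffeo(3) mediant_in_range] by blast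

lemma u_mean: "x \<in> I \<Longrightarrow> y \<in> I \<Longrightarrow> u (bajraktarevic I f g x y) = (f x + f y) / (g x + g y)"
  unfolding bajraktarevic_eq
  using f_the_inv_into_f[OF u_diffeo(3) mediant_in_range] by blast

lemma mean_characterization:
  assumes "x \<in> I" "y \<in> I"
  shows "f (bajraktarevic I f g x y) * (g x + g y) = g (bajraktarevic I f g x y) * (f x + f y)"
proof -
  have "g x + g y > 0" "g (bajraktarevic I f g x y) > 0"
    using g_pos assms mean_in by (auto intro: add_pos_pos)
  with u_mean[OF assms] show ?thesis
    by (simp add: u_def field_simps)
qed

lemma mean_eqI:
  assumes "x \<in> I" "y \<in> I" "m \<in> I" and "f m * (g x + g y) = g m * (f x + f y)"
  shows "bajraktarevic I f g x y = m"
proof -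
  have "g x + g y > 0" "g m > 0"
    using g_pos assms(1-3) by (auto intro: add_pos_pos)
  with assms(4) have "(f x + f y) / (g x + g y) = u m"
    by (simp add: u_def field_simps)
  then show ?thesis
    unfolding bajraktarevic_eq by (simp add: the_inv_into_f_f[OF u_diffeo(3) assms(3)])
qed

lemma mean_of_trigonometric_pair:
  assumes w: "continuous_on I w" "strictly_monotone_on I w"
    and pe: "pair_equiv I (f, g) (S_fun \<alpha> \<circ> w, C_fun \<alpha> \<circ> w)"
    and x: "x \<in> I" and y: "y \<in> I"
  shows "bajraktarevic I f g x y = bajraktarevic I w (\<lambda>_. 1) x y"
proof -
  have "is_interval (w ` I)"
    using w(1) interval_I connected_continuous_image is_interval_connected_1 by blast
  moreover have "min (w x) (w y) \<in> w ` I" "max (w x) (w y) \<in> w ` I"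
    using x y by (auto simp: min_def max_def)
  ultimately have "(w x + w y) / 2 \<in> w ` I"
    by (rule mem_is_interval_1_I) (auto simp: min_def max_def)
  then obtain m where m: "m \<in> I" "w m = (w x + w y) / 2" by auto
  have "bajraktarevic I w (\<lambda>_. 1) x y = the_inv_into I w (w m)"
    by (simp add: bajraktarevic_def m(2))
  also have "\<dots> = m"
    by (rule the_inv_into_f_f[OF strictly_monotone_imp_inj_on[OF w(2)] m(1)])
  finally have qa: "bajraktarevic I w (\<lambda>_. 1) x y = m" .
  from pair_equiv_sym[OF pe] obtain a b c d where
    ab: "\<And>t. t \<in> I \<Longrightarrow> f t = a * S_fun \<alpha> (w t) + b * C_fun \<alpha> (w t)"
        "\<And>t. t \<in> I \<Longrightarrow> g t = c * S_fun \<alpha> (w t) + d * C_fun \<alpha> (w t)"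
    unfolding pair_equiv_def by auto
  define r where "r = (w x - w y) / 2"
  have wxy: "w x = w m + r" "w y = w m - r"
    by (simp_all add: m(2) r_def field_simps)
  have S: "S_fun \<alpha> (w x) + S_fun \<alpha> (w y) = 2 * C_fun \<alpha> r * S_fun \<alpha> (w m)"
   and C: "C_fun \<alpha> (w x) + C_fun \<alpha> (w y) = 2 * C_fun \<alpha> r * C_fun \<alpha> (w m)"
    unfolding wxy by (simp_all add: S_fun_sum_to_product C_fun_sum_to_product)
  have "f x + f y = a * (S_fun \<alpha> (w x) + S_fun \<alpha> (w y)) + b * (C_fun \<alpha> (w x) + C_fun \<alpha> (w y))"
    by (simp add: ab x y algebra_simps)
  also have "\<dots> = 2 * C_fun \<alpha> r * f m"
    unfolding S C by (simp add: ab m algebra_simps)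
  finally have f: "f x + f y = 2 * C_fun \<alpha> r * f m" .
  have "g x + g y = c * (S_fun \<alpha> (w x) + S_fun \<alpha> (w y)) + d * (C_fun \<alpha> (w x) + C_fun \<alpha> (w y))"
    by (simp add: ab x y algebra_simps)
  also have "\<dots> = 2 * C_fun \<alpha> r * g m"
    unfolding S C by (simp add: ab m algebra_simps)
  finally have g: "g x + g y = 2 * C_fun \<alpha> r * g m" .
  have "bajraktarevic I f g x y = m"
    by (rule mean_eqI[OF x y m(1)]) (simp add: f g)
  with qa show ?thesis by simp
qed

text \<open>
  The matrix of coefficients is invertible, since otherwise \<open>f\<close> and \<open>g\<close> would be proportional and the
  Wronskian would vanish.
\<close>
lemma linear_combinations_imp_pair_equiv:
  assumes f: "\<And>x. x \<in> I \<Longrightarrow> f x = a * p x + b * q x"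
    and g: "\<And>x. x \<in> I \<Longrightarrow> g x = c * p x + d * q x"
  shows "pair_equiv I (f, g) (p, q)"
proof -
  have "a * d - b * c \<noteq> 0"
  proof
    assume det: "a * d - b * c = 0"
    have pr: "d * f x = b * g x" "c * f x = a * g x" if "x \<in> I" for x
    proof -
      have "d * f x - b * g x = (a * d - b * c) * p x" "a * g x - c * f x = (a * d - b * c) * q x"
        by (simp_all add: f g that algebra_simps)
      then show "d * f x = b * g x" "c * f x = a * g x" by (simp_all add: det)
    qed
    obtain x0 where x0: "x0 \<in> I" using I_ne by blast
    have "c \<noteq> 0 \<or> d \<noteq> 0" using g[OF x0] g_pos[OF x0] by auto
    then have "\<exists>e. \<forall>x\<in>I. u x - e = 0"
    proof
      assume "c \<noteq> 0"
      then show ?thesis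
        using pr(2) g_pos by (intro exI[of _ "a / c"]) (force simp: u_def field_simps)
    next
      assume "d \<noteq> 0"
      then show ?thesis
        using pr(1) g_pos by (intro exI[of _ "b / d"]) (force simp: u_def field_simps)
    qed
    then obtain e where e: "\<And>x. x \<in> I \<Longrightarrow> u x - e = 0" by blast
    have "((\<lambda>x. u x - e) has_real_derivative W x0 / (g x0 * g x0)) (at x0)"
      using DERIV_diff[OF deriv_u[OF x0] DERIV_const] by simp
    from derivative_of_zero_function[OF open_I x0 e this] u_derivative_nz[OF x0]
    show False by blast
  qed
  then have "pair_equiv I (p, q) (f, g)"
    unfolding pair_equiv_def using f g by auto
  then show ?thesis by (rule pair_equiv_sym)
qed

text \<open>
  The common end of the proofs that start from the quadratic identity or from the Wronskian of the
  derivatives: \<open>\<phi>\<close> and \<open>\<psi>\<close> are the derivatives of \<open>f\<close> and \<open>g\<close> with respect to the variable \<open>w\<close>.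
\<close>
lemma first_order_system_imp_trigonometric:
  assumes w: "\<And>x. x \<in> I \<Longrightarrow> (w has_real_derivative V x) (at x)"
    and f: "\<And>x. x \<in> I \<Longrightarrow> f1 x = V x * \<phi> x" and g: "\<And>x. x \<in> I \<Longrightarrow> g1 x = V x * \<psi> x"
    and \<phi>: "\<And>x. x \<in> I \<Longrightarrow> (\<phi> has_real_derivative \<alpha> * V x * f x) (at x)"
    and \<psi>: "\<And>x. x \<in> I \<Longrightarrow> (\<psi> has_real_derivative \<alpha> * V x * g x) (at x)"
  shows "pair_equiv I (f, g) (S_fun \<alpha> \<circ> w, C_fun \<alpha> \<circ> w)"
proof -
  obtain a b where "\<forall>x\<in>I. f x = a * S_fun \<alpha> (w x) + b * C_fun \<alpha> (w x) \<and>
                       \<phi> x = a * C_fun \<alpha> (w x) + b * \<alpha> * S_fun \<alpha> (w x)"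
    using linear_system_solution[OF interval_I w _ \<phi>] deriv_f f by metis
  moreover obtain c d where "\<forall>x\<in>I. g x = c * S_fun \<alpha> (w x) + d * C_fun \<alpha> (w x) \<and>
                       \<psi> x = c * C_fun \<alpha> (w x) + d * \<alpha> * S_fun \<alpha> (w x)"
    using linear_system_solution[OF interval_I w _ \<psi>] deriv_g g by metis
  ultimately show ?thesis
    by (intro linear_combinations_imp_pair_equiv[of a _ b _ c d]) auto
qed

text \<open>
  Differentiating the quadratic identity gives a second linear equation for \<open>f'\<close> and \<open>g'\<close> besides
  \<open>f' g - f g' = W\<close>. The system has determinant \<open>-2\<close> by the identity itself, and its solution expresses
  \<open>f' / W\<close> and \<open>g' / W\<close> as linear combinations of \<open>f\<close> and \<open>g\<close>. Differentiating
  these combinations once more leads to \<open>y'' = (b\<^sup>2 - 4 a c) / 4 * y\<close> in the variable \<open>\<integral>W\<close>, although \<open>f\<close>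
  and \<open>g\<close> are only known to have first derivatives. The factor \<open>\<gamma>\<close> allows for the
  antiderivative of the other pair's Wronskian as variable.
\<close>
lemma quadratic_identity_imp_trigonometric:
  assumes q: "\<And>x. x \<in> I \<Longrightarrow> a * (f x)\<^sup>2 + b * f x * g x + c * (g x)\<^sup>2 = 1"
    and V: "\<And>x. x \<in> I \<Longrightarrow> W x = \<gamma> * V x"
    and w: "\<And>x. x \<in> I \<Longrightarrow> (w has_real_derivative V x) (at x)"
  shows "pair_equiv I (f, g) (S_fun (\<gamma>\<^sup>2 * (b\<^sup>2 - 4 * a * c) / 4) \<circ> w, C_fun (\<gamma>\<^sup>2 * (b\<^sup>2 - 4 * a * c) / 4) \<circ> w)"
proof -
  define \<phi> \<psi> where "\<phi> = (\<lambda>x. \<gamma> * (b * f x + 2 * c * g x) / 2)"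
    and "\<psi> = (\<lambda>x. - \<gamma> * (2 * a * f x + b * g x) / 2)"
  have d0: "2 * a * f x * f1 x + b * (f1 x * g x + f x * g1 x) + 2 * c * g x * g1 x = 0" if x: "x \<in> I" for x
  proof -
    have "((\<lambda>x. a * (f x)\<^sup>2 + b * f x * g x + c * (g x)\<^sup>2 - 1) has_real_derivative
        2 * a * f x * f1 x + b * (f1 x * g x + f x * g1 x) + 2 * c * g x * g1 x) (at x)"
      by (rule derivative_eq_intros deriv_f[OF x] deriv_g[OF x] refl)+ (simp add: algebra_simps)
    from derivative_of_zero_function[OF open_I x _ this] q show ?thesis by simp
  qed
  have f: "f1 x = V x * \<phi> x" if x: "x \<in> I" for x
  proof -
    have "V x * \<phi> x = W x * (b * f x + 2 * c * g x) / 2"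
      by (simp add: V[OF x] \<phi>_def)
    also have "\<dots> = f1 x * (a * (f x)\<^sup>2 + b * f x * g x + c * (g x)\<^sup>2) -
        f x / 2 * (2 * a * f x * f1 x + b * (f1 x * g x + f x * g1 x) + 2 * c * g x * g1 x)"
      by (simp add: W_def field_simps power2_eq_square)
    finally show ?thesis by (simp add: q[OF x] d0[OF x])
  qed
  have g: "g1 x = V x * \<psi> x" if x: "x \<in> I" for x
  proof -
    have "V x * \<psi> x = - W x * (2 * a * f x + b * g x) / 2"
      by (simp add: V[OF x] \<psi>_def)
    also have "\<dots> = g1 x * (a * (f x)\<^sup>2 + b * f x * g x + c * (g x)\<^sup>2) -
        g x / 2 * (2 * a * f x * f1 x + b * (f1 x * g x + f x * g1 x) + 2 * c * g x * g1 x)"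
      by (simp add: W_def field_simps power2_eq_square)
    finally show ?thesis by (simp add: q[OF x] d0[OF x])
  qed
  have \<phi>: "(\<phi> has_real_derivative \<gamma>\<^sup>2 * (b\<^sup>2 - 4 * a * c) / 4 * V x * f x) (at x)" if x: "x \<in> I" for x
  proof -
    have "(\<phi> has_real_derivative \<gamma> * (b * (V x * \<phi> x) + 2 * c * (V x * \<psi> x)) / 2) (at x)"
      unfolding \<phi>_def
      by (rule derivative_eq_intros deriv_f[OF x, unfolded f[OF x]] deriv_g[OF x, unfolded g[OF x]] refl)+
        (simp_all add: \<phi>_def \<psi>_def field_simps)
    also have "\<gamma> * (b * (V x * \<phi> x) + 2 * c * (V x * \<psi> x)) / 2 = \<gamma>\<^sup>2 * (b\<^sup>2 - 4 * a * c) / 4 * V x * f x"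
      by (simp add: \<phi>_def \<psi>_def field_simps power2_eq_square)
    finally show ?thesis .
  qed
  have \<psi>: "(\<psi> has_real_derivative \<gamma>\<^sup>2 * (b\<^sup>2 - 4 * a * c) / 4 * V x * g x) (at x)" if x: "x \<in> I" for x
  proof -
    have "(\<psi> has_real_derivative - \<gamma> * (2 * a * (V x * \<phi> x) + b * (V x * \<psi> x)) / 2) (at x)"
      unfolding \<psi>_def
      by (rule derivative_eq_intros deriv_f[OF x, unfolded f[OF x]] deriv_g[OF x, unfolded g[OF x]] refl)+
        (simp_all add: \<phi>_def \<psi>_def field_simps)
    also have "- \<gamma> * (2 * a * (V x * \<phi> x) + b * (V x * \<psi> x)) / 2 = \<gamma>\<^sup>2 * (b\<^sup>2 - 4 * a * c) / 4 * V x * g x"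
      by (simp add: \<phi>_def \<psi>_def field_simps power2_eq_square)
    finally show ?thesis .
  qed
  show ?thesis
    by (rule first_order_system_imp_trigonometric[OF w f g \<phi> \<psi>])
qed

lemma trigonometric_imp_quadratic_identity:
  assumes "pair_equiv I (f, g) (S_fun \<alpha> \<circ> w, C_fun \<alpha> \<circ> w)"
  shows "\<exists>a b c. \<forall>x\<in>I. a * (f x)\<^sup>2 + b * f x * g x + c * (g x)\<^sup>2 = 1"
proof -
  from assms obtain a b c d where
    ab: "\<And>x. x \<in> I \<Longrightarrow> S_fun \<alpha> (w x) = a * f x + b * g x"
        "\<And>x. x \<in> I \<Longrightarrow> C_fun \<alpha> (w x) = c * f x + d * g x"
    unfolding pair_equiv_def by auto
  have "(c\<^sup>2 - \<alpha> * a\<^sup>2) * (f x)\<^sup>2 + 2 * (c * d - \<alpha> * a * b) * f x * g x + (d\<^sup>2 - \<alpha> * b\<^sup>2) * (g x)\<^sup>2 = 1"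
    if "x \<in> I" for x
    using C_fun_sq_minus_S_fun_sq[of \<alpha> "w x"] unfolding ab[OF that]
    by (simp add: algebra_simps power2_eq_square)
  then show ?thesis by blast
qed

text \<open>
  The quadratic form in \<open>f\<close> and \<open>g\<close> is \<open>g\<^sup>2\<close> times a polynomial in \<open>u = f / g\<close>.
\<close>
lemma quadratic_identity_iff_poly:
  "(\<forall>x\<in>I. a * (f x)\<^sup>2 + b * f x * g x + c * (g x)\<^sup>2 = 1) \<longleftrightarrow>
   (\<forall>x\<in>I. poly [:c, b, a:] (u x) > 0 \<and> g x = 1 / sqrt (poly [:c, b, a:] (u x)))"
proof (rule ball_cong[OF refl])
  fix x assume x: "x \<in> I"
  define P where "P = poly [:c, b, a:] (u x)"
  have gp: "g x > 0" using g_pos[OF x] .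
  have "a * (f x)\<^sup>2 + b * f x * g x + c * (g x)\<^sup>2 = (g x)\<^sup>2 * P"
    using gp by (simp add: P_def u_def field_simps power2_eq_square)
  moreover have "(g x)\<^sup>2 * P = 1 \<longleftrightarrow> P > 0 \<and> g x = 1 / sqrt P"
  proof
    assume e: "(g x)\<^sup>2 * P = 1"
    then have P: "P = 1 / (g x)\<^sup>2" using gp by (simp add: field_simps)
    then show "P > 0 \<and> g x = 1 / sqrt P"
      using gp by (simp add: real_sqrt_divide)
  next
    assume P: "P > 0 \<and> g x = 1 / sqrt P"
    then show "(g x)\<^sup>2 * P = 1"
      by (simp add: power_divide)
  qed
  ultimately show "(a * (f x)\<^sup>2 + b * f x * g x + c * (g x)\<^sup>2 = 1) =
      (poly [:c, b, a:] (u x) > 0 \<and> g x = 1 / sqrt (poly [:c, b, a:] (u x)))"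
    by (simp only: P_def)
qed

text \<open>
  Since \<open>u' = W / g\<^sup>2\<close>, the derivative of \<open>w \<circ> u\<^sup>-\<^sup>1\<close> is \<open>g\<^sup>2 = 1 / P\<close>: the antiderivative of \<open>1 / P\<close>, read
  along \<open>u\<close>, is the antiderivative of the Wronskian.
\<close>
lemma antiderivative_on_range:
  assumes P: "\<And>x. x \<in> I \<Longrightarrow> (g x)\<^sup>2 * poly P (u x) = 1"
    and w: "\<And>x. x \<in> I \<Longrightarrow> (w has_real_derivative W x) (at x)"
  shows "antiderivative_on (u ` I) (\<lambda>t. 1 / poly P t) (\<lambda>t. w (the_inv_into I u t))"
  unfolding antiderivative_on_def
proof
  fix t assume "t \<in> u ` I"
  then obtain x where x: "x \<in> I" "t = u x" by blast
  have inv: "the_inv_into I u (u x) = x"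
    by (rule the_inv_into_f_f[OF u_diffeo(3) x(1)])
  have "((\<lambda>t. w (the_inv_into I u t)) has_real_derivative
      W x * inverse (W x / (g x * g x))) (at (u x))"
    by (rule DERIV_chain2[OF _ u_diffeo(4)[OF x(1)]]) (simp add: inv w x(1))
  moreover have "poly P (u x) = 1 / (g x * g x)"
    using P[OF x(1)] g_pos[OF x(1)] by (simp add: field_simps power2_eq_square)
  then have "W x * inverse (W x / (g x * g x)) = 1 / poly P (u x)"
    using W_nz[OF x(1)] g_pos[OF x(1)] by simp
  ultimately show "((\<lambda>t. w (the_inv_into I u t)) has_real_derivative 1 / poly P t) (at t within u ` I)"
    using x(2) has_field_derivative_at_within by metis
qed

text \<open>
  By the chain rule \<open>f'' = V' \<phi> + \<alpha> V\<^sup>2 f\<close>, where \<open>f' = V \<phi>\<close>, and likewise for \<open>g\<close>. In the Wronskian of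
  the derivatives the terms with \<open>V'\<close> cancel.
\<close>
lemma wronskian_of_derivatives_trigonometric:
  assumes pe: "pair_equiv I (f, g) (S_fun \<alpha> \<circ> w, C_fun \<alpha> \<circ> w)"
    and w: "\<And>x. x \<in> I \<Longrightarrow> (w has_real_derivative V x) (at x)"
    and x: "x \<in> I" and V: "(V has_real_derivative V1) (at x)"
    and f2: "(f1 has_real_derivative f2) (at x)" and g2: "(g1 has_real_derivative g2) (at x)"
  shows "f2 * g1 x - f1 x * g2 = - \<alpha> * (V x)\<^sup>2 * W x"
proof -
  from pair_equiv_sym[OF pe] obtain a b c d where
    ab: "\<And>t. t \<in> I \<Longrightarrow> f t = a * S_fun \<alpha> (w t) + b * C_fun \<alpha> (w t)"
        "\<And>t. t \<in> I \<Longrightarrow> g t = c * S_fun \<alpha> (w t) + d * C_fun \<alpha> (w t)"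
    unfolding pair_equiv_def by auto
  have first: "r1 t = V t * (a * C_fun \<alpha> (w t) + b * \<alpha> * S_fun \<alpha> (w t))"
    if r: "\<And>t. t \<in> I \<Longrightarrow> r t = a * S_fun \<alpha> (w t) + b * C_fun \<alpha> (w t)"
      and r1: "\<And>t. t \<in> I \<Longrightarrow> (r has_real_derivative r1 t) (at t)" and t: "t \<in> I" for r r1 a b t
  proof (rule derivatives_of_equal_functions[OF open_I r r1 _ t])
    show "((\<lambda>t. a * S_fun \<alpha> (w t) + b * C_fun \<alpha> (w t)) has_real_derivative
        V t * (a * C_fun \<alpha> (w t) + b * \<alpha> * S_fun \<alpha> (w t))) (at t)" if "t \<in> I" for t
      by (rule derivative_eq_intros w[OF that] refl)+ (simp add: algebra_simps)
  qed
  have second: "r2 = V1 * (a * C_fun \<alpha> (w x) + b * \<alpha> * S_fun \<alpha> (w x)) + \<alpha> * (V x)\<^sup>2 * r x"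
    if r: "\<And>t. t \<in> I \<Longrightarrow> r t = a * S_fun \<alpha> (w t) + b * C_fun \<alpha> (w t)"
      and r1: "\<And>t. t \<in> I \<Longrightarrow> r1 t = V t * (a * C_fun \<alpha> (w t) + b * \<alpha> * S_fun \<alpha> (w t))"
      and r2: "(r1 has_real_derivative r2) (at x)" for r r1 r2 a b
  proof -
    have "((\<lambda>t. V t * (a * C_fun \<alpha> (w t) + b * \<alpha> * S_fun \<alpha> (w t))) has_real_derivative
        V1 * (a * C_fun \<alpha> (w x) + b * \<alpha> * S_fun \<alpha> (w x)) + \<alpha> * (V x)\<^sup>2 * r x) (at x)"
      by (rule derivative_eq_intros V w[OF x] refl)+
        (simp add: r[OF x] algebra_simps power2_eq_square)
    then have "(r1 has_real_derivative
        V1 * (a * C_fun \<alpha> (w x) + b * \<alpha> * S_fun \<alpha> (w x)) + \<alpha> * (V x)\<^sup>2 * r x) (at x)"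
      by (rule has_field_derivative_transform_within_open[OF _ open_I x]) (simp add: r1)
    with r2 show ?thesis by (rule DERIV_unique)
  qed
  have ff: "f1 t = V t * (a * C_fun \<alpha> (w t) + b * \<alpha> * S_fun \<alpha> (w t))" if "t \<in> I" for t
    using first[OF ab(1) deriv_f] that by blast
  have gg: "g1 t = V t * (c * C_fun \<alpha> (w t) + d * \<alpha> * S_fun \<alpha> (w t))" if "t \<in> I" for t
    using first[OF ab(2) deriv_g] that by blast
  have e2: "f2 = V1 * (a * C_fun \<alpha> (w x) + b * \<alpha> * S_fun \<alpha> (w x)) + \<alpha> * (V x)\<^sup>2 * f x"
           "g2 = V1 * (c * C_fun \<alpha> (w x) + d * \<alpha> * S_fun \<alpha> (w x)) + \<alpha> * (V x)\<^sup>2 * g x"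
    by (rule second[OF ab(1) ff f2] second[OF ab(2) gg g2]; assumption)+
  show ?thesis
    unfolding e2 W_def unfolding ff[OF x] gg[OF x] by (simp add: algebra_simps power2_eq_square)
qed

text \<open>
  With \<open>W' = f'' g - f g''\<close> the numerator of \<open>(f' / W)'\<close> is \<open>- f\<close> times the Wronskian of the
  derivatives, which explains why the third power of \<open>W\<close> occurs in the condition.
\<close>
lemma curvature_condition_imp_trigonometric:
  assumes f2: "\<And>x. x \<in> I \<Longrightarrow> (f1 has_real_derivative f2 x) (at x)"
    and g2: "\<And>x. x \<in> I \<Longrightarrow> (g1 has_real_derivative g2 x) (at x)"
    and cond: "\<And>x. x \<in> I \<Longrightarrow> f2 x * g1 x - f1 x * g2 x = \<alpha> * (W x) ^ 3"
    and V: "\<And>x. x \<in> I \<Longrightarrow> W x = \<gamma> * V x"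
    and w: "\<And>x. x \<in> I \<Longrightarrow> (w has_real_derivative V x) (at x)"
  shows "pair_equiv I (f, g) (S_fun (- \<alpha> * \<gamma>\<^sup>2) \<circ> w, C_fun (- \<alpha> * \<gamma>\<^sup>2) \<circ> w)"
proof (rule first_order_system_imp_trigonometric[OF w])
  fix x assume x: "x \<in> I"
  have dW: "(W has_real_derivative f2 x * g x - f x * g2 x) (at x)"
    unfolding W_def[abs_def]
    by (rule derivative_eq_intros deriv_f[OF x] deriv_g[OF x] f2[OF x] g2[OF x] refl)+
      (simp add: algebra_simps)
  have nz: "\<gamma> * V x \<noteq> 0" using W_nz[OF x] V[OF x] by simp
  then show "f1 x = V x * (\<gamma> * (f1 x / W x))" "g1 x = V x * (\<gamma> * (g1 x / W x))"
    unfolding V[OF x] by simp_all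
  have num: "f2 x * W x - f1 x * (f2 x * g x - f x * g2 x) = - f x * (\<alpha> * (W x) ^ 3)"
            "g2 x * W x - g1 x * (f2 x * g x - f x * g2 x) = - g x * (\<alpha> * (W x) ^ 3)"
    unfolding cond[OF x, symmetric] unfolding W_def by (simp_all add: algebra_simps)
  have val: "\<gamma> * ((- r * (\<alpha> * (W x) ^ 3)) / (W x * W x)) = - \<alpha> * \<gamma>\<^sup>2 * V x * r" for r
    using nz unfolding V[OF x] by (simp add: field_simps power2_eq_square power3_eq_cube)
  show "((\<lambda>x. \<gamma> * (f1 x / W x)) has_real_derivative - \<alpha> * \<gamma>\<^sup>2 * V x * f x) (at x)"
    unfolding val[symmetric] num[symmetric]
    by (intro DERIV_cmult DERIV_divide f2[OF x] dW W_nz[OF x])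
  show "((\<lambda>x. \<gamma> * (g1 x / W x)) has_real_derivative - \<alpha> * \<gamma>\<^sup>2 * V x * g x) (at x)"
    unfolding val[symmetric] num[symmetric]
    by (intro DERIV_cmult DERIV_divide g2[OF x] dW W_nz[OF x])
qed

end

section \<open>Equal means\<close>

locale two_bajraktarevic_pairs =
  fg: bajraktarevic_pair I f f1 g g1 + hk: bajraktarevic_pair I h h1 k k1 for I f f1 g g1 h h1 k k1
begin

lemma pair_equiv_imp_means_equal:
  assumes "pair_equiv I (f, g) (h, k)" and x: "x \<in> I" and y: "y \<in> I"
  shows "bajraktarevic I f g x y = bajraktarevic I h k x y"
proof -
  let ?m = "bajraktarevic I f g x y"
  have m: "?m \<in> I" by (rule fg.mean_in[OF x y])
  from assms(1) obtain a b c d where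
    eq: "\<And>x. x \<in> I \<Longrightarrow> h x = a * f x + b * g x" "\<And>x. x \<in> I \<Longrightarrow> k x = c * f x + d * g x"
    unfolding pair_equiv_def by auto
  have "h ?m * (k x + k y) - k ?m * (h x + h y) =
      (a * d - b * c) * (f ?m * (g x + g y) - g ?m * (f x + f y))"
    by (simp add: eq x y m algebra_simps)
  then have "h ?m * (k x + k y) = k ?m * (h x + h y)"
    using fg.mean_characterization[OF x y] by simp
  then show ?thesis
    using hk.mean_eqI[OF x y m] by simp
qed

lemma trigonometric_imp_means_equal:
  assumes w: "continuous_on I w" "strictly_monotone_on I w"
    and "pair_equiv I (f, g) (S_fun \<alpha> \<circ> w, C_fun \<alpha> \<circ> w)"
    and "pair_equiv I (h, k) (S_fun \<beta> \<circ> w, C_fun \<beta> \<circ> w)"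
    and "x \<in> I" "y \<in> I"
  shows "bajraktarevic I f g x y = bajraktarevic I w (\<lambda>_. 1) x y"
    and "bajraktarevic I w (\<lambda>_. 1) x y = bajraktarevic I h k x y"
  using fg.mean_of_trigonometric_pair[OF w assms(3,5,6)]
    hk.mean_of_trigonometric_pair[OF w assms(4,5,6)] by simp_all

lemma quadratic_identities_imp_trigonometric:
  assumes "\<forall>x\<in>I. a * (f x)\<^sup>2 + b * f x * g x + c * (g x)\<^sup>2 = 1"
    and "\<forall>x\<in>I. A * (h x)\<^sup>2 + B * h x * k x + C * (k x)\<^sup>2 = 1"
    and "\<forall>x\<in>I. hk.W x = \<gamma> * fg.W x"
  shows "\<exists>w \<alpha> \<beta>. continuous_on I w \<and> strictly_monotone_on I w \<and>
    pair_equiv I (f, g) (S_fun \<alpha> \<circ> w, C_fun \<alpha> \<circ> w) \<and>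
    pair_equiv I (h, k) (S_fun \<beta> \<circ> w, C_fun \<beta> \<circ> w)"
proof -
  obtain w where w: "\<And>x. x \<in> I \<Longrightarrow> (w has_real_derivative fg.W x) (at x)"
    using interval_has_antiderivative[OF fg.open_I fg.interval_I fg.I_ne fg.cont_W] by blast
  have "pair_equiv I (f, g) (S_fun (1\<^sup>2 * (b\<^sup>2 - 4 * a * c) / 4) \<circ> w, C_fun (1\<^sup>2 * (b\<^sup>2 - 4 * a * c) / 4) \<circ> w)"
    by (rule fg.quadratic_identity_imp_trigonometric[OF _ _ w]) (use assms in auto)
  moreover have "pair_equiv I (h, k)
      (S_fun (\<gamma>\<^sup>2 * (B\<^sup>2 - 4 * A * C) / 4) \<circ> w, C_fun (\<gamma>\<^sup>2 * (B\<^sup>2 - 4 * A * C) / 4) \<circ> w)"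
    by (rule hk.quadratic_identity_imp_trigonometric[OF _ _ w]) (use assms in auto)
  ultimately show ?thesis
    using derivative_continuous_on[OF w] fg.antiderivative_strictly_monotone[OF w] by blast
qed

text \<open>
  The numerators of the partial derivatives with respect to \<open>x\<close> of \<open>(f x + f y) / (g x + g y)\<close> and of
  \<open>(h x + h y) / (k x + k y)\<close>.
\<close>
definition N_fg where "N_fg x y = f1 x * (g x + g y) - g1 x * (f x + f y)"
definition N_hk where "N_hk x y = h1 x * (k x + k y) - k1 x * (h x + h y)"

text \<open>
  Equality of the means says that the quotient formed with \<open>h\<close> and \<open>k\<close> is a fixed differentiable function
  \<open>\<psi>\<close> of the quotient formed with \<open>f\<close> and \<open>g\<close>. Both partial derivatives at \<open>(x, y)\<close> therefore contain
  the same factor \<open>\<psi>'\<close>, and cross-multiplication removes it.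
\<close>
lemma means_equal_imp_partial_derivatives_proportional:
  assumes eq: "\<And>x y. x \<in> I \<Longrightarrow> y \<in> I \<Longrightarrow> bajraktarevic I f g x y = bajraktarevic I h k x y"
    and x: "x \<in> I" and y: "y \<in> I"
  shows "N_fg x y * N_hk y x = N_hk x y * N_fg y x"
proof -
  define U V where "U = (\<lambda>x y. (f x + f y) / (g x + g y))" and "V = (\<lambda>x y. (h x + h y) / (k x + k y))"
  define \<psi> where "\<psi> = (\<lambda>t. hk.u (the_inv_into I fg.u t))"
  have V_eq: "V x y = \<psi> (U x y)" if "x \<in> I" "y \<in> I" for x y
    using hk.u_mean[OF that] eq[OF that] by (simp add: \<psi>_def U_def V_def fg.bajraktarevic_eq)
  define m where "m = bajraktarevic I f g x y"
  have m: "m \<in> I" "fg.u m = U x y"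
    using fg.mean_in[OF x y] fg.u_mean[OF x y] by (simp_all add: m_def U_def)
  have inv: "the_inv_into I fg.u (fg.u m) = m"
    by (rule the_inv_into_f_f[OF fg.u_diffeo(3) m(1)])
  obtain D where D: "(\<psi> has_real_derivative D) (at (U x y))"
  proof
    show "(\<psi> has_real_derivative hk.W m / (k m * k m) * inverse (fg.W m / (g m * g m))) (at (U x y))"
      unfolding \<psi>_def m(2)[symmetric]
      by (rule DERIV_chain2[OF _ fg.u_diffeo(4)[OF m(1)]]) (simp add: inv hk.deriv_u m(1))
  qed
  have dU: "((\<lambda>t. U t y) has_real_derivative N_fg x y / (g x + g y)\<^sup>2) (at x)"
    if x: "x \<in> I" and y: "y \<in> I" for x y
  proof -
    have "g x + g y \<noteq> 0"
      using fg.g_pos[OF x] fg.g_pos[OF y] by simp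
    then show ?thesis
      unfolding U_def N_fg_def
      by (auto intro!: derivative_eq_intros fg.deriv_f fg.deriv_g x simp: power2_eq_square algebra_simps)
  qed
  have dV: "((\<lambda>t. V t y) has_real_derivative N_hk x y / (k x + k y)\<^sup>2) (at x)"
    if x: "x \<in> I" and y: "y \<in> I" for x y
  proof -
    have "k x + k y \<noteq> 0"
      using hk.g_pos[OF x] hk.g_pos[OF y] by simp
    then show ?thesis
      unfolding V_def N_hk_def
      by (auto intro!: derivative_eq_intros hk.deriv_f hk.deriv_g x simp: power2_eq_square algebra_simps)
  qed
  have partial: "N_hk x y / (k x + k y)\<^sup>2 = D * (N_fg x y / (g x + g y)\<^sup>2)"
    if x: "x \<in> I" and y: "y \<in> I" and D: "(\<psi> has_real_derivative D) (at (U x y))" for x y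
  proof (rule DERIV_unique[OF dV[OF x y]])
    show "((\<lambda>t. V t y) has_real_derivative D * (N_fg x y / (g x + g y)\<^sup>2)) (at x)"
      by (rule has_field_derivative_transform_within_open[OF DERIV_chain2[OF D dU[OF x y]] fg.open_I x])
        (simp add: V_eq y)
  qed
  have sym: "U y x = U x y" "g y + g x = g x + g y" "k y + k x = k x + k y"
    by (simp_all add: U_def add.commute)
  define G K where "G = (g x + g y)\<^sup>2" and "K = (k x + k y)\<^sup>2"
  have GK: "G \<noteq> 0" "K \<noteq> 0"
    using fg.g_pos[OF x] fg.g_pos[OF y] hk.g_pos[OF x] hk.g_pos[OF y] by (simp_all add: G_def K_def)
  have 1: "N_hk x y = D * N_fg x y * K / G"
    using partial[OF x y D] GK unfolding G_def[symmetric] K_def[symmetric] by (simp add: field_simps)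
  have 2: "N_hk y x = D * N_fg y x * K / G"
    using partial[OF y x D[folded sym(1)]] GK unfolding sym G_def[symmetric] K_def[symmetric]
    by (simp add: field_simps)
  show ?thesis unfolding 1 2 by simp
qed

text \<open>
  As \<open>y\<close> tends to \<open>x\<close>, \<open>N_fg x y = 2 W x + o(y - x)\<close> and \<open>N_fg y x = 2 W y + o(y - x)\<close>, because the linear
  terms have the coefficient \<open>f' g' - g' f' = 0\<close> at \<open>x\<close>; likewise for \<open>N_hk\<close>. The proportionality of the
  partial derivatives thus becomes \<open>W\<^sub>f\<^sub>g x * W\<^sub>h\<^sub>k y - W\<^sub>h\<^sub>k x * W\<^sub>f\<^sub>g y = o(y - x)\<close>. In this way the quotient
  of the Wronskians turns out to be differentiable, although each of them is merely continuous.
\<close>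
lemma means_equal_imp_wronskians_proportional:
  assumes eq: "\<And>x y. x \<in> I \<Longrightarrow> y \<in> I \<Longrightarrow> bajraktarevic I f g x y = bajraktarevic I h k x y"
  shows "\<exists>\<gamma>. \<gamma> \<noteq> 0 \<and> (\<forall>x\<in>I. hk.W x = \<gamma> * fg.W x)"
proof -
  have "((\<lambda>x. hk.W x / fg.W x) has_real_derivative 0) (at x)" if x: "x \<in> I" for x
  proof -
    have cts: "(\<phi> \<longlongrightarrow> \<phi> x) (at x)" if "continuous_on I \<phi>" for \<phi> :: "real \<Rightarrow> real"
      using that continuous_on_eq_continuous_at[OF fg.open_I] x by (auto simp: isCont_def)
    note lim = cts[OF fg.cont_f1] cts[OF fg.cont_g1] cts[OF hk.cont_f1] cts[OF hk.cont_g1]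
      cts[OF fg.cont_f] cts[OF fg.cont_g] cts[OF hk.cont_f] cts[OF hk.cont_g]
      cts[OF fg.cont_W] cts[OF hk.cont_W]
    define q where "q = (\<lambda>\<phi> y. (\<phi> y - \<phi> x) / (y - x) :: real)"
    have q: "(q f \<longlongrightarrow> f1 x) (at x)" "(q g \<longlongrightarrow> g1 x) (at x)"
        "(q h \<longlongrightarrow> h1 x) (at x)" "(q k \<longlongrightarrow> k1 x) (at x)"
      unfolding q_def using fg.deriv_f[OF x] fg.deriv_g[OF x] hk.deriv_f[OF x] hk.deriv_g[OF x]
      by (simp_all add: has_field_derivative_iff)
    \<comment> \<open>The remainders of \<open>N_fg x y\<close>, \<open>N_fg y x\<close>, \<open>N_hk x y\<close>, \<open>N_hk y x\<close> after the leading terms \<open>2 W\<close>,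
      divided by \<open>y - x\<close>.\<close>
    define a a' b b' where
      "a = (\<lambda>y. f1 x * q g y - g1 x * q f y)" and "a' = (\<lambda>y. g1 y * q f y - f1 y * q g y)" and
      "b = (\<lambda>y. h1 x * q k y - k1 x * q h y)" and "b' = (\<lambda>y. k1 y * q h y - h1 y * q k y)"
    have r: "(a \<longlongrightarrow> f1 x * g1 x - g1 x * f1 x) (at x)" "(a' \<longlongrightarrow> g1 x * f1 x - f1 x * g1 x) (at x)"
        "(b \<longlongrightarrow> h1 x * k1 x - k1 x * h1 x) (at x)" "(b' \<longlongrightarrow> k1 x * h1 x - h1 x * k1 x) (at x)"
      unfolding a_def a'_def b_def b'_def by (intro tendsto_intros q lim)+
    \<comment> \<open>This combination is \<open>4 (W\<^sub>h\<^sub>k y * W\<^sub>f\<^sub>g x - W\<^sub>h\<^sub>k x * W\<^sub>f\<^sub>g y) / (y - x)\<close> by the proportionality of the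
      partial derivatives. Every term of it contains a remainder, hence its limit is zero.\<close>
    have "((\<lambda>y. a' y * (2 * hk.W x + (y - x) * b y) + 2 * fg.W y * b y
             - a y * (2 * hk.W y + (y - x) * b' y) - 2 * fg.W x * b' y) \<longlongrightarrow>
          (g1 x * f1 x - f1 x * g1 x) * (2 * hk.W x + (x - x) * (h1 x * k1 x - k1 x * h1 x))
          + 2 * fg.W x * (h1 x * k1 x - k1 x * h1 x)
          - (f1 x * g1 x - g1 x * f1 x) * (2 * hk.W x + (x - x) * (k1 x * h1 x - h1 x * k1 x))
          - 2 * fg.W x * (k1 x * h1 x - h1 x * k1 x)) (at x)"
      by (intro tendsto_intros r lim)
    then have "((\<lambda>y. a' y * (2 * hk.W x + (y - x) * b y) + 2 * fg.W y * b y
             - a y * (2 * hk.W y + (y - x) * b' y) - 2 * fg.W x * b' y) \<longlongrightarrow> 0) (at x)"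
      by (simp add: mult.commute)
    from tendsto_divide[OF this tendsto_mult[OF tendsto_const[of "4 * fg.W x"] lim(9)]]
    have "((\<lambda>y. (a' y * (2 * hk.W x + (y - x) * b y) + 2 * fg.W y * b y
             - a y * (2 * hk.W y + (y - x) * b' y) - 2 * fg.W x * b' y) / (4 * fg.W x * fg.W y)) \<longlongrightarrow> 0) (at x)"
      using fg.W_nz[OF x] by simp
    moreover have "\<forall>\<^sub>F y in at x. y \<in> I \<and> y \<noteq> x"
      using eventually_at_in_open'[OF fg.open_I x] eventually_neq_at_within[of x x UNIV]
      by eventually_elim simp
    then have "\<forall>\<^sub>F y in at x. (a' y * (2 * hk.W x + (y - x) * b y) + 2 * fg.W y * b y
             - a y * (2 * hk.W y + (y - x) * b' y) - 2 * fg.W x * b' y) / (4 * fg.W x * fg.W y) =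
          (hk.W y / fg.W y - hk.W x / fg.W x) / (y - x)"
    proof eventually_elim
      case (elim y)
      define s where "s = y - x"
      have s: "s \<noteq> 0" using elim by (simp add: s_def)
      have qs: "f y = f x + s * q f y" "g y = g x + s * q g y" "h y = h x + s * q h y" "k y = k x + s * q k y"
        using s by (simp_all add: q_def s_def)
      have n: "N_fg x y = 2 * fg.W x + s * a y" "N_hk x y = 2 * hk.W x + s * b y"
        unfolding N_fg_def N_hk_def fg.W_def hk.W_def a_def b_def qs by (simp_all add: algebra_simps)
      have "N_fg y x = f1 y * (g y + (g y - s * q g y)) - g1 y * (f y + (f y - s * q f y))"
        unfolding N_fg_def using qs(1,2) by simp
      then have n1: "N_fg y x = 2 * fg.W y + s * a' y"
        unfolding fg.W_def a'_def by (simp add: algebra_simps)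
      have "N_hk y x = h1 y * (k y + (k y - s * q k y)) - k1 y * (h y + (h y - s * q h y))"
        unfolding N_hk_def using qs(3,4) by simp
      then have n2: "N_hk y x = 2 * hk.W y + s * b' y"
        unfolding hk.W_def b'_def by (simp add: algebra_simps)
      have "(2 * fg.W x + s * a y) * (2 * hk.W y + s * b' y) = (2 * hk.W x + s * b y) * (2 * fg.W y + s * a' y)"
        using means_equal_imp_partial_derivatives_proportional[OF eq x, of y] elim
        unfolding n n1 n2 by simp
      then have "4 * (hk.W y * fg.W x - hk.W x * fg.W y) =
          s * (a' y * (2 * hk.W x + s * b y) + 2 * fg.W y * b y - a y * (2 * hk.W y + s * b' y) - 2 * fg.W x * b' y)"
        by (simp add: algebra_simps)
      then have "a' y * (2 * hk.W x + s * b y) + 2 * fg.W y * b y - a y * (2 * hk.W y + s * b' y) - 2 * fg.W x * b' y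
          = 4 * (hk.W y * fg.W x - hk.W x * fg.W y) / s"
        using s by (simp add: eq_divide_eq mult.commute)
      moreover have "4 * (hk.W y * fg.W x - hk.W x * fg.W y) / s / (4 * fg.W x * fg.W y) =
          (hk.W y / fg.W y - hk.W x / fg.W x) / s"
        using s fg.W_nz[OF x] fg.W_nz[of y] elim by (simp add: field_simps)
      ultimately show ?case by (simp add: s_def)
    qed
    ultimately have "((\<lambda>y. (hk.W y / fg.W y - hk.W x / fg.W x) / (y - x)) \<longlongrightarrow> 0) (at x)"
      by (rule Lim_transform_eventually)
    then show ?thesis by (simp add: has_field_derivative_iff)
  qed
  from zero_derivative_imp_constant[OF fg.interval_I this]
  obtain \<gamma> where \<gamma>: "\<And>x. x \<in> I \<Longrightarrow> hk.W x / fg.W x = \<gamma>" by blast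
  have pr: "hk.W x = \<gamma> * fg.W x" if "x \<in> I" for x
    using fg.W_nz[OF that] \<gamma>[OF that] by (simp add: divide_eq_eq)
  obtain x0 where "x0 \<in> I" using fg.I_ne by blast
  with pr[of x0] hk.W_nz[of x0] have "\<gamma> \<noteq> 0" by auto
  with pr show ?thesis by blast
qed

text \<open>
  The reduction to Wronskian one: all functions are composed with the inverse \<open>s\<close> of an antiderivative
  \<open>w\<close> of the Wronskian of \<open>(f, g)\<close>, and \<open>h\<close> is divided by the constant \<open>\<gamma>\<close>, which does not change the
  mean of the second pair.
\<close>
theorem means_equal_imp_equivalent_or_trigonometric:
  assumes eq: "\<And>x y. x \<in> I \<Longrightarrow> y \<in> I \<Longrightarrow> bajraktarevic I f g x y = bajraktarevic I h k x y"
  shows "pair_equiv I (f, g) (h, k) \<or>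
    (\<exists>w \<gamma> \<alpha> \<beta>. (\<forall>x\<in>I. (w has_real_derivative fg.W x) (at x)) \<and>
       (\<forall>x\<in>I. hk.W x = \<gamma> * fg.W x) \<and>
       pair_equiv I (f, g) (S_fun \<alpha> \<circ> w, C_fun \<alpha> \<circ> w) \<and>
       pair_equiv I (h, k) (S_fun \<beta> \<circ> w, C_fun \<beta> \<circ> w))"
proof -
  obtain \<gamma> where \<gamma>: "\<gamma> \<noteq> 0" "\<And>x. x \<in> I \<Longrightarrow> hk.W x = \<gamma> * fg.W x"
    using means_equal_imp_wronskians_proportional[OF eq] by blast
  obtain w where w: "\<And>x. x \<in> I \<Longrightarrow> (w has_real_derivative fg.W x) (at x)"
    using interval_has_antiderivative[OF fg.open_I fg.interval_I fg.I_ne fg.cont_W] by blast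
  define J s where "J = w ` I" and "s = the_inv_into I w"
  have w_diffeo: "open (w ` I)" "is_interval (w ` I)" "inj_on w I"
      "\<And>x. x \<in> I \<Longrightarrow> (the_inv_into I w has_real_derivative inverse (fg.W x)) (at (w x))"
    using inverse_of_nonzero_derivative[OF fg.open_I fg.interval_I w fg.cont_W fg.W_nz] by blast+
  have sw: "s (w x) = x" if "x \<in> I" for x
    unfolding s_def by (rule the_inv_into_f_f[OF w_diffeo(3) that])
  have ds: "(s has_real_derivative inverse (fg.W (s t))) (at t)" and sI: "s t \<in> I" if "t \<in> J" for t
    using that w_diffeo(4) sw unfolding s_def[symmetric] J_def by auto
  have cs: "continuous_on J s"
    using ds by (rule derivative_continuous_on)
  have cont: "continuous_on J (\<lambda>t. \<phi> (s t))" if "continuous_on I \<phi>" for \<phi> :: "real \<Rightarrow> real"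
    using continuous_on_compose2[OF that cs] sI by blast
  have chain: "((\<lambda>t. \<phi> (s t)) has_real_derivative \<phi>1 (s t) / fg.W (s t)) (at t)"
    if "\<And>x. x \<in> I \<Longrightarrow> (\<phi> has_real_derivative \<phi>1 x) (at x)" "t \<in> J" for \<phi> \<phi>1 :: "real \<Rightarrow> real" and t
    unfolding divide_inverse by (rule DERIV_chain2[OF that(1)[OF sI[OF that(2)]] ds[OF that(2)]])
  have combine: "p / V * q' - p' * (q / V) = (p * q' - p' * q) / V"
      "p / V / c * q' - p' / c * (q / V) = (p * q' - p' * q) / (c * V)" for p p' q q' V c :: real
    by (simp_all add: diff_divide_distrib mult.commute)
  interpret A: unimodular_pair J "\<lambda>t. f (s t)" "\<lambda>t. f1 (s t) / fg.W (s t)"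
    "\<lambda>t. g (s t)" "\<lambda>t. g1 (s t) / fg.W (s t)"
  proof unfold_locales
    show "open J" "is_interval J" using w_diffeo by (simp_all add: J_def)
    show "continuous_on J (\<lambda>t. f1 (s t) / fg.W (s t))" "continuous_on J (\<lambda>t. g1 (s t) / fg.W (s t))"
      using fg.W_nz sI by (intro continuous_intros cont fg.cont_f1 fg.cont_g1 fg.cont_W; simp)+
    fix t assume t: "t \<in> J"
    show "((\<lambda>t. f (s t)) has_real_derivative f1 (s t) / fg.W (s t)) (at t)"
         "((\<lambda>t. g (s t)) has_real_derivative g1 (s t) / fg.W (s t)) (at t)"
      by (rule chain[OF _ t], rule fg.deriv_f fg.deriv_g, assumption)+
    show "g (s t) > 0"
      using fg.g_pos sI[OF t] by blast
    show "f1 (s t) / fg.W (s t) * g (s t) - f (s t) * (g1 (s t) / fg.W (s t)) = 1"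
      unfolding combine fg.W_def[symmetric] using fg.W_nz[OF sI[OF t]] by simp
  qed
  interpret B: unimodular_pair J "\<lambda>t. h (s t) / \<gamma>" "\<lambda>t. h1 (s t) / fg.W (s t) / \<gamma>"
    "\<lambda>t. k (s t)" "\<lambda>t. k1 (s t) / fg.W (s t)"
  proof unfold_locales
    show "open J" "is_interval J" using w_diffeo by (simp_all add: J_def)
    show "continuous_on J (\<lambda>t. h1 (s t) / fg.W (s t) / \<gamma>)" "continuous_on J (\<lambda>t. k1 (s t) / fg.W (s t))"
      using fg.W_nz sI \<gamma>(1) by (intro continuous_intros cont hk.cont_f1 hk.cont_g1 fg.cont_W; simp)+
    fix t assume t: "t \<in> J"
    show "((\<lambda>t. h (s t) / \<gamma>) has_real_derivative h1 (s t) / fg.W (s t) / \<gamma>) (at t)"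
      by (intro DERIV_cdivide chain[OF _ t]) (rule hk.deriv_f)
    show "((\<lambda>t. k (s t)) has_real_derivative k1 (s t) / fg.W (s t)) (at t)"
      by (rule chain[OF _ t], rule hk.deriv_g, assumption)
    show "k (s t) > 0"
      using hk.g_pos sI[OF t] by blast
    show "h1 (s t) / fg.W (s t) / \<gamma> * k (s t) - h (s t) / \<gamma> * (k1 (s t) / fg.W (s t)) = 1"
      unfolding combine hk.W_def[symmetric] \<gamma>(2)[OF sI[OF t]]
      using fg.W_nz[OF sI[OF t]] \<gamma>(1) by simp
  qed
  have speed_A: "A.speed t r = N_fg (s t) (s r) / fg.W (s t)" if "t \<in> J" for t r
  proof -
    have "A.speed t r = fg.W (s t) / fg.W (s t) + (f1 (s t) * g (s r) - g1 (s t) * f (s r)) / fg.W (s t)"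
      using fg.W_nz[OF sI[OF that]] by (simp add: A.speed_def diff_divide_distrib)
    also have "\<dots> = N_fg (s t) (s r) / fg.W (s t)"
      unfolding add_divide_distrib[symmetric]
      by (rule arg_cong2[of _ _ _ _ "(/)", OF _ refl]) (simp add: N_fg_def fg.W_def algebra_simps)
    finally show ?thesis .
  qed
  have speed_B: "B.speed t r = N_hk (s t) (s r) / hk.W (s t)" if "t \<in> J" for t r
  proof -
    have "B.speed t r = hk.W (s t) / hk.W (s t) + (h1 (s t) * k (s r) - k1 (s t) * h (s r)) / hk.W (s t)"
      using hk.W_nz[OF sI[OF that]] \<gamma>(1) unfolding \<gamma>(2)[OF sI[OF that]] B.speed_def
      by (simp add: diff_divide_distrib mult.commute)
    also have "\<dots> = N_hk (s t) (s r) / hk.W (s t)"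
      unfolding add_divide_distrib[symmetric]
      by (rule arg_cong2[of _ _ _ _ "(/)", OF _ refl]) (simp add: N_hk_def hk.W_def algebra_simps)
    finally show ?thesis .
  qed
  interpret J: two_unimodular_pairs J "\<lambda>t. f (s t)" "\<lambda>t. f1 (s t) / fg.W (s t)"
    "\<lambda>t. g (s t)" "\<lambda>t. g1 (s t) / fg.W (s t)"
    "\<lambda>t. h (s t) / \<gamma>" "\<lambda>t. h1 (s t) / fg.W (s t) / \<gamma>" "\<lambda>t. k (s t)" "\<lambda>t. k1 (s t) / fg.W (s t)"
  proof unfold_locales
    fix t r assume t: "t \<in> J" "r \<in> J"
    show "A.speed t r * B.speed r t = B.speed t r * A.speed r t"
      unfolding speed_A[OF t(1)] speed_A[OF t(2)] speed_B[OF t(1)] speed_B[OF t(2)]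
        \<gamma>(2)[OF sI[OF t(1)]] \<gamma>(2)[OF sI[OF t(2)]]
      using means_equal_imp_partial_derivatives_proportional[OF eq sI[OF t(1)] sI[OF t(2)]]
      by (simp add: mult.commute mult.left_commute)
  qed
  have "J \<noteq> {}" using fg.I_ne by (simp add: J_def)
  from J.equivalent_or_constant_curvature[OF this] show ?thesis
  proof
    assume "pair_equiv J (\<lambda>t. f (s t), \<lambda>t. g (s t)) (\<lambda>t. h (s t) / \<gamma>, \<lambda>t. k (s t))"
    then obtain a b c d where det: "a * d - b * c \<noteq> 0"
      and ab: "\<And>t. t \<in> J \<Longrightarrow> h (s t) / \<gamma> = a * f (s t) + b * g (s t) \<and> k (s t) = c * f (s t) + d * g (s t)"
      unfolding pair_equiv_def by auto
    have "h x = (\<gamma> * a) * f x + (\<gamma> * b) * g x \<and> k x = c * f x + d * g x" if x: "x \<in> I" for x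
    proof -
      have "h x / \<gamma> = a * f x + b * g x" "k x = c * f x + d * g x"
        using ab[of "w x"] x by (auto simp: J_def sw)
      then show ?thesis using \<gamma>(1) by (simp add: field_simps)
    qed
    moreover have "(\<gamma> * a) * d - (\<gamma> * b) * c = \<gamma> * (a * d - b * c)"
      by (simp add: algebra_simps)
    then have "(\<gamma> * a) * d - (\<gamma> * b) * c \<noteq> 0"
      using det \<gamma>(1) by simp
    ultimately have "pair_equiv I (f, g) (h, k)"
      unfolding pair_equiv_def split by blast
    then show ?thesis ..
  next
    assume "\<exists>\<alpha> \<beta>. \<forall>t\<in>J.
      ((\<lambda>t. f1 (s t) / fg.W (s t)) has_real_derivative \<alpha> * f (s t)) (at t) \<and>
      ((\<lambda>t. g1 (s t) / fg.W (s t)) has_real_derivative \<alpha> * g (s t)) (at t) \<and>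
      ((\<lambda>t. h1 (s t) / fg.W (s t) / \<gamma>) has_real_derivative \<beta> * (h (s t) / \<gamma>)) (at t) \<and>
      ((\<lambda>t. k1 (s t) / fg.W (s t)) has_real_derivative \<beta> * k (s t)) (at t)"
    then obtain \<alpha> \<beta> where hill: "\<And>t. t \<in> J \<Longrightarrow>
      ((\<lambda>t. f1 (s t) / fg.W (s t)) has_real_derivative \<alpha> * f (s t)) (at t) \<and>
      ((\<lambda>t. g1 (s t) / fg.W (s t)) has_real_derivative \<alpha> * g (s t)) (at t) \<and>
      ((\<lambda>t. h1 (s t) / fg.W (s t) / \<gamma>) has_real_derivative \<beta> * (h (s t) / \<gamma>)) (at t) \<and>
      ((\<lambda>t. k1 (s t) / fg.W (s t)) has_real_derivative \<beta> * k (s t)) (at t)"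
      by blast
    have solve: "\<exists>a b. \<forall>x\<in>I. r (w x) = a * S_fun \<kappa> (w x) + b * C_fun \<kappa> (w x)"
      if "\<And>t. t \<in> J \<Longrightarrow> (r has_real_derivative r1 t) (at t)"
        "\<And>t. t \<in> J \<Longrightarrow> (r1 has_real_derivative \<kappa> * r t) (at t)" for r r1 :: "real \<Rightarrow> real" and \<kappa>
    proof -
      have "\<exists>a b. \<forall>t\<in>J. r t = a * S_fun \<kappa> t + b * C_fun \<kappa> t \<and>
          r1 t = a * C_fun \<kappa> t + b * \<kappa> * S_fun \<kappa> t"
        by (rule linear_system_solution[OF A.interval_J, where W = "\<lambda>_. 1"])
          (use that in \<open>auto intro!: derivative_eq_intros\<close>)
      then show ?thesis unfolding J_def by blast
    qed
    obtain a b where 1: "\<forall>x\<in>I. f (s (w x)) = a * S_fun \<alpha> (w x) + b * C_fun \<alpha> (w x)"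
      using solve[OF A.deriv_f] hill by blast
    obtain c d where 2: "\<forall>x\<in>I. g (s (w x)) = c * S_fun \<alpha> (w x) + d * C_fun \<alpha> (w x)"
      using solve[OF A.deriv_g] hill by blast
    obtain a' b' where 3: "\<forall>x\<in>I. h (s (w x)) / \<gamma> = a' * S_fun \<beta> (w x) + b' * C_fun \<beta> (w x)"
      using solve[OF B.deriv_f] hill by blast
    obtain c' d' where 4: "\<forall>x\<in>I. k (s (w x)) = c' * S_fun \<beta> (w x) + d' * C_fun \<beta> (w x)"
      using solve[OF B.deriv_g] hill by blast
    have "pair_equiv I (f, g) (S_fun \<alpha> \<circ> w, C_fun \<alpha> \<circ> w)"
      by (rule fg.linear_combinations_imp_pair_equiv[of a _ b _ c d]) (use 1 2 sw in auto)
    moreover have "pair_equiv I (h, k) (S_fun \<beta> \<circ> w, C_fun \<beta> \<circ> w)"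
      by (rule hk.linear_combinations_imp_pair_equiv[of "\<gamma> * a'" _ "\<gamma> * b'" _ c' d'])
        (use 3 4 sw \<gamma>(1) in \<open>auto simp: divide_eq_eq algebra_simps\<close>)
    ultimately show ?thesis
      using w \<gamma>(2) by blast
  qed
qed

end

section \<open>The equivalent conditions\<close>

lemma poly_of_degree_le_2:
  fixes P :: "real poly"
  assumes "degree P \<le> 2"
  shows "P = [:coeff P 0, coeff P 1, coeff P 2:]"
proof (rule poly_eqI)
  fix n :: nat
  consider "n = 0" | "n = 1" | "n = 2" | "n > 2" by linarith
  then show "coeff P n = coeff [:coeff P 0, coeff P 1, coeff P 2:] n"
  proof cases
    case 4
    then have "coeff P n = 0" "n = Suc (Suc (Suc (n - 3)))"
      using assms by (auto intro: coeff_eq_0)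
    then show ?thesis by (metis coeff_0 coeff_pCons_Suc)
  qed (simp_all add: numeral_2_eq_2)
qed

lemma C1_differentiable_onD:
  fixes f :: "real \<Rightarrow> real"
  assumes "f C1_differentiable_on I"
  shows "x \<in> I \<Longrightarrow> (f has_real_derivative deriv f x) (at x)" and "continuous_on I (deriv f)"
proof -
  from assms obtain D where D: "\<And>x. x \<in> I \<Longrightarrow> (f has_real_derivative D x) (at x)" "continuous_on I D"
    unfolding C1_differentiable_on_def has_real_derivative_iff_has_vector_derivative by blast
  then have eq: "deriv f x = D x" if "x \<in> I" for x
    using that DERIV_imp_deriv by blast
  then show "x \<in> I \<Longrightarrow> (f has_real_derivative deriv f x) (at x)"
    using D(1) by simp
  show "continuous_on I (deriv f)"
    using D(2) eq continuous_on_cong by fastforce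
qed

context two_bajraktarevic_pairs
begin

definition means_equal :: bool where
  "means_equal \<longleftrightarrow> (\<forall>x\<in>I. \<forall>y\<in>I. bajraktarevic I f g x y = bajraktarevic I h k x y)"

text \<open>
  The strongest form of the trigonometric alternative, with \<open>w\<close> an antiderivative of the Wronskian. All
  the other conditions are read off from it.
\<close>
lemma means_equal_cases:
  assumes means_equal
  obtains "pair_equiv I (f, g) (h, k)"
  | w \<gamma> \<alpha> \<beta> where "\<And>x. x \<in> I \<Longrightarrow> (w has_real_derivative fg.W x) (at x)"
      "\<And>x. x \<in> I \<Longrightarrow> hk.W x = \<gamma> * fg.W x" "\<gamma> \<noteq> 0"
      "pair_equiv I (f, g) (S_fun \<alpha> \<circ> w, C_fun \<alpha> \<circ> w)"
      "pair_equiv I (h, k) (S_fun \<beta> \<circ> w, C_fun \<beta> \<circ> w)"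
proof -
  obtain x0 where x0: "x0 \<in> I" using fg.I_ne by blast
  have "\<gamma> \<noteq> 0" if "\<forall>x\<in>I. hk.W x = \<gamma> * fg.W x" for \<gamma>
    using that x0 hk.W_nz by force
  with means_equal_imp_equivalent_or_trigonometric assms that show ?thesis
    unfolding means_equal_def by blast
qed

lemma means_equal_if_pair_equiv: "pair_equiv I (f, g) (h, k) \<Longrightarrow> means_equal"
  using pair_equiv_imp_means_equal unfolding means_equal_def by blast

lemma means_equal_if_trigonometric:
  assumes "continuous_on I w" "strictly_monotone_on I w"
    "pair_equiv I (f, g) (S_fun \<alpha> \<circ> w, C_fun \<alpha> \<circ> w)" "pair_equiv I (h, k) (S_fun \<beta> \<circ> w, C_fun \<beta> \<circ> w)"
  shows means_equal
  using trigonometric_imp_means_equal[OF assms] unfolding means_equal_def by simp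

theorem means_equal_iff_trigonometric:
  "means_equal \<longleftrightarrow> pair_equiv I (f, g) (h, k) \<or>
    (\<exists>w \<alpha> \<beta>. continuous_on I w \<and> strictly_monotone_on I w \<and>
       pair_equiv I (f, g) (S_fun \<alpha> \<circ> w, C_fun \<alpha> \<circ> w) \<and>
       pair_equiv I (h, k) (S_fun \<beta> \<circ> w, C_fun \<beta> \<circ> w))"
proof
  assume means_equal
  then show "pair_equiv I (f, g) (h, k) \<or>
    (\<exists>w \<alpha> \<beta>. continuous_on I w \<and> strictly_monotone_on I w \<and>
       pair_equiv I (f, g) (S_fun \<alpha> \<circ> w, C_fun \<alpha> \<circ> w) \<and>
       pair_equiv I (h, k) (S_fun \<beta> \<circ> w, C_fun \<beta> \<circ> w))"
  proof (cases rule: means_equal_cases)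
    case (2 w \<gamma> \<alpha> \<beta>)
    with derivative_continuous_on[OF 2(1)] fg.antiderivative_strictly_monotone[OF 2(1)]
    show ?thesis by blast
  qed blast
qed (use means_equal_if_pair_equiv means_equal_if_trigonometric in blast)

theorem means_equal_iff_quasi_arithmetic_antiderivative:
  "means_equal \<longleftrightarrow> pair_equiv I (f, g) (h, k) \<or>
    (\<exists>w. antiderivative_on I (wronskian f g) w \<and>
       (\<forall>x\<in>I. \<forall>y\<in>I. bajraktarevic I f g x y = bajraktarevic I w (\<lambda>_. 1) x y \<and>
          bajraktarevic I w (\<lambda>_. 1) x y = bajraktarevic I h k x y))"
proof
  assume means_equal
  then show "pair_equiv I (f, g) (h, k) \<or>
    (\<exists>w. antiderivative_on I (wronskian f g) w \<and>
       (\<forall>x\<in>I. \<forall>y\<in>I. bajraktarevic I f g x y = bajraktarevic I w (\<lambda>_. 1) x y \<and>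
          bajraktarevic I w (\<lambda>_. 1) x y = bajraktarevic I h k x y))"
  proof (cases rule: means_equal_cases)
    case (2 w \<gamma> \<alpha> \<beta>)
    have "antiderivative_on I (wronskian f g) w"
      unfolding antiderivative_on_def
      using 2(1) fg.wronskian_eq_W by (auto intro: has_field_derivative_at_within)
    with trigonometric_imp_means_equal[OF derivative_continuous_on[OF 2(1)]
        fg.antiderivative_strictly_monotone[OF 2(1)] 2(4,5)]
    show ?thesis by blast
  qed blast
qed (use means_equal_if_pair_equiv in \<open>auto simp: means_equal_def\<close>)

theorem means_equal_iff_quasi_arithmetic:
  "means_equal \<longleftrightarrow> pair_equiv I (f, g) (h, k) \<or>
    (\<exists>w. continuous_on I w \<and> strictly_monotone_on I w \<and>
       (\<forall>x\<in>I. \<forall>y\<in>I. bajraktarevic I f g x y = bajraktarevic I w (\<lambda>_. 1) x y \<and>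
          bajraktarevic I w (\<lambda>_. 1) x y = bajraktarevic I h k x y))"
proof
  assume means_equal
  then show "pair_equiv I (f, g) (h, k) \<or>
    (\<exists>w. continuous_on I w \<and> strictly_monotone_on I w \<and>
       (\<forall>x\<in>I. \<forall>y\<in>I. bajraktarevic I f g x y = bajraktarevic I w (\<lambda>_. 1) x y \<and>
          bajraktarevic I w (\<lambda>_. 1) x y = bajraktarevic I h k x y))"
  proof (cases rule: means_equal_cases)
    case (2 w \<gamma> \<alpha> \<beta>)
    note w = derivative_continuous_on[OF 2(1)] fg.antiderivative_strictly_monotone[OF 2(1)]
    with trigonometric_imp_means_equal[OF w 2(4,5)] show ?thesis by blast
  qed blast
qed (use means_equal_if_pair_equiv in \<open>auto simp: means_equal_def\<close>)

theorem means_equal_iff_quadratic_identities: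
  "means_equal \<longleftrightarrow> pair_equiv I (f, g) (h, k) \<or>
    (\<exists>a b c A B C \<gamma>. \<forall>x\<in>I.
       a * (f x)\<^sup>2 + b * f x * g x + c * (g x)\<^sup>2 = 1 \<and>
       A * (h x)\<^sup>2 + B * h x * k x + C * (k x)\<^sup>2 = 1 \<and>
       wronskian h k x = \<gamma> * wronskian f g x)"
proof
  assume means_equal
  then show "pair_equiv I (f, g) (h, k) \<or>
    (\<exists>a b c A B C \<gamma>. \<forall>x\<in>I.
       a * (f x)\<^sup>2 + b * f x * g x + c * (g x)\<^sup>2 = 1 \<and>
       A * (h x)\<^sup>2 + B * h x * k x + C * (k x)\<^sup>2 = 1 \<and>
       wronskian h k x = \<gamma> * wronskian f g x)"
  proof (cases rule: means_equal_cases)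
    case (2 w \<gamma> \<alpha> \<beta>)
    have "\<forall>x\<in>I. wronskian h k x = \<gamma> * wronskian f g x"
      using 2(2) fg.wronskian_eq_W hk.wronskian_eq_W by simp
    with fg.trigonometric_imp_quadratic_identity[OF 2(4)] hk.trigonometric_imp_quadratic_identity[OF 2(5)]
    show ?thesis by blast
  qed blast
next
  assume "pair_equiv I (f, g) (h, k) \<or>
    (\<exists>a b c A B C \<gamma>. \<forall>x\<in>I.
       a * (f x)\<^sup>2 + b * f x * g x + c * (g x)\<^sup>2 = 1 \<and>
       A * (h x)\<^sup>2 + B * h x * k x + C * (k x)\<^sup>2 = 1 \<and>
       wronskian h k x = \<gamma> * wronskian f g x)"
  then show means_equal
  proof (elim disjE exE)
    fix a b c A B C \<gamma>
    assume *: "\<forall>x\<in>I. a * (f x)\<^sup>2 + b * f x * g x + c * (g x)\<^sup>2 = 1 \<and>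
       A * (h x)\<^sup>2 + B * h x * k x + C * (k x)\<^sup>2 = 1 \<and>
       wronskian h k x = \<gamma> * wronskian f g x"
    then have "\<forall>x\<in>I. hk.W x = \<gamma> * fg.W x"
      using fg.wronskian_eq_W hk.wronskian_eq_W by simp
    with * have "\<exists>w \<alpha> \<beta>. continuous_on I w \<and> strictly_monotone_on I w \<and>
        pair_equiv I (f, g) (S_fun \<alpha> \<circ> w, C_fun \<alpha> \<circ> w) \<and>
        pair_equiv I (h, k) (S_fun \<beta> \<circ> w, C_fun \<beta> \<circ> w)"
      by (intro quadratic_identities_imp_trigonometric[of a b c A B C \<gamma>]) blast+
    then show means_equal
      using means_equal_if_trigonometric by blast
  qed (rule means_equal_if_pair_equiv)
qed

theorem means_equal_iff_polynomials:
  "means_equal \<longleftrightarrow> pair_equiv I (f, g) (h, k) \<or>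
    (\<exists>P Q :: real poly. degree P \<le> 2 \<and> degree Q \<le> 2 \<and>
       (\<forall>t\<in>(\<lambda>t. f t / g t) ` I. poly P t > 0) \<and>
       (\<forall>t\<in>(\<lambda>t. h t / k t) ` I. poly Q t > 0) \<and>
       (\<exists>\<gamma> \<delta> \<Phi> \<Psi>.
          antiderivative_on ((\<lambda>t. f t / g t) ` I) (\<lambda>t. 1 / poly P t) \<Phi> \<and>
          antiderivative_on ((\<lambda>t. h t / k t) ` I) (\<lambda>t. 1 / poly Q t) \<Psi> \<and>
          (\<forall>x\<in>I. g x = 1 / sqrt (poly P (f x / g x)) \<and>
                 k x = 1 / sqrt (poly Q (h x / k x)) \<and>
                 \<Psi> (h x / k x) = \<gamma> * \<Phi> (f x / g x) + \<delta>)))"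
  unfolding fg.u_def[symmetric] fg.u_def[abs_def, symmetric] hk.u_def[symmetric] hk.u_def[abs_def, symmetric]
proof
  assume means_equal
  then show "pair_equiv I (f, g) (h, k) \<or>
    (\<exists>P Q :: real poly. degree P \<le> 2 \<and> degree Q \<le> 2 \<and>
       (\<forall>t\<in>fg.u ` I. poly P t > 0) \<and> (\<forall>t\<in>hk.u ` I. poly Q t > 0) \<and>
       (\<exists>\<gamma> \<delta> \<Phi> \<Psi>.
          antiderivative_on (fg.u ` I) (\<lambda>t. 1 / poly P t) \<Phi> \<and>
          antiderivative_on (hk.u ` I) (\<lambda>t. 1 / poly Q t) \<Psi> \<and>
          (\<forall>x\<in>I. g x = 1 / sqrt (poly P (fg.u x)) \<and> k x = 1 / sqrt (poly Q (hk.u x)) \<and>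
                 \<Psi> (hk.u x) = \<gamma> * \<Phi> (fg.u x) + \<delta>)))"
  proof (cases rule: means_equal_cases)
    case (2 w \<gamma> \<alpha> \<beta>)
    obtain a b c where q: "\<forall>x\<in>I. a * (f x)\<^sup>2 + b * f x * g x + c * (g x)\<^sup>2 = 1"
      using fg.trigonometric_imp_quadratic_identity[OF 2(4)] by blast
    obtain A B C where Q: "\<forall>x\<in>I. A * (h x)\<^sup>2 + B * h x * k x + C * (k x)\<^sup>2 = 1"
      using hk.trigonometric_imp_quadratic_identity[OF 2(5)] by blast
    note q' = q[unfolded fg.quadratic_identity_iff_poly] and Q' = Q[unfolded hk.quadratic_identity_iff_poly]
    have deg: "degree [:c, b, a:] \<le> 2" "degree [:C, B, A:] \<le> 2"
      by (simp_all add: degree_pCons_eq_if)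
    have \<Phi>: "antiderivative_on (fg.u ` I) (\<lambda>t. 1 / poly [:c, b, a:] t) (\<lambda>t. w (the_inv_into I fg.u t))"
      by (rule fg.antiderivative_on_range[OF _ 2(1)])
        (use q' in \<open>auto simp: power_divide dest!: bspec\<close>)
    have \<Psi>: "antiderivative_on (hk.u ` I) (\<lambda>t. 1 / poly [:C, B, A:] t) (\<lambda>t. \<gamma> * w (the_inv_into I hk.u t))"
    proof (rule hk.antiderivative_on_range)
      show "((\<lambda>x. \<gamma> * w x) has_real_derivative hk.W x) (at x)" if "x \<in> I" for x
        unfolding 2(2)[OF that] by (intro DERIV_cmult 2(1) that)
    qed (use Q' in \<open>auto simp: power_divide dest!: bspec\<close>)
    have "\<gamma> * w (the_inv_into I hk.u (hk.u x)) = \<gamma> * w (the_inv_into I fg.u (fg.u x)) + 0" if "x \<in> I" for x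
      using the_inv_into_f_f[OF fg.u_diffeo(3) that] the_inv_into_f_f[OF hk.u_diffeo(3) that] by simp
    with q' Q' deg \<Phi> \<Psi> show ?thesis
      by (intro disjI2 exI[of _ "[:c, b, a:]"] exI[of _ "[:C, B, A:]"] exI[of _ \<gamma>] exI[of _ "0::real"]
          exI[of _ "\<lambda>t. w (the_inv_into I fg.u t)"] exI[of _ "\<lambda>t. \<gamma> * w (the_inv_into I hk.u t)"]
          conjI) blast+
  qed blast
next
  assume "pair_equiv I (f, g) (h, k) \<or>
    (\<exists>P Q :: real poly. degree P \<le> 2 \<and> degree Q \<le> 2 \<and>
       (\<forall>t\<in>fg.u ` I. poly P t > 0) \<and> (\<forall>t\<in>hk.u ` I. poly Q t > 0) \<and>
       (\<exists>\<gamma> \<delta> \<Phi> \<Psi>.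
          antiderivative_on (fg.u ` I) (\<lambda>t. 1 / poly P t) \<Phi> \<and>
          antiderivative_on (hk.u ` I) (\<lambda>t. 1 / poly Q t) \<Psi> \<and>
          (\<forall>x\<in>I. g x = 1 / sqrt (poly P (fg.u x)) \<and> k x = 1 / sqrt (poly Q (hk.u x)) \<and>
                 \<Psi> (hk.u x) = \<gamma> * \<Phi> (fg.u x) + \<delta>)))"
  then show means_equal
  proof (elim disjE exE conjE)
    fix P Q :: "real poly" and \<gamma> \<delta> \<Phi> \<Psi>
    assume deg: "degree P \<le> 2" "degree Q \<le> 2"
      and pos: "\<forall>t\<in>fg.u ` I. poly P t > 0" "\<forall>t\<in>hk.u ` I. poly Q t > 0"
      and anti: "antiderivative_on (fg.u ` I) (\<lambda>t. 1 / poly P t) \<Phi>"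
        "antiderivative_on (hk.u ` I) (\<lambda>t. 1 / poly Q t) \<Psi>"
      and eqs: "\<forall>x\<in>I. g x = 1 / sqrt (poly P (fg.u x)) \<and> k x = 1 / sqrt (poly Q (hk.u x)) \<and>
                 \<Psi> (hk.u x) = \<gamma> * \<Phi> (fg.u x) + \<delta>"
    obtain a b c where P: "P = [:c, b, a:]" using poly_of_degree_le_2[OF deg(1)] by blast
    obtain A B C where Q: "Q = [:C, B, A:]" using poly_of_degree_le_2[OF deg(2)] by blast
    have q: "\<forall>x\<in>I. a * (f x)\<^sup>2 + b * f x * g x + c * (g x)\<^sup>2 = 1"
      unfolding fg.quadratic_identity_iff_poly using pos(1) eqs unfolding P by blast
    have q': "\<forall>x\<in>I. A * (h x)\<^sup>2 + B * h x * k x + C * (k x)\<^sup>2 = 1"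
      unfolding hk.quadratic_identity_iff_poly using pos(2) eqs unfolding Q by blast
    have "hk.W x = \<gamma> * fg.W x" if x: "x \<in> I" for x
    proof -
      have "(\<Phi> has_real_derivative 1 / poly P (fg.u x)) (at (fg.u x))"
           "(\<Psi> has_real_derivative 1 / poly Q (hk.u x)) (at (hk.u x))"
        using anti x fg.u_diffeo(1) hk.u_diffeo(1) unfolding antiderivative_on_def
        by (metis at_within_open imageI)+
      then have "((\<lambda>x. \<Psi> (hk.u x) - (\<gamma> * \<Phi> (fg.u x) + \<delta>)) has_real_derivative
          1 / poly Q (hk.u x) * (hk.W x / (k x * k x)) -
          (\<gamma> * (1 / poly P (fg.u x) * (fg.W x / (g x * g x))) + 0)) (at x)"
        by (intro DERIV_diff DERIV_add DERIV_cmult DERIV_const DERIV_chain2[OF _ fg.deriv_u[OF x]]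
            DERIV_chain2[OF _ hk.deriv_u[OF x]])
      from derivative_of_zero_function[OF fg.open_I x _ this] eqs
      have "1 / poly Q (hk.u x) * (hk.W x / (k x * k x)) = \<gamma> * (1 / poly P (fg.u x) * (fg.W x / (g x * g x)))"
        by simp
      moreover have p: "poly P (fg.u x) > 0" "poly Q (hk.u x) > 0"
        using pos x by auto
      moreover have "g x * g x = 1 / poly P (fg.u x)" "k x * k x = 1 / poly Q (hk.u x)"
        using bspec[OF eqs x] p by (simp_all add: abs_of_pos)
      ultimately show ?thesis by simp
    qed
    with q q' have "\<exists>w \<alpha> \<beta>. continuous_on I w \<and> strictly_monotone_on I w \<and>
        pair_equiv I (f, g) (S_fun \<alpha> \<circ> w, C_fun \<alpha> \<circ> w) \<and>
        pair_equiv I (h, k) (S_fun \<beta> \<circ> w, C_fun \<beta> \<circ> w)"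
      by (intro quadratic_identities_imp_trigonometric[of a b c A B C \<gamma>]) blast+
    then show means_equal
      using means_equal_if_trigonometric by blast
  qed (rule means_equal_if_pair_equiv)
qed

theorem means_equal_iff_wronskians_of_derivatives:
  assumes f2: "\<And>x. x \<in> I \<Longrightarrow> (f1 has_real_derivative f2 x) (at x)"
    and g2: "\<And>x. x \<in> I \<Longrightarrow> (g1 has_real_derivative g2 x) (at x)"
    and h2: "\<And>x. x \<in> I \<Longrightarrow> (h1 has_real_derivative h2 x) (at x)"
    and k2: "\<And>x. x \<in> I \<Longrightarrow> (k1 has_real_derivative k2 x) (at x)"
  shows "means_equal \<longleftrightarrow> pair_equiv I (f, g) (h, k) \<or>
    (\<exists>\<alpha> \<beta> \<gamma>. \<forall>x\<in>I.
       f2 x * g1 x - f1 x * g2 x = \<alpha> * (fg.W x) ^ 3 \<and>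
       h2 x * k1 x - h1 x * k2 x = \<beta> * (hk.W x) ^ 3 \<and>
       hk.W x = \<gamma> * fg.W x)"
proof
  assume means_equal
  then show "pair_equiv I (f, g) (h, k) \<or>
    (\<exists>\<alpha> \<beta> \<gamma>. \<forall>x\<in>I.
       f2 x * g1 x - f1 x * g2 x = \<alpha> * (fg.W x) ^ 3 \<and>
       h2 x * k1 x - h1 x * k2 x = \<beta> * (hk.W x) ^ 3 \<and>
       hk.W x = \<gamma> * fg.W x)"
  proof (cases rule: means_equal_cases)
    case (2 w \<gamma> \<alpha> \<beta>)
    have "f2 x * g1 x - f1 x * g2 x = - \<alpha> * (fg.W x) ^ 3 \<and>
       h2 x * k1 x - h1 x * k2 x = (- \<beta> / \<gamma>\<^sup>2) * (hk.W x) ^ 3 \<and> hk.W x = \<gamma> * fg.W x" if x: "x \<in> I" for x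
    proof -
      have dW: "(fg.W has_real_derivative f2 x * g x - f x * g2 x) (at x)"
        unfolding fg.W_def[abs_def]
        by (rule derivative_eq_intros fg.deriv_f[OF x] fg.deriv_g[OF x] f2[OF x] g2[OF x] refl)+
          (simp add: algebra_simps)
      have "f2 x * g1 x - f1 x * g2 x = - \<alpha> * (fg.W x)\<^sup>2 * fg.W x"
        by (rule fg.wronskian_of_derivatives_trigonometric[OF 2(4,1) x dW f2[OF x] g2[OF x]])
      moreover have "h2 x * k1 x - h1 x * k2 x = - \<beta> * (fg.W x)\<^sup>2 * hk.W x"
        by (rule hk.wronskian_of_derivatives_trigonometric[OF 2(5,1) x dW h2[OF x] k2[OF x]])
      ultimately show ?thesis
        using 2(3) unfolding 2(2)[OF x] by (simp add: power2_eq_square power3_eq_cube)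
    qed
    then show ?thesis by blast
  qed blast
next
  assume "pair_equiv I (f, g) (h, k) \<or>
    (\<exists>\<alpha> \<beta> \<gamma>. \<forall>x\<in>I.
       f2 x * g1 x - f1 x * g2 x = \<alpha> * (fg.W x) ^ 3 \<and>
       h2 x * k1 x - h1 x * k2 x = \<beta> * (hk.W x) ^ 3 \<and>
       hk.W x = \<gamma> * fg.W x)"
  then show means_equal
  proof (elim disjE exE)
    fix \<alpha> \<beta> \<gamma>
    assume *: "\<forall>x\<in>I.
       f2 x * g1 x - f1 x * g2 x = \<alpha> * (fg.W x) ^ 3 \<and>
       h2 x * k1 x - h1 x * k2 x = \<beta> * (hk.W x) ^ 3 \<and>
       hk.W x = \<gamma> * fg.W x"
    obtain w where w: "\<And>x. x \<in> I \<Longrightarrow> (w has_real_derivative fg.W x) (at x)"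
      using interval_has_antiderivative[OF fg.open_I fg.interval_I fg.I_ne fg.cont_W] by blast
    have "pair_equiv I (f, g) (S_fun (- \<alpha> * 1\<^sup>2) \<circ> w, C_fun (- \<alpha> * 1\<^sup>2) \<circ> w)"
      by (rule fg.curvature_condition_imp_trigonometric[OF f2 g2 _ _ w]) (use * in simp_all)
    moreover have "pair_equiv I (h, k) (S_fun (- \<beta> * \<gamma>\<^sup>2) \<circ> w, C_fun (- \<beta> * \<gamma>\<^sup>2) \<circ> w)"
      by (rule hk.curvature_condition_imp_trigonometric[OF h2 k2 _ _ w]) (use * in simp_all)
    ultimately show means_equal
      using means_equal_if_trigonometric derivative_continuous_on[OF w]
        fg.antiderivative_strictly_monotone[OF w] by blast
  qed (rule means_equal_if_pair_equiv)
qed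

end

lemma bajraktarevic_pairI:
  assumes "I \<noteq> {}" "open I" "is_interval I" "f C1_differentiable_on I" "g C1_differentiable_on I"
    "\<forall>x\<in>I. g x > 0" "\<forall>x\<in>I. deriv (\<lambda>t. f t / g t) x \<noteq> 0"
  shows "bajraktarevic_pair I f (deriv f) g (deriv g)"
proof unfold_locales
  fix x assume x: "x \<in> I"
  have "g x \<noteq> 0" using assms(6) x by force
  then have "((\<lambda>t. f t / g t) has_real_derivative (deriv f x * g x - f x * deriv g x) / (g x * g x)) (at x)"
    by (intro DERIV_divide C1_differentiable_onD(1)[OF assms(4) x] C1_differentiable_onD(1)[OF assms(5) x])
  then show "deriv f x * g x - f x * deriv g x \<noteq> 0"
    using assms(7) x DERIV_imp_deriv by fastforce
qed (use assms C1_differentiable_onD in blast)+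

theorem corollary9:
  fixes I :: "real set" and f g h k :: "real \<Rightarrow> real"
  assumes "I \<noteq> {}" and "open I" and "is_interval I"
    and "f C1_differentiable_on I" and "g C1_differentiable_on I"
    and "h C1_differentiable_on I" and "k C1_differentiable_on I"
    and "\<forall>x\<in>I. g x > 0" and "\<forall>x\<in>I. k x > 0"
    and "\<forall>x\<in>I. deriv (\<lambda>t. f t / g t) x \<noteq> 0"
    and "\<forall>x\<in>I. deriv (\<lambda>t. h t / k t) x \<noteq> 0"
  shows "let
      i = (\<forall>x\<in>I. \<forall>y\<in>I. bajraktarevic I f g x y = bajraktarevic I h k x y);
      ii = (pair_equiv I (f, g) (h, k) \<or>
        (\<exists>\<alpha> \<beta> \<gamma>. \<forall>x\<in>I.
           wronskian (deriv f) (deriv g) x = \<alpha> * (wronskian f g x) ^ 3 \<and>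
           wronskian (deriv h) (deriv k) x = \<beta> * (wronskian h k x) ^ 3 \<and>
           wronskian h k x = \<gamma> * wronskian f g x));
      iii = (pair_equiv I (f, g) (h, k) \<or>
        (\<exists>a b c A B C \<gamma>. \<forall>x\<in>I.
           a * (f x)\<^sup>2 + b * f x * g x + c * (g x)\<^sup>2 = 1 \<and>
           A * (h x)\<^sup>2 + B * h x * k x + C * (k x)\<^sup>2 = 1 \<and>
           wronskian h k x = \<gamma> * wronskian f g x));
      iv = (pair_equiv I (f, g) (h, k) \<or>
        (\<exists>P Q :: real poly. degree P \<le> 2 \<and> degree Q \<le> 2 \<and>
           (\<forall>u\<in>(\<lambda>t. f t / g t) ` I. poly P u > 0) \<and>
           (\<forall>u\<in>(\<lambda>t. h t / k t) ` I. poly Q u > 0) \<and>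
           (\<exists>\<gamma> \<delta> \<Phi> \<Psi>.
              antiderivative_on ((\<lambda>t. f t / g t) ` I) (\<lambda>u. 1 / poly P u) \<Phi> \<and>
              antiderivative_on ((\<lambda>t. h t / k t) ` I) (\<lambda>u. 1 / poly Q u) \<Psi> \<and>
              (\<forall>x\<in>I. g x = 1 / sqrt (poly P (f x / g x)) \<and>
                     k x = 1 / sqrt (poly Q (h x / k x)) \<and>
                     \<Psi> (h x / k x) = \<gamma> * \<Phi> (f x / g x) + \<delta>))));
      v = (pair_equiv I (f, g) (h, k) \<or>
        (\<exists>w \<alpha> \<beta>. continuous_on I w \<and> strictly_monotone_on I w \<and>
           pair_equiv I (f, g) (S_fun \<alpha> \<circ> w, C_fun \<alpha> \<circ> w) \<and>
           pair_equiv I (h, k) (S_fun \<beta> \<circ> w, C_fun \<beta> \<circ> w)));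
      vi = (pair_equiv I (f, g) (h, k) \<or>
        (\<exists>w. antiderivative_on I (wronskian f g) w \<and>
           (\<forall>x\<in>I. \<forall>y\<in>I.
              bajraktarevic I f g x y = bajraktarevic I w (\<lambda>_. 1) x y \<and>
              bajraktarevic I w (\<lambda>_. 1) x y = bajraktarevic I h k x y)));
      vii = (pair_equiv I (f, g) (h, k) \<or>
        (\<exists>w. continuous_on I w \<and> strictly_monotone_on I w \<and>
           (\<forall>x\<in>I. \<forall>y\<in>I.
              bajraktarevic I f g x y = bajraktarevic I w (\<lambda>_. 1) x y \<and>
              bajraktarevic I w (\<lambda>_. 1) x y = bajraktarevic I h k x y)))
    in
      (i \<longleftrightarrow> iii) \<and> (i \<longleftrightarrow> iv) \<and> (i \<longleftrightarrow> v) \<and> (i \<longleftrightarrow> vi) \<and> (i \<longleftrightarrow> vii) \<and>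
      (C2_differentiable_on f I \<and> C2_differentiable_on g I \<and>
       C2_differentiable_on h I \<and> C2_differentiable_on k I \<longrightarrow> (i \<longleftrightarrow> ii))"
proof -
  interpret two_bajraktarevic_pairs I f "deriv f" g "deriv g" h "deriv h" k "deriv k"
    by (intro two_bajraktarevic_pairs.intro bajraktarevic_pairI assms)
  have ii: "means_equal \<longleftrightarrow> pair_equiv I (f, g) (h, k) \<or>
      (\<exists>\<alpha> \<beta> \<gamma>. \<forall>x\<in>I.
         wronskian (deriv f) (deriv g) x = \<alpha> * (wronskian f g x) ^ 3 \<and>
         wronskian (deriv h) (deriv k) x = \<beta> * (wronskian h k x) ^ 3 \<and>
         wronskian h k x = \<gamma> * wronskian f g x)"
    if C2: "C2_differentiable_on f I" "C2_differentiable_on g I"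
      "C2_differentiable_on h I" "C2_differentiable_on k I"
  proof -
    note d2 = C2[unfolded C2_differentiable_on_def, THEN conjunct2, THEN C1_differentiable_onD(1)]
    show ?thesis
      using means_equal_iff_wronskians_of_derivatives[OF d2]
      by (simp add: fg.wronskian_eq_W hk.wronskian_eq_W
          wronskian_def[of "deriv f" "deriv g"] wronskian_def[of "deriv h" "deriv k"] cong: ball_cong)
  qed
  show ?thesis
    unfolding Let_def means_equal_def[symmetric]
    using means_equal_iff_quadratic_identities means_equal_iff_polynomials means_equal_iff_trigonometric
      means_equal_iff_quasi_arithmetic_antiderivative means_equal_iff_quasi_arithmetic ii
    by (intro conjI impI) (assumption | blast)+
qed

end
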